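(* Let $\phi$ be an arbitrary positive function on $\mathbb{N}$ and let $F(\phi)=\{x\in I_{even}\colon a_{2n}(x)\ge\phi(n)\text{ for infinitely many } n\}$. Suppose $\liminf_{n\to\infty}\frac{\log\phi(n)}{2n}=\log B$ with $B\in[1,\infty]$, and if $B=\infty$ suppose $\liminf_{n\to\infty}\frac{\log\log\phi(n)}{2n}=\log b$ with $b\in[1,\infty]$. Then: (i) if $B=1$, then $s_1\le\dim_H F(\phi)\le\dim_H I_{even}$; (ii) if $1<B<\infty$, then $\dim_H F(\phi)=s_B$; (iii) if $B=\infty$ and $b=1$, then $\dim_H F(\phi)=\frac12$; (iv) if $B=\infty$ and $1<b<\infty$, then $\dim_H F(\phi)=\frac{1}{1+b^2}$; (v) if $B=\infty$ and $b=\infty$, then $\dim_H F(\phi)=0$.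
   Context: Every $x\in[0,1)$ has a regular continued fraction expansion $x=[0;a_1(x),a_2(x),\ldots]$. $I_{even}$ is the set of $x\in[0,1)$ with $a_{2k+1}(x)=1$ for all $k\ge0$. For positive integers $a_2,\ldots,a_{2n}$, $q_{2n}=q_{2n}(1,a_2,1,a_4,\ldots,1,a_{2n})$ is the denominator of $[0;1,a_2,1,\ldots,1,a_{2n}]$ (via $q_{-1}=0,q_0=1,q_k=c_kq_{k-1}+q_{k-2}$). For $B>1$, $s_B=\lim_{n\to\infty}\inf\{\rho\ge0\colon \sum_{a_2,\ldots,a_{2n}\in\mathbb{N}}(B^{2n}q_{2n}^2)^{-\rho}\le1\}$ (the limit exists), and $s_1=\lim_{B\to1^+}s_B$ (this right limit exists). $\dim_H$ is Hausdorff dimension. *)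

theory Defs
  imports "HOL-Analysis.Analysis"
begin

section \<open>Hausdorff dimension\<close>

text \<open>
  The contribution of a covering set \<open>U\<close> to the \<open>s\<close>-dimensional Hausdorff sum, with the
  conventions that the empty set contributes 0 and that \<open>|U|^0 = 1\<close> for nonempty \<open>U\<close>
  (whereas \<open>0 powr 0 = 0\<close>).
\<close>
definition hausdorff_gauge :: "real \<Rightarrow> 'a::metric_space set \<Rightarrow> ennreal" where
  "hausdorff_gauge s U =
     (if U = {} then 0 else if s = 0 then 1 else ennreal (diameter U powr s))"

text \<open>
  Covers by sequences include finite covers, because of the empty set. Boundedness of the
  covering sets is required explicitly because \<^const>\<open>diameter\<close> is meaningless for unbounded sets.
\<close>
definition hausdorff_premeasure :: "real \<Rightarrow> real \<Rightarrow> 'a::metric_space set \<Rightarrow> ennreal" where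
  "hausdorff_premeasure s \<delta> A =
     (INF U \<in> {U :: nat \<Rightarrow> 'a set.
                 A \<subseteq> (\<Union>i. U i) \<and> (\<forall>i. bounded (U i) \<and> diameter (U i) \<le> \<delta>)}.
        \<Sum>i. hausdorff_gauge s (U i))"

definition hausdorff_measure :: "real \<Rightarrow> 'a::metric_space set \<Rightarrow> ennreal" where
  "hausdorff_measure s A = (SUP \<delta> \<in> {0<..}. hausdorff_premeasure s \<delta> A)"

definition hausdorff_dim :: "'a::metric_space set \<Rightarrow> ereal" where
  "hausdorff_dim A = (INF s \<in> {s. 0 \<le> s \<and> hausdorff_measure s A = 0}. ereal s)"


section \<open>Regular continued fractions\<close>

definition gauss_map :: "real \<Rightarrow> real" where
  "gauss_map x = frac (1 / x)"

text \<open>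
  The partial quotient \<open>a\<^sub>n(x)\<close>, meaningful for \<open>n \<ge> 1\<close> and \<open>x \<in> [0,1)\<close>. If the expansion of \<open>x\<close>
  terminates before the \<open>n\<close>-th step, then the \<open>(n-1)\<close>-st iterate is 0 and the value is 0 (as
  \<open>1 / 0 = 0\<close>); a partial quotient that exists is always at least 1.
\<close>
definition cf_digit :: "real \<Rightarrow> nat \<Rightarrow> nat" where
  "cf_digit x n = nat \<lfloor>1 / (gauss_map ^^ (n - 1)) x\<rfloor>"

text \<open>
  The denominator \<open>q\<^sub>k\<close> of \<open>[0; c 1, \<dots>, c k]\<close>; the second equation is the recursion
  \<open>q\<^sub>1 = c 1 * q\<^sub>0 + q\<^sub>-\<^sub>1\<close> with \<open>q\<^sub>0 = 1\<close>, \<open>q\<^sub>-\<^sub>1 = 0\<close>. The value \<open>c 0\<close> is not used.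
\<close>
fun cf_denom :: "(nat \<Rightarrow> nat) \<Rightarrow> nat \<Rightarrow> nat" where
  "cf_denom c 0 = 1"
| "cf_denom c (Suc 0) = c 1"
| "cf_denom c (Suc (Suc k)) = c (Suc (Suc k)) * cf_denom c (Suc k) + cf_denom c k"

text \<open>
  For a list \<open>as = [a\<^sub>2, a\<^sub>4, \<dots>, a\<^sub>2\<^sub>n]\<close>, the digit at position \<open>k\<close> (\<open>1 \<le> k \<le> 2n\<close>) of
  \<open>(1, a\<^sub>2, 1, a\<^sub>4, \<dots>, 1, a\<^sub>2\<^sub>n)\<close>.
\<close>
definition interleave_ones :: "nat list \<Rightarrow> nat \<Rightarrow> nat" where
  "interleave_ones as k = (if odd k then 1 else as ! (k div 2 - 1))"

definition I_even :: "real set" where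
  "I_even = {x \<in> {0..<1}. \<forall>k. cf_digit x (2 * k + 1) = 1}"

definition F_set :: "(nat \<Rightarrow> real) \<Rightarrow> real set" where
  "F_set \<phi> = {x \<in> I_even. infinite {n. 1 \<le> n \<and> real (cf_digit x (2 * n)) \<ge> \<phi> n}}"


section \<open>The dimensional numbers\<close>

text \<open>The sum is taken in \<^typ>\<open>ennreal\<close>, so that divergence means the value \<open>\<infinity>\<close>.\<close>
definition s_sum :: "real \<Rightarrow> nat \<Rightarrow> real \<Rightarrow> ennreal" where
  "s_sum B n \<rho> =
     (\<Sum>\<^sub>\<infinity>as\<in>{as :: nat list. length as = n \<and> (\<forall>a\<in>set as. 1 \<le> a)}.
        ennreal ((B ^ (2 * n) * (real (cf_denom (interleave_ones as) (2 * n)))\<^sup>2) powr (- \<rho>)))"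

definition s_approx :: "real \<Rightarrow> nat \<Rightarrow> real" where
  "s_approx B n = Inf {\<rho>. 0 \<le> \<rho> \<and> s_sum B n \<rho> \<le> 1}"

text \<open>Meaningful for \<open>B > 1\<close>, where the limit exists.\<close>
definition s_num :: "real \<Rightarrow> real" where
  "s_num B = lim (\<lambda>n. s_approx B n)"

definition s_one :: real where
  "s_one = Lim (at_right 1) s_num"


section \<open>The logarithm with \<open>log \<infinity> = \<infinity>\<close>\<close>

text \<open>Used for arguments in \<open>[1, \<infinity>]\<close> only.\<close>
definition elog :: "ereal \<Rightarrow> ereal" where
  "elog x = (if x = \<infinity> then \<infinity> else ereal (ln (real_of_ereal x)))"

end

theory Submission
  imports Defs "HOL-Probability.Probability"
begin

text \<open>
  If \<open>x = [0; 1, a, \<dots>]\<close> then \<open>x = 1 - 1 / (a + 1 + y)\<close>, where \<open>y\<close> is the second iterate of \<open>x\<close> under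
  the Gauss map. So \<open>I_even\<close> is the limit set of the maps \<open>y \<mapsto> 1 - 1 / (a + 1 + y)\<close>, and the
  composition along a word \<open>u = a\<^sub>2 a\<^sub>4 \<dots> a\<^sub>2\<^sub>n\<close> contracts by \<open>q\<^sub>2\<^sub>n(u)\<^sup>-\<^sup>2\<close> up to a factor 4, where \<open>q\<^sub>2\<^sub>n\<close> is
  multiplicative up to a factor 2.

  The upper bounds come from the covers of \<open>F_set \<phi>\<close> by the sets of points with a prefix \<open>u\<close> of length \<open>n\<close>
  followed by a digit \<open>\<ge> \<phi> (n + 1)\<close>, whose diameters are at most \<open>1 / (\<phi> (n + 1) q(u)\<^sup>2)\<close>.
  By submultiplicativity the sums defining \<open>s\<^sub>B\<close> decay geometrically in \<open>n\<close> for exponents above \<open>s\<^sub>B\<close>.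
  If \<open>\<phi>\<close> grows doubly exponentially with base \<open>c\<close> and \<open>1 < d < c\<close>, one only uses the \<open>n\<close> at which
  \<open>(ln a\<^sub>2\<^sub>n) / d\<^sup>n\<close> attains a new maximum: there \<open>q(u) \<le> 4\<^sup>n a\<^sub>2\<^sub>n\<^bsup>1/(d - 1)\<^esup>\<close>, so that the
  diameters are of order \<open>q(u)\<^bsup>-(d + 1)\<^esup>\<close>.

  The lower bounds come from the mass distribution principle for random sequences of independent words of a
  fixed length: a few sparsely placed words (or all of them, in the doubly exponential case) contain a huge
  uniformly distributed digit, the others are drawn from a finite set with weights \<open>q(u)\<^sup>-\<^sup>2\<^sup>s\<close>.
\<close>

section \<open>Hausdorff dimension\<close>

text \<open>Covering by a prefix \<open>u\<close> and a next digit at least \<phi> cannot give a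
  bound below 1/2: already for words of one length the sum of q(u)^(-2s) diverges when s \<le> 1/2.
  Record times break this barrier because a large q(u) then forces an even larger next digit; the
  power 2 of q becomes d + 1, and convergence only needs s (d + 1) > 1. In the lower bounds
  everything is measured by the ratio \<open>R\<close> of the mass of a cylinder to q^(-2s). A digit
  uniform in [N, 2N) has all its N children in an interval of length about 1 / (N q^2), so
  \<open>R\<close> has to be of order N^(-s) before it; the digit then multiplies \<open>R\<close>
  by about N^(2s - 1). For exponential \<phi> the ordinary words drive \<open>R\<close> down to
  N^(-s), which they can do when s < s_B. For doubly exponential \<phi> the earlier huge digits do
  it themselves: (1 - 2s) / (\<beta> - 1) > s says s (1 + \<beta>) < 1. The factor 2 lost at each
  concatenation compounds exponentially. It is paid for by the gap between s and the critical
  exponent, together with q(u) \<ge> 2^n or with the growth of d^n.\<close>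

text \<open>Borel-Cantelli: a point in infinitely many \<open>J i\<close> stays covered when
  finitely many indices are discarded, and the remaining tail of the sum is as small as
  desired.\<close>

lemma hausdorff_measure_limsup_null:
  fixes J :: "'i::countable \<Rightarrow> 'a::metric_space set"
  assumes s: "0 < s" and summable: "(\<lambda>i. D i powr s) summable_on I"
    and bdd: "\<And>i. i \<in> I \<Longrightarrow> bounded (J i)" and diam: "\<And>i. i \<in> I \<Longrightarrow> diameter (J i) \<le> D i"
    and A: "\<And>x. x \<in> A \<Longrightarrow> infinite {i \<in> I. x \<in> J i}"
  shows "hausdorff_measure s A = 0"
proof -
  have "hausdorff_premeasure s \<delta> A \<le> ennreal \<epsilon>" if \<delta>: "0 < \<delta>" and \<epsilon>: "0 < \<epsilon>" for \<delta> \<epsilon> :: real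
  proof -
    \<comment> \<open>A single tail term is at most \<eta>, so the bound \<delta>^s forces every
      remaining set to have diameter at most \<delta>.\<close>
    define \<eta> where "\<eta> = min \<epsilon> (\<delta> powr s)"
    have \<eta>: "\<eta> > 0" using \<delta> \<epsilon> by (simp add: \<eta>_def)
    obtain F where F: "finite F" "F \<subseteq> I"
      and approx: "dist (\<Sum>i\<in>F. D i powr s) (\<Sum>\<^sub>\<infinity>i\<in>I. D i powr s) \<le> \<eta>"
      using has_sum_finite_approximation[OF has_sum_infsum[OF summable] \<eta>] by blast
    have tail: "(\<Sum>i\<in>G. D i powr s) \<le> \<eta>" if G: "finite G" "G \<subseteq> I - F" for G
    proof -
      have "(\<Sum>i\<in>F. D i powr s) + (\<Sum>i\<in>G. D i powr s) = (\<Sum>i\<in>F \<union> G. D i powr s)"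
        using F G by (subst sum.union_disjoint) auto
      also have "\<dots> \<le> (\<Sum>\<^sub>\<infinity>i\<in>I. D i powr s)"
        using F G by (intro finite_sum_le_infsum summable) auto
      finally show ?thesis using approx by (simp add: dist_real_def)
    qed
    have small: "D i \<le> \<delta>" if "i \<in> I - F" for i
    proof (rule ccontr)
      assume "\<not> D i \<le> \<delta>"
      then have "\<delta> powr s < D i powr s" using \<delta> s by (intro powr_less_mono2) auto
      moreover have "D i powr s \<le> \<eta>" using tail[of "{i}"] that by simp
      ultimately show False by (simp add: \<eta>_def)
    qed
    define U where "U n = (if n \<in> to_nat ` (I - F) then J (from_nat n) else {})" for n :: nat
    have "A \<subseteq> (\<Union>n. U n)"
    proof
      fix x assume "x \<in> A"
      then have "\<not> {i \<in> I. x \<in> J i} \<subseteq> F" using A F(1) finite_subset by blast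
      then obtain i where "i \<in> I - F" "x \<in> J i" by blast
      then show "x \<in> (\<Union>n. U n)" by (auto simp: U_def intro!: exI[of _ "to_nat i"])
    qed
    moreover have "bounded (U n) \<and> diameter (U n) \<le> \<delta>" for n
    proof (cases "n \<in> to_nat ` (I - F)")
      case True
      then obtain i where i: "i \<in> I - F" "n = to_nat i" by blast
      have "U n = J i" using i by (auto simp: U_def)
      moreover have "bounded (J i)" "diameter (J i) \<le> D i" using i bdd diam by blast+
      ultimately show ?thesis using small[OF i(1)] by simp
    next
      case False
      then show ?thesis using \<delta> by (simp add: U_def)
    qed
    moreover have "(\<Sum>n. hausdorff_gauge s (U n)) \<le> ennreal \<epsilon>"
    proof (rule suminf_le_const[OF summableI])
      fix m
      define G where "G = {i \<in> I - F. to_nat i < m}"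
      have G: "{..<m} \<inter> to_nat ` (I - F) = to_nat ` G" "G \<subseteq> I - F" unfolding G_def by blast+
      have "finite (to_nat ` G)" unfolding G(1)[symmetric] by simp
      then have fin: "finite G" by (rule finite_imageD) (rule inj_on_subset[OF inj_to_nat subset_UNIV])
      have "(\<Sum>n<m. hausdorff_gauge s (U n)) = (\<Sum>n\<in>to_nat ` G. hausdorff_gauge s (U n))"
        unfolding G(1)[symmetric]
        by (rule sum.mono_neutral_right) (auto simp: U_def hausdorff_gauge_def)
      also have "\<dots> = (\<Sum>i\<in>G. hausdorff_gauge s (U (to_nat i)))"
        by (subst sum.reindex) (auto intro: inj_on_subset[OF inj_to_nat])
      also have "\<dots> = (\<Sum>i\<in>G. hausdorff_gauge s (J i))"
        using G(2) by (intro sum.cong refl) (auto simp: U_def)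
      also have "\<dots> \<le> (\<Sum>i\<in>G. ennreal (D i powr s))"
      proof (rule sum_mono)
        fix i assume "i \<in> G"
        then have i: "i \<in> I" using G(2) by auto
        show "hausdorff_gauge s (J i) \<le> ennreal (D i powr s)"
          using s diameter_ge_0[OF bdd[OF i]] diam[OF i]
          by (auto simp: hausdorff_gauge_def intro!: ennreal_leI powr_mono2)
      qed
      also have "\<dots> = ennreal (\<Sum>i\<in>G. D i powr s)" by simp
      also have "\<dots> \<le> ennreal \<epsilon>"
        using tail[OF fin G(2)] by (intro ennreal_leI) (simp add: \<eta>_def)
      finally show "(\<Sum>n<m. hausdorff_gauge s (U n)) \<le> ennreal \<epsilon>" .
    qed
    ultimately show ?thesis unfolding hausdorff_premeasure_def
      by (intro INF_lower2[of U]) auto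
  qed
  then have "hausdorff_premeasure s \<delta> A \<le> 0" if "0 < \<delta>" for \<delta>
    using that by - (rule ennreal_le_epsilon, simp)
  then have "hausdorff_measure s A \<le> 0" unfolding hausdorff_measure_def by (intro SUP_least) simp
  then show ?thesis by simp
qed

lemma hausdorff_dim_le:
  assumes "0 \<le> s" "hausdorff_measure s A = 0"
  shows "hausdorff_dim A \<le> ereal s"
  unfolding hausdorff_dim_def using assms by (intro INF_lower) auto

lemma hausdorff_dim_nonneg: "0 \<le> hausdorff_dim A"
  unfolding hausdorff_dim_def by (intro INF_greatest) auto

lemma hausdorff_premeasure_mono: "A \<subseteq> A' \<Longrightarrow> hausdorff_premeasure s \<delta> A \<le> hausdorff_premeasure s \<delta> A'"
  unfolding hausdorff_premeasure_def by (rule INF_superset_mono) auto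

lemma hausdorff_measure_mono: "A \<subseteq> A' \<Longrightarrow> hausdorff_measure s A \<le> hausdorff_measure s A'"
  unfolding hausdorff_measure_def by (rule SUP_mono) (auto intro: hausdorff_premeasure_mono)

lemma hausdorff_dim_mono: "A \<subseteq> A' \<Longrightarrow> hausdorff_dim A \<le> hausdorff_dim A'"
  unfolding hausdorff_dim_def
proof (rule INF_superset_mono)
  assume A: "A \<subseteq> A'"
  show "{s. 0 \<le> s \<and> hausdorff_measure s A' = 0} \<subseteq> {s. 0 \<le> s \<and> hausdorff_measure s A = 0}"
    by clarify (metis A hausdorff_measure_mono le_zero_eq)
qed simp

text \<open>Covers of any mesh may be tested, because lowering the exponent only increases the sum
  of a cover whose sets have diameter at most 1. It is therefore enough to look at \<delta> =
  1.\<close>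

lemma hausdorff_dim_ge:
  fixes A :: "'a::metric_space set"
  assumes s: "0 < s" and c: "0 < c"
    and cover: "\<And>U :: nat \<Rightarrow> 'a set. A \<subseteq> (\<Union>i. U i) \<Longrightarrow> (\<And>i. bounded (U i)) \<Longrightarrow>
        ennreal c \<le> (\<Sum>i. hausdorff_gauge s (U i))"
  shows "ereal s \<le> hausdorff_dim A"
  unfolding hausdorff_dim_def
proof (rule INF_greatest, clarsimp)
  fix t assume t: "0 \<le> t" "hausdorff_measure t A = 0"
  show "s \<le> t"
  proof (rule ccontr)
    assume ts: "\<not> s \<le> t"
    have "ennreal c \<le> hausdorff_premeasure t 1 A"
      unfolding hausdorff_premeasure_def
    proof (rule INF_greatest, clarsimp)
      fix U :: "nat \<Rightarrow> 'a set"
      assume U: "A \<subseteq> (\<Union>i. U i)" "\<forall>i. bounded (U i) \<and> diameter (U i) \<le> 1"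
      have "hausdorff_gauge s (U i) \<le> hausdorff_gauge t (U i)" for i
      proof -
        have "0 \<le> diameter (U i)" "diameter (U i) \<le> 1" using U(2) diameter_ge_0 by auto
        then have "diameter (U i) powr s \<le> diameter (U i) powr t" "diameter (U i) powr s \<le> 1"
          using ts s t by (cases "diameter (U i) = 0"; force intro: powr_mono' powr_le1)+
        then show ?thesis using s by (auto simp: hausdorff_gauge_def intro: ennreal_leI)
      qed
      then show "ennreal c \<le> (\<Sum>i. hausdorff_gauge t (U i))"
        using cover[OF U(1)] U(2) by (meson order_trans suminf_le summableI)
    qed
    also have "\<dots> \<le> hausdorff_measure t A"
      unfolding hausdorff_measure_def by (rule SUP_upper) auto
    finally show False using t c by auto
  qed
qed

section \<open>Product measures and the mass distribution principle\<close>

lemma emeasure_PiM_cylinder: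
  fixes p :: "nat \<Rightarrow> 'b pmf"
  shows "emeasure (PiM UNIV (\<lambda>i. measure_pmf (p i))) {\<omega>. (\<forall>j<i. \<omega> j = u j) \<and> \<omega> i \<in> S} =
      ennreal ((\<Prod>j<i. pmf (p j) (u j)) * measure_pmf.prob (p i) S)"
    and "{\<omega>. (\<forall>j<i. \<omega> j = u j) \<and> \<omega> i \<in> S} \<in> sets (PiM UNIV (\<lambda>i. measure_pmf (p i)))"
proof -
  interpret product_prob_space "\<lambda>i. measure_pmf (p i)" UNIV
    by unfold_locales
  define X where "X j = (if j < i then {u j} else S)" for j
  have eq: "{\<omega>. (\<forall>j<i. \<omega> j = u j) \<and> \<omega> i \<in> S} = emb UNIV {..i} (Pi\<^sub>E {..i} X)"
  proof -
    have "\<omega> \<in> emb UNIV {..i} (Pi\<^sub>E {..i} X) \<longleftrightarrow> (\<forall>j\<le>i. \<omega> j \<in> X j)" for \<omega>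
      by (auto simp: prod_emb_def PiE_iff)
    moreover have "(\<forall>j\<le>i. \<omega> j \<in> X j) \<longleftrightarrow> (\<forall>j<i. \<omega> j = u j) \<and> \<omega> i \<in> S" for \<omega>
      unfolding le_less by (auto simp: X_def)
    ultimately show ?thesis by (intro set_eqI) simp
  qed
  have "emeasure (PiM UNIV (\<lambda>i. measure_pmf (p i))) (emb UNIV {..i} (Pi\<^sub>E {..i} X)) =
      (\<Prod>j\<in>{..i}. emeasure (measure_pmf (p j)) (X j))"
    by (rule emeasure_PiM_emb) auto
  also have "\<dots> = (\<Prod>j\<in>insert i {..<i}. emeasure (measure_pmf (p j)) (X j))"
    by (intro prod.cong) auto
  also have "\<dots> =
     emeasure (measure_pmf (p i)) S * (\<Prod>j<i. ennreal (pmf (p j) (u j)))"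
    by (auto simp: X_def emeasure_pmf_single intro!: arg_cong2[where f = "(*)"] prod.cong)
  also have "\<dots> = ennreal ((\<Prod>j<i. pmf (p j) (u j)) * measure_pmf.prob (p i) S)"
    by (simp add: measure_pmf.emeasure_eq_measure prod_ennreal ennreal_mult' prod_nonneg mult.commute)
  finally show "emeasure (PiM UNIV (\<lambda>i. measure_pmf (p i))) {\<omega>. (\<forall>j<i. \<omega> j = u j) \<and> \<omega> i \<in> S} =
      ennreal ((\<Prod>j<i. pmf (p j) (u j)) * measure_pmf.prob (p i) S)"
    unfolding eq .
  show "{\<omega>. (\<forall>j<i. \<omega> j = u j) \<and> \<omega> i \<in> S} \<in> sets (PiM UNIV (\<lambda>i. measure_pmf (p i)))"
    unfolding eq by (rule sets_PiM_I) auto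
qed

text \<open>The image measure under \<open>X\<close> is never formed: each covering set is replaced
  by a measurable set of sequences containing its preimage. The mass of that set is controlled at
  the first coordinate where two sequences of the preimage part, which explains the form of
  \<open>ball\<close>.\<close>

lemma mass_distribution_principle:
  fixes p :: "nat \<Rightarrow> 'b pmf" and X :: "(nat \<Rightarrow> 'b) \<Rightarrow> 'a::metric_space"
  assumes s: "0 < s" and C: "0 < C"
    and mass0: "\<And>\<omega>. \<omega> \<in> \<Omega> \<Longrightarrow> (\<lambda>i. \<Prod>j<i. pmf (p j) (\<omega> j)) \<longlonglongrightarrow> 0"
    and \<Omega>: "\<Omega> = {\<omega>. \<forall>i. \<omega> i \<in> set_pmf (p i)}"
    and ball: "\<And>U i \<omega> \<omega>'. bounded U \<Longrightarrow> \<omega> \<in> \<Omega> \<Longrightarrow> \<omega>' \<in> \<Omega> \<Longrightarrow> X \<omega> \<in> U \<Longrightarrow> X \<omega>' \<in> U \<Longrightarrow>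
       (\<And>j. j < i \<Longrightarrow> \<omega>' j = \<omega> j) \<Longrightarrow> \<omega>' i \<noteq> \<omega> i \<Longrightarrow>
       (\<Prod>j<i. pmf (p j) (\<omega> j)) *
         measure_pmf.prob (p i) {\<omega>'' i |\<omega>''. \<omega>'' \<in> \<Omega> \<and> X \<omega>'' \<in> U \<and> (\<forall>j<i. \<omega>'' j = \<omega> j)}
       \<le> C * diameter U powr s"
  shows "ereal s \<le> hausdorff_dim (X ` \<Omega>)"
proof (rule hausdorff_dim_ge[OF s, of "1 / C"])
  show "0 < 1 / C" using C by simp
  fix U :: "nat \<Rightarrow> 'a set"
  assume cov: "X ` \<Omega> \<subseteq> (\<Union>i. U i)" and bdd: "\<And>i. bounded (U i)"
  let ?M = "PiM UNIV (\<lambda>i. measure_pmf (p i))"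
  interpret product_prob_space "\<lambda>i. measure_pmf (p i)" UNIV
    by unfold_locales
  have "\<exists>E. E \<in> sets ?M \<and> {\<omega> \<in> \<Omega>. X \<omega> \<in> U n} \<subseteq> E \<and> emeasure ?M E \<le> ennreal C * hausdorff_gauge s (U n)"
    for n
  proof -
    define V where "V = {\<omega> \<in> \<Omega>. X \<omega> \<in> U n}"
    consider "V = {}" | \<omega> where "V = {\<omega>}" | \<omega> \<omega>' where "\<omega> \<in> V" "\<omega>' \<in> V" "\<omega> \<noteq> \<omega>'"
      by blast
    then have "\<exists>E. E \<in> sets ?M \<and> V \<subseteq> E \<and> emeasure ?M E \<le> ennreal C * hausdorff_gauge s (U n)"
    proof cases
      case 1
      then show ?thesis by (intro exI[of _ "{}"]) auto
    next
      \<comment> \<open>A single point may be covered by a set of diameter 0, where the gauge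
        vanishes, so its mass has to be 0; \<open>mass0\<close> provides this.\<close>
      case (2 \<omega>)
      then have \<omega>: "\<omega> \<in> \<Omega>" by (auto simp: V_def)
      define E where "E = (\<Inter>i. {\<omega>'. (\<forall>j<i. \<omega>' j = \<omega> j) \<and> \<omega>' i \<in> UNIV})"
      have E: "E \<in> sets ?M" unfolding E_def
        by (rule sets.countable_INT) (auto simp only: emeasure_PiM_cylinder(2))
      have "emeasure ?M E \<le> ennreal (\<Prod>j<i. pmf (p j) (\<omega> j))" for i
      proof -
        have "emeasure ?M E \<le> emeasure ?M {\<omega>'. (\<forall>j<i. \<omega>' j = \<omega> j) \<and> \<omega>' i \<in> UNIV}"
          using emeasure_PiM_cylinder(2)[where S=UNIV] by (intro emeasure_mono) (auto simp: E_def)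
        also have "\<dots> = ennreal (\<Prod>j<i. pmf (p j) (\<omega> j))"
          by (subst emeasure_PiM_cylinder) simp
        finally show ?thesis .
      qed
      moreover have "(\<lambda>i. ennreal (\<Prod>j<i. pmf (p j) (\<omega> j))) \<longlonglongrightarrow> ennreal 0"
        by (intro tendsto_ennrealI mass0 \<omega>)
      ultimately have "emeasure ?M E \<le> ennreal 0"
        by (intro LIMSEQ_le_const[of "\<lambda>i. ennreal (\<Prod>j<i. pmf (p j) (\<omega> j))"]) blast+
      then show ?thesis using E 2 by (intro exI[of _ E]) (auto simp: E_def)
    next
      case (3 \<omega> \<omega>')
      define Q where "Q i \<longleftrightarrow> (\<exists>\<omega>1\<in>V. \<exists>\<omega>2\<in>V. \<omega>1 i \<noteq> \<omega>2 i)" for i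
      have "\<exists>i. Q i" using 3 by (auto simp: Q_def fun_eq_iff)
      \<comment> \<open>All of \<open>V\<close> agrees below this least index of disagreement, so
        \<open>V\<close> lies in the cylinder that fixes these coordinates and restricts coordinate
        \<open>i\<close> to \<open>S\<close>.\<close>
      define i where "i = (LEAST i. Q i)"
      have "Q i" unfolding i_def by (rule LeastI_ex) fact
      then obtain \<omega>1 \<omega>2 where \<omega>12: "\<omega>1 \<in> V" "\<omega>2 \<in> V" "\<omega>2 i \<noteq> \<omega>1 i" unfolding Q_def by blast
      have agree: "\<omega>3 j = \<omega>1 j" if "\<omega>3 \<in> V" "j < i" for \<omega>3 j
        using not_less_Least[OF that(2)[unfolded i_def]] that(1) \<omega>12(1) by (auto simp: Q_def)
      define S where "S = {\<omega>'' i |\<omega>''. \<omega>'' \<in> \<Omega> \<and> X \<omega>'' \<in> U n \<and> (\<forall>j<i. \<omega>'' j = \<omega>1 j)}"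
      define E where "E = {\<omega>'. (\<forall>j<i. \<omega>' j = \<omega>1 j) \<and> \<omega>' i \<in> S}"
      have "emeasure ?M E = ennreal ((\<Prod>j<i. pmf (p j) (\<omega>1 j)) * measure_pmf.prob (p i) S)"
        unfolding E_def by (rule emeasure_PiM_cylinder)
      also have "\<dots> \<le> ennreal (C * diameter (U n) powr s)"
        unfolding S_def
      proof (intro ennreal_leI ball)
        show "\<omega>1 \<in> \<Omega>" "\<omega>2 \<in> \<Omega>" "X \<omega>1 \<in> U n" "X \<omega>2 \<in> U n" using \<omega>12 by (simp_all add: V_def)
      qed (use \<omega>12 agree bdd in blast)+
      also have "\<dots> = ennreal C * hausdorff_gauge s (U n)"
        using \<omega>12 s C by (auto simp: hausdorff_gauge_def V_def ennreal_mult)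
      finally have "emeasure ?M E \<le> ennreal C * hausdorff_gauge s (U n)" .
      moreover have "E \<in> sets ?M" unfolding E_def by (rule emeasure_PiM_cylinder)
      moreover have "V \<subseteq> E" using agree by (auto simp: E_def S_def V_def)
      ultimately show ?thesis by blast
    qed
    then show ?thesis unfolding V_def .
  qed
  then obtain E where E: "\<And>n. E n \<in> sets ?M" "\<And>n. {\<omega> \<in> \<Omega>. X \<omega> \<in> U n} \<subseteq> E n"
      "\<And>n. emeasure ?M (E n) \<le> ennreal C * hausdorff_gauge s (U n)"
    using choice[OF allI[of "\<lambda>n. \<exists>E. E \<in> sets ?M \<and> {\<omega> \<in> \<Omega>. X \<omega> \<in> U n} \<subseteq> E \<and>
      emeasure ?M E \<le> ennreal C * hausdorff_gauge s (U n)"]] by blast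
  have "AE \<omega> in ?M. \<forall>i. \<omega> i \<in> set_pmf (p i)"
    unfolding AE_all_countable
    by (intro allI AE_PiM_component) (auto simp: AE_measure_pmf prob_space_measure_pmf)
  then have "AE \<omega> in ?M. \<omega> \<in> (\<Union>n. E n)"
  proof eventually_elim
    case (elim \<omega>)
    then have "\<omega> \<in> \<Omega>" by (simp add: \<Omega>)
    then obtain n where "X \<omega> \<in> U n" using cov by blast
    then show ?case using E(2)[of n] \<open>\<omega> \<in> \<Omega>\<close> by blast
  qed
  then have "emeasure ?M (\<Union>n. E n) = 1"
    using E(1) by (subst P.emeasure_eq_1_AE) auto
  then have "1 \<le> (\<Sum>n. emeasure ?M (E n))"
    using E(1) emeasure_subadditive_countably[of E ?M] by auto
  also have "\<dots> \<le> (\<Sum>n. ennreal C * hausdorff_gauge s (U n))"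
    by (intro suminf_le E(3) summableI)
  also have "\<dots> = ennreal C * (\<Sum>n. hausdorff_gauge s (U n))" by simp
  finally have "ennreal (1 / C) * 1 \<le> ennreal (1 / C) * (ennreal C * (\<Sum>n. hausdorff_gauge s (U n)))"
    by (intro mult_left_mono) auto
  then show "ennreal (1 / C) \<le> (\<Sum>n. hausdorff_gauge s (U n))"
    using C by (simp add: mult.assoc[symmetric] ennreal_mult[symmetric])
qed

section \<open>Continued fractions with odd-indexed digits 1\<close>

text \<open>The two entries of the product of the matrices ((1, a), (1, a + 1)) applied to the
  column (y, 1). Each matrix encodes y \<mapsto> [0; 1, a + y] = (a + y) / (a + 1 + y) and has
  determinant 1.\<close>

fun cf_num :: "nat list \<Rightarrow> real \<Rightarrow> real" and cf_den :: "nat list \<Rightarrow> real \<Rightarrow> real" where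
  "cf_num [] y = y"
| "cf_num (a # u) y = cf_num u y + a * cf_den u y"
| "cf_den [] y = 1"
| "cf_den (a # u) y = cf_num u y + (a + 1) * cf_den u y"

definition cf_map :: "nat list \<Rightarrow> real \<Rightarrow> real" where
  "cf_map u y = cf_num u y / cf_den u y"

definition q_even :: "nat list \<Rightarrow> real" where
  "q_even u = cf_den u 0"

abbreviation pos_digits :: "nat list \<Rightarrow> bool" where
  "pos_digits u \<equiv> \<forall>a\<in>set u. 1 \<le> a"

lemma
  assumes "0 \<le> y"
  shows cf_num_nonneg: "0 \<le> cf_num u y" and cf_den_ge1: "1 \<le> cf_den u y"
proof (induction u)
  case (Cons a u)
  have "1 * 1 \<le> (real a + 1) * cf_den u y"
    using Cons by (intro mult_mono) auto
  with Cons assms show "0 \<le> cf_num (a # u) y" "1 \<le> cf_den (a # u) y" by auto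
qed (use assms in simp_all)

lemma cf_map_Nil [simp]: "cf_map [] y = y"
  by (simp add: cf_map_def)

lemma cf_map_Cons:
  assumes "0 \<le> y"
  shows "cf_map (a # u) y = 1 - 1 / (a + 1 + cf_map u y)"
proof -
  have d: "0 < cf_den u y" "0 < cf_den (a # u) y"
    using cf_den_ge1[OF assms, of u] cf_den_ge1[OF assms, of "a # u"] by linarith+
  have num: "cf_num (a # u) y = cf_den (a # u) y - cf_den u y" by (simp add: algebra_simps)
  have "a + 1 + cf_map u y = cf_den (a # u) y / cf_den u y"
    using d(1) by (simp add: cf_map_def field_simps)
  then have "1 / (a + 1 + cf_map u y) = cf_den u y / cf_den (a # u) y" by simp
  then show ?thesis
    using d by (simp add: cf_map_def[of "a # u"] num diff_divide_distrib add_ac del: cf_den.simps cf_num.simps)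
qed

lemma cf_den_Cons: "0 \<le> y \<Longrightarrow> cf_den (a # u) y = (a + 1 + cf_map u y) * cf_den u y"
  using cf_den_ge1[of y u] by (simp add: cf_map_def field_simps)

lemma cf_map_nonneg: "0 \<le> y \<Longrightarrow> 0 \<le> cf_map u y"
  using cf_den_ge1[of y u] cf_num_nonneg[of y u] by (simp add: cf_map_def)

lemma cf_map_le1: "0 \<le> y \<Longrightarrow> y \<le> 1 \<Longrightarrow> cf_map u y \<le> 1"
  by (cases u) (auto simp: cf_map_Cons cf_map_nonneg)

lemma cf_map_append: "0 \<le> y \<Longrightarrow> cf_map (u @ v) y = cf_map u (cf_map v y)"
  by (induction u) (auto simp: cf_map_Cons cf_map_nonneg)

text \<open>The chain rule in disguise: \<open>cf_map u\<close> has derivative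
  \<open>cf_den u y\<close> to the power -2 at \<open>y\<close>.\<close>

lemma cf_den_append: "0 \<le> y \<Longrightarrow> cf_den (u @ v) y = cf_den u (cf_map v y) * cf_den v y"
  by (induction u) (auto simp: cf_den_Cons cf_map_nonneg cf_map_append simp del: cf_den.simps(2))

text \<open>Moebius maps of determinant 1 have exactly factoring difference quotients. The distance
  estimates from above and from below both rest on this identity.\<close>

lemma cf_map_diff:
  assumes "0 \<le> y" "0 \<le> z"
  shows "cf_map u y - cf_map u z = (y - z) / (cf_den u y * cf_den u z)"
proof (induction u)
  case (Cons a u)
  define Y where "Y = a + 1 + cf_map u y"
  define Z where "Z = a + 1 + cf_map u z"
  have pos: "Y > 0" "Z > 0" using cf_map_nonneg[of _ u] assms by (auto simp: Y_def Z_def add_pos_nonneg)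
  have "cf_map (a # u) y - cf_map (a # u) z = 1 / Z - 1 / Y"
    using assms by (simp add: cf_map_Cons Y_def Z_def add_ac)
  also have "\<dots> = (cf_map u y - cf_map u z) / (Y * Z)"
    using pos by (simp add: field_simps) (simp add: Y_def Z_def)
  also have "\<dots> = (y - z) / (cf_den (a # u) y * cf_den (a # u) z)"
    using assms by (simp add: Cons.IH cf_den_Cons Y_def Z_def mult_ac add_ac del: cf_den.simps(2))
  finally show ?case .
qed simp

lemma cf_map_mono: "0 \<le> y \<Longrightarrow> y \<le> z \<Longrightarrow> cf_map u y \<le> cf_map u z"
  using cf_map_diff[of z y u] cf_den_ge1[of y u] cf_den_ge1[of z u]
  by (smt (verit) divide_nonneg_nonneg mult_nonneg_nonneg)

section \<open>The denominators as integers, and their multiplicativity\<close>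

definition q_step :: "nat \<times> nat \<Rightarrow> nat \<Rightarrow> nat \<times> nat" where
  "q_step r a = (fst r + snd r, a * (fst r + snd r) + snd r)"

text \<open>The pair \<open>(q\<^sub>2\<^sub>n\<^sub>-\<^sub>1, q\<^sub>2\<^sub>n)\<close>.\<close>
definition q_pair :: "nat list \<Rightarrow> nat \<times> nat" where
  "q_pair u = foldl q_step (0, 1) u"

lemma q_pair_simps [simp]: "q_pair [] = (0, 1)" "q_pair (u @ [a]) = q_step (q_pair u) a"
  by (simp_all add: q_pair_def)

text \<open>Associativity of the matrix product: \<open>cf_den\<close> lets the matrices act on the
  column (y, 1), beginning with the last digit, and \<open>q_step\<close> lets them act on the row
  \<open>r\<close>, beginning with the first.\<close>

lemma foldl_q_step:
  "real (fst r) * cf_num u y + real (snd r) * cf_den u y =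
     real (fst (foldl q_step r u)) * y + real (snd (foldl q_step r u))"
proof (induction u arbitrary: r)
  case (Cons a u)
  show ?case using Cons[of "q_step r a"] by (simp add: q_step_def algebra_simps)
qed simp

lemma cf_den_eq: "cf_den u y = real (fst (q_pair u)) * y + real (snd (q_pair u))"
  using foldl_q_step[of "(0, 1)" u y] by (simp add: q_pair_def)

text \<open>This confines \<open>cf_den u\<close> to [q, 2q] on the unit interval. It is the source
  of the factor 2 in \<open>q_even_append_le\<close> and of the factor 4 in the lower distance
  estimate.\<close>

lemma q_pair_le: "pos_digits u \<Longrightarrow> fst (q_pair u) \<le> snd (q_pair u)"
proof (induction u rule: rev_induct)
  case (snoc a u)
  have "fst (q_pair u) + snd (q_pair u) \<le> a * (fst (q_pair u) + snd (q_pair u))"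
    using snoc.prems by (cases a) auto
  then show ?case unfolding q_pair_simps q_step_def fst_conv snd_conv by linarith
qed simp

lemma q_even_eq: "q_even u = real (snd (q_pair u))"
  by (simp add: q_even_def cf_den_eq)

lemma q_even_ge1: "1 \<le> q_even u"
  by (simp add: q_even_def cf_den_ge1)

lemma q_even_pos: "0 < q_even u"
  using q_even_ge1[of u] by linarith

lemma q_even_Nil [simp]: "q_even [] = 1"
  by (simp add: q_even_def)

lemma q_even_singleton: "q_even [a] = a + 1"
  by (simp add: q_even_def)

lemma cf_den_ge_q_even: "0 \<le> y \<Longrightarrow> q_even u \<le> cf_den u y"
  by (simp add: q_even_def cf_den_eq)

lemma cf_den_le_q_even: "pos_digits u \<Longrightarrow> 0 \<le> y \<Longrightarrow> y \<le> 1 \<Longrightarrow> cf_den u y \<le> 2 * q_even u"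
  using q_pair_le[of u] mult_mono[of "real (fst (q_pair u))" "real (snd (q_pair u))" y 1]
  by (simp add: q_even_def cf_den_eq)

lemma q_even_append_ge: "q_even u * q_even v \<le> q_even (u @ v)"
  using cf_den_ge_q_even[of "cf_map v 0" u] q_even_ge1[of v]
  by (simp add: q_even_def cf_den_append cf_map_nonneg)

lemma q_even_append_le: "pos_digits u \<Longrightarrow> q_even (u @ v) \<le> 2 * q_even u * q_even v"
  using cf_den_le_q_even[of u "cf_map v 0"] q_even_ge1[of v]
  by (simp add: q_even_def cf_den_append cf_map_nonneg cf_map_le1)

lemma q_even_ge_power2: "pos_digits u \<Longrightarrow> 2 ^ length u \<le> q_even u"
proof (induction u)
  case (Cons a u)
  have "2 * 2 ^ length u \<le> q_even [a] * q_even u"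
    using Cons by (intro mult_mono) (auto simp: q_even_singleton)
  then show ?case using q_even_append_ge[of "[a]" u] by simp
qed simp

lemma cf_denom_interleave_cong:
  assumes "k \<le> 2 * length u"
  shows "cf_denom (interleave_ones (u @ v)) k = cf_denom (interleave_ones u) k"
  using assms
proof (induction "interleave_ones (u @ v)" k rule: cf_denom.induct)
  case (3 k)
  then show ?case by (auto simp: interleave_ones_def nth_append)
qed (auto simp: interleave_ones_def)

text \<open>The second claim excludes the empty word because truncated subtraction would read the
  index -1 as 0.\<close>

lemma cf_denom_interleave:
  "cf_denom (interleave_ones u) (2 * length u) = snd (q_pair u)"
  "u \<noteq> [] \<Longrightarrow> cf_denom (interleave_ones u) (2 * length u - 1) = fst (q_pair u)"
proof (induction u rule: rev_induct)
  case (snoc a u)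
  have cong: "cf_denom (interleave_ones (u @ [a])) k = cf_denom (interleave_ones u) k" if "k \<le> 2 * length u" for k
    using that by (rule cf_denom_interleave_cong)
  have odd: "cf_denom (interleave_ones (u @ [a])) (Suc (2 * length u)) = fst (q_pair (u @ [a]))"
  proof (cases u rule: rev_cases)
    case Nil
    then show ?thesis using q_pair_simps(2)[of "[]" a] by (simp add: q_step_def interleave_ones_def)
  next
    case (snoc v b)
    then obtain m where m: "2 * length u = Suc (Suc m)" by simp
    have "cf_denom (interleave_ones (u @ [a])) (Suc (2 * length u)) =
        cf_denom (interleave_ones (u @ [a])) (2 * length u) + cf_denom (interleave_ones (u @ [a])) (2 * length u - 1)"
      by (simp add: m interleave_ones_def)
        (metis m even_Suc even_mult_iff even_numeral)
    also have "\<dots> = snd (q_pair u) + fst (q_pair u)"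
      using snoc.IH cong[of "2 * length u"] cong[of "2 * length u - 1"] snoc by force
    finally show ?thesis by (simp add: q_step_def)
  qed
  have "cf_denom (interleave_ones (u @ [a])) (Suc (Suc (2 * length u))) = snd (q_pair (u @ [a]))"
    using odd cong[of "2 * length u"] snoc.IH(1)
    by (simp add: q_step_def interleave_ones_def nth_append)
  with odd show
    "cf_denom (interleave_ones (u @ [a])) (2 * length (u @ [a])) = snd (q_pair (u @ [a]))"
    "cf_denom (interleave_ones (u @ [a])) (2 * length (u @ [a]) - 1) = fst (q_pair (u @ [a]))"
    by simp_all
qed simp_all

lemma q_even_eq_cf_denom: "real (cf_denom (interleave_ones u) (2 * length u)) = q_even u"
  by (simp add: q_even_eq cf_denom_interleave)

section \<open>The Gauss map and the points of \<open>I_even\<close>\<close>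

text \<open>The remainder must lie strictly inside the unit interval: for \<open>a\<close> = 1 and
  \<open>y\<close> = 0 the point is 1/2, whose first digit is 2.\<close>

lemma gauss_map_cf_map:
  assumes a: "1 \<le> a" and y: "0 < y" "y < 1"
  shows "cf_digit (cf_map [a] y) 1 = 1" "cf_digit (cf_map [a] y) 2 = a"
    "(gauss_map ^^ 2) (cf_map [a] y) = y"
proof -
  have x: "cf_map [a] y = (a + y) / (a + 1 + y)"
    using y by (simp add: cf_map_Cons field_simps)
  have inv: "1 / cf_map [a] y = 1 + 1 / (a + y)"
    using y by (simp add: x field_simps)
  have lt: "1 / (a + y) > 0" "1 / (a + y) < 1" using a y by auto
  have g1: "gauss_map (cf_map [a] y) = 1 / (a + y)"
    unfolding gauss_map_def inv using lt by (simp add: frac_unique_iff)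
  have fl: "\<lfloor>real a + y\<rfloor> = int a" using y by linarith
  have g2: "gauss_map (1 / (a + y)) = y"
    unfolding gauss_map_def using y fl by (simp add: frac_def)
  have "\<lfloor>1 / cf_map [a] y\<rfloor> = 1" unfolding inv using lt by linarith
  then show "cf_digit (cf_map [a] y) 1 = 1" by (simp add: cf_digit_def)
  show "cf_digit (cf_map [a] y) 2 = a" using g1 fl by (simp add: cf_digit_def)
  show "(gauss_map ^^ 2) (cf_map [a] y) = y" using g1 g2 by (simp add: numeral_2_eq_2)
qed

lemma cf_digit_shift: "1 \<le> m \<Longrightarrow> cf_digit x (n + m) = cf_digit ((gauss_map ^^ n) x) m"
proof -
  assume "1 \<le> m"
  then have "n + m - 1 = (m - 1) + n" by simp
  then show ?thesis by (simp add: cf_digit_def funpow_add)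
qed

lemma cf_map_in_unit:
  assumes "pos_digits u" "0 < y" "y < 1"
  shows "0 < cf_map u y" "cf_map u y < 1"
proof -
  have "0 < cf_map u y \<and> cf_map u y < 1" using assms
  proof (induction u)
    case (Cons a u)
    then have "0 < cf_map u y" by auto
    then show ?case using Cons.prems by (auto simp: cf_map_Cons)
  qed simp
  then show "0 < cf_map u y" "cf_map u y < 1" by auto
qed

lemma gauss_map_funpow_cf_map:
  assumes "pos_digits u" "0 < y" "y < 1"
  shows "(gauss_map ^^ (2 * length u)) (cf_map u y) = y"
  using assms(1)
proof (induction u)
  case (Cons a u)
  have "cf_map (a # u) y = cf_map [a] (cf_map u y)"
    using cf_map_append[of y "[a]" u] assms by simp
  moreover have "(gauss_map ^^ 2) (cf_map [a] (cf_map u y)) = cf_map u y"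
    using Cons.prems assms by (intro gauss_map_cf_map cf_map_in_unit) auto
  moreover have "2 * length (a # u) = 2 * length u + 2" by simp
  ultimately show ?case using Cons by (simp only: funpow_add o_apply) simp
qed simp

lemma cf_digit_cf_map:
  assumes "pos_digits u" "0 < y" "y < 1" "1 \<le> m"
  shows "cf_digit (cf_map u y) (2 * length u + m) = cf_digit y m"
  using assms by (simp add: cf_digit_shift gauss_map_funpow_cf_map)

lemma in_I_evenI:
  assumes "\<And>n. \<exists>u y. n \<le> length u \<and> pos_digits u \<and> 0 < y \<and> y < 1 \<and> x = cf_map u y"
  shows "x \<in> I_even"
proof -
  obtain u y where "pos_digits u" "0 < y" "y < 1" "x = cf_map u y" using assms by blast
  then have "x \<in> {0..<1}" using cf_map_in_unit[of u y] by auto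
  moreover have "cf_digit x (2 * k + 1) = 1" for k
  proof -
    obtain u y where u: "Suc k \<le> length u" "pos_digits u" "0 < y" "y < 1" "x = cf_map u y"
      using assms by blast
    define v a w where "v = take k u" and "a = u ! k" and "w = drop (Suc k) u"
    have eq: "u = v @ [a] @ w" using u(1) by (simp add: v_def a_def w_def id_take_nth_drop)
    have len: "length v = k" using u(1) by (simp add: v_def)
    have "x = cf_map v (cf_map [a] (cf_map w y))" using u(3,5) cf_map_nonneg[of y w]
      by (simp only: eq cf_map_append)
    moreover have "cf_map w y > 0" "cf_map w y < 1" using cf_map_in_unit[of w y] u eq by auto
    moreover from this have "cf_map [a] (cf_map w y) > 0" "cf_map [a] (cf_map w y) < 1"
      using cf_map_in_unit[of "[a]" "cf_map w y"] u(2) eq by auto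
    ultimately show ?thesis using u(2) eq len
      using cf_digit_cf_map[of v "cf_map [a] (cf_map w y)" 1] gauss_map_cf_map(1)[of a "cf_map w y"] by auto
  qed
  ultimately show ?thesis by (simp add: I_even_def)
qed

lemma I_even_step:
  assumes "x \<in> I_even"
  defines "a \<equiv> cf_digit x 2" and "y \<equiv> (gauss_map ^^ 2) x"
  shows "1 \<le> a" "y \<in> I_even" "x = cf_map [a] y"
proof -
  have digit: "cf_digit x (2 * k + 1) = 1" for k using assms(1) by (auto simp: I_even_def)
  define z where "z = gauss_map x"
  have z: "0 \<le> z" "z < 1" by (auto simp: z_def gauss_map_def frac_lt_1)
  have y: "0 \<le> y" "y < 1" by (auto simp: y_def numeral_2_eq_2 gauss_map_def frac_lt_1)
  have "nat \<lfloor>1 / x\<rfloor> = 1" using digit[of 0] by (simp add: cf_digit_def)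
  then have "\<lfloor>1 / x\<rfloor> = 1" by linarith
  then have x1: "1 / x = 1 + z" by (simp add: z_def gauss_map_def frac_def)
  have y_eq: "y = frac (1 / z)" by (simp add: y_def z_def numeral_2_eq_2 gauss_map_def)
  \<comment> \<open>The third digit of \<open>x\<close> excludes termination: for \<open>y\<close> =
    0 the convention 1 / 0 = 0 would make it 0.\<close>
  have "cf_digit y 1 = 1" using digit[of 1] cf_digit_shift[of 1 x 2] by (simp add: y_def)
  then have "y \<noteq> 0" by (auto simp: cf_digit_def)
  then have "z \<noteq> 0" using y_eq by auto
  then have zpos: "0 < z" using z by simp
  have a_eq: "int a = \<lfloor>1 / z\<rfloor>" using zpos z by (simp add: a_def cf_digit_def z_def)
  then show a: "1 \<le> a" using zpos z by (simp add: le_floor_iff flip: of_nat_le_iff[where 'a=int])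
  have z1: "1 / z = a + y" using a_eq y_eq by (simp add: frac_def)
  then have "z = 1 / (a + y)" using z1[symmetric] by simp
  moreover have "x = 1 / (1 + z)" using x1 zpos z by (cases "x = 0") (auto simp: field_simps)
  moreover have "1 / (1 + 1 / t) = 1 - 1 / (t + 1)" if "t > 0" for t :: real
    using that by (simp add: field_simps)
  from this[of "a + y"] have "1 / (1 + 1 / (a + y)) = 1 - 1 / (a + y + 1)"
    using y a by simp
  ultimately show "x = cf_map [a] y" using y by (simp add: cf_map_Cons add_ac)
  have "cf_digit y (2 * k + 1) = 1" for k
  proof -
    have "2 * Suc k + 1 = 2 + (2 * k + 1)" by simp
    then show ?thesis
      using digit[of "Suc k"] cf_digit_shift[of "2 * k + 1" x 2] le_add2[of 1 "2 * k"] unfolding y_def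
      by metis
  qed
  then show "y \<in> I_even" using y by (simp add: I_even_def)
qed

definition even_digits :: "real \<Rightarrow> nat \<Rightarrow> nat list" where
  "even_digits x n = map (\<lambda>k. cf_digit x (2 * k)) [1..<Suc n]"

lemma I_even_expansion:
  assumes "x \<in> I_even"
  shows "pos_digits (even_digits x n)" "(gauss_map ^^ (2 * n)) x \<in> I_even"
    "x = cf_map (even_digits x n) ((gauss_map ^^ (2 * n)) x)"
proof -
  have "pos_digits (even_digits x n) \<and> (gauss_map ^^ (2 * n)) x \<in> I_even \<and>
    x = cf_map (even_digits x n) ((gauss_map ^^ (2 * n)) x)"
  proof (induction n)
    case 0
    then show ?case using assms by (simp add: even_digits_def)
  next
    case (Suc n)
    define y where "y = (gauss_map ^^ (2 * n)) x"
    have y: "y \<in> I_even" using Suc y_def by simp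
    have a: "cf_digit y 2 = cf_digit x (2 * Suc n)"
      using cf_digit_shift[of 2 x "2 * n"] by (simp add: y_def)
    have y2: "(gauss_map ^^ 2) y = (gauss_map ^^ (2 * Suc n)) x"
      unfolding y_def by (simp add: numeral_2_eq_2)
    have "0 \<le> (gauss_map ^^ (2 * Suc n)) x" using I_even_step(2)[OF y] unfolding y2 by (auto simp: I_even_def)
    moreover have "even_digits x (Suc n) = even_digits x n @ [cf_digit x (2 * Suc n)]"
      by (simp add: even_digits_def)
    ultimately show ?case using Suc I_even_step[OF y] unfolding a y2 y_def[symmetric]
      by (auto simp: cf_map_append)
  qed
  then show "pos_digits (even_digits x n)" "(gauss_map ^^ (2 * n)) x \<in> I_even"
    "x = cf_map (even_digits x n) ((gauss_map ^^ (2 * n)) x)" by auto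
qed

lemma length_even_digits [simp]: "length (even_digits x n) = n"
  by (simp add: even_digits_def)

lemma I_even_bounds:
  assumes "x \<in> I_even"
  shows "1 / 2 \<le> x" "x < 1"
proof -
  define a where "a = cf_digit x 2"
  define y where "y = (gauss_map ^^ 2) x"
  have "1 \<le> a" "0 \<le> y" "x = 1 - 1 / (a + 1 + y)"
    using I_even_step[OF assms] by (auto simp: a_def y_def cf_map_Cons I_even_def add_ac)
  moreover from this have "1 / (a + 1 + y) \<le> 1 / 2" by (intro divide_left_mono) auto
  ultimately show "1 / 2 \<le> x" by simp
  show "x < 1" using assms by (simp add: I_even_def)
qed

section \<open>The dimensional numbers\<close>

definition words :: "nat \<Rightarrow> nat list set" where
  "words n = {u. length u = n \<and> pos_digits u}"

definition s_weight :: "real \<Rightarrow> real \<Rightarrow> nat list \<Rightarrow> real" where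
  "s_weight B \<rho> u = (B ^ (2 * length u) * (q_even u)\<^sup>2) powr (- \<rho>)"

lemma s_weight_nonneg: "0 \<le> s_weight B \<rho> u"
  by (simp add: s_weight_def)

lemma s_sum_eq_SUP:
  "s_sum B n \<rho> = (SUP F \<in> {F. finite F \<and> F \<subseteq> words n}. ennreal (\<Sum>u\<in>F. s_weight B \<rho> u))"
proof -
  have "s_sum B n \<rho> = (\<Sum>\<^sub>\<infinity>u\<in>words n. ennreal (s_weight B \<rho> u))"
    unfolding s_sum_def words_def
    by (intro infsum_cong) (auto simp: s_weight_def q_even_eq_cf_denom)
  also have "\<dots> = (SUP F \<in> {F. finite F \<and> F \<subseteq> words n}. (\<Sum>u\<in>F. ennreal (s_weight B \<rho> u)))"
    by (rule nonneg_infsum_complete) simp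
  finally show ?thesis by (simp add: s_weight_nonneg)
qed

lemma s_sum_upper: "finite F \<Longrightarrow> F \<subseteq> words n \<Longrightarrow> ennreal (\<Sum>u\<in>F. s_weight B \<rho> u) \<le> s_sum B n \<rho>"
  unfolding s_sum_eq_SUP by (rule SUP_upper) simp

lemma s_sum_least:
  "(\<And>F. finite F \<Longrightarrow> F \<subseteq> words n \<Longrightarrow> ennreal (\<Sum>u\<in>F. s_weight B \<rho> u) \<le> X) \<Longrightarrow> s_sum B n \<rho> \<le> X"
  unfolding s_sum_eq_SUP by (rule SUP_least) simp

lemma s_sum_finite_le:
  assumes "s_sum B n \<rho> \<le> ennreal C" "0 \<le> C" "finite F" "F \<subseteq> words n"
  shows "(\<Sum>u\<in>F. s_weight B \<rho> u) \<le> C"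
  using order_trans[OF s_sum_upper[OF assms(3,4)] assms(1)] assms(2) by simp

lemma s_sum_0: "s_sum B 0 \<rho> \<le> 1"
proof (rule s_sum_least)
  fix F :: "nat list set"
  assume "finite F" "F \<subseteq> words 0"
  then have "F = {} \<or> F = {[]}" by (auto simp: words_def)
  then show "ennreal (\<Sum>u\<in>F. s_weight B \<rho> u) \<le> 1" by (auto simp: s_weight_def)
qed

lemma base_pos: "0 < B \<Longrightarrow> 0 < B ^ (2 * length u) * (q_even u)\<^sup>2"
  using q_even_pos[of u] by simp

lemma s_weight_append:
  assumes "0 < B" "0 \<le> \<rho>"
  shows "s_weight B \<rho> (u @ v) \<le> s_weight B \<rho> u * s_weight B \<rho> v"
proof -
  let ?b = "\<lambda>u. B ^ (2 * length u) * (q_even u)\<^sup>2"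
  have "(q_even u * q_even v)\<^sup>2 \<le> (q_even (u @ v))\<^sup>2"
    using q_even_append_ge[of u v] q_even_pos[of u] q_even_pos[of v] by (intro power_mono) auto
  then have "B ^ (2 * length (u @ v)) * (q_even u * q_even v)\<^sup>2 \<le> ?b (u @ v)"
    using assms(1) by (intro mult_left_mono) auto
  moreover have "?b u * ?b v = B ^ (2 * length (u @ v)) * (q_even u * q_even v)\<^sup>2"
    by (simp add: power_mult_distrib power_add algebra_simps)
  ultimately have "?b u * ?b v \<le> ?b (u @ v)" by simp
  then have "?b (u @ v) powr (- \<rho>) \<le> (?b u * ?b v) powr (- \<rho>)"
    using base_pos[OF assms(1)] assms(2) by (intro powr_mono2') auto
  then show ?thesis using base_pos[OF assms(1)] unfolding s_weight_def
    by (subst (asm) powr_mult) (auto intro: less_imp_le)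
qed

lemma s_weight_append_ge:
  assumes "0 < B" "0 \<le> \<rho>" "pos_digits u"
  shows "s_weight B \<rho> u * (4 * B ^ (2 * length v) * (q_even v)\<^sup>2) powr (- \<rho>) \<le> s_weight B \<rho> (u @ v)"
proof -
  let ?b = "\<lambda>u. B ^ (2 * length u) * (q_even u)\<^sup>2"
  have "(q_even (u @ v))\<^sup>2 \<le> (2 * q_even u * q_even v)\<^sup>2"
    using q_even_append_le[OF assms(3), of v] q_even_pos[of "u @ v"] by (intro power_mono) auto
  then have "?b (u @ v) \<le> B ^ (2 * length (u @ v)) * (2 * q_even u * q_even v)\<^sup>2"
    using assms(1) by (intro mult_left_mono) auto
  moreover have "?b u * (4 * ?b v) = B ^ (2 * length (u @ v)) * (2 * q_even u * q_even v)\<^sup>2"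
    by (simp add: power_mult_distrib power_add algebra_simps)
  ultimately have "?b (u @ v) \<le> ?b u * (4 * ?b v)" by simp
  then have "(?b u * (4 * ?b v)) powr (- \<rho>) \<le> ?b (u @ v) powr (- \<rho>)"
    using base_pos[OF assms(1), of "u @ v"] assms(2) by (intro powr_mono2') simp_all
  moreover have "(?b u * (4 * ?b v)) powr (- \<rho>) = ?b u powr (- \<rho>) * (4 * ?b v) powr (- \<rho>)"
    by (rule powr_mult)
  ultimately show ?thesis unfolding s_weight_def by (simp add: mult.assoc)
qed

lemma s_sum_add_le:
  assumes "0 < B" "0 \<le> \<rho>"
  shows "s_sum B (n + m) \<rho> \<le> s_sum B n \<rho> * s_sum B m \<rho>"
proof (rule s_sum_least)
  fix F :: "nat list set"
  assume F: "finite F" "F \<subseteq> words (n + m)"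
  let ?w = "s_weight B \<rho>"
  have sub: "take n ` F \<subseteq> words n" "drop n ` F \<subseteq> words m"
    using F(2) by (auto simp: words_def dest: in_set_takeD in_set_dropD)
  have "(\<Sum>u\<in>F. ?w u) \<le> (\<Sum>u\<in>F. ?w (take n u) * ?w (drop n u))"
  proof (rule sum_mono)
    fix u show "?w u \<le> ?w (take n u) * ?w (drop n u)"
      using s_weight_append[OF assms, of "take n u" "drop n u"] by simp
  qed
  also have "\<dots> = (\<Sum>(v, w)\<in>(\<lambda>u. (take n u, drop n u)) ` F. ?w v * ?w w)"
    by (subst sum.reindex) (auto simp: inj_on_def, metis append_take_drop_id)
  also have "\<dots> \<le> (\<Sum>(v, w)\<in>take n ` F \<times> drop n ` F. ?w v * ?w w)"
    using F(1) by (intro sum_mono2) (auto simp: s_weight_nonneg)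
  also have "\<dots> = (\<Sum>v\<in>take n ` F. ?w v) * (\<Sum>w\<in>drop n ` F. ?w w)"
    by (simp add: sum_product sum.cartesian_product)
  finally have "ennreal (\<Sum>u\<in>F. ?w u) \<le> ennreal (\<Sum>v\<in>take n ` F. ?w v) * ennreal (\<Sum>w\<in>drop n ` F. ?w w)"
    by (subst ennreal_mult[symmetric]) (auto intro!: ennreal_leI sum_nonneg s_weight_nonneg)
  also have "\<dots> \<le> s_sum B n \<rho> * s_sum B m \<rho>"
    using F(1) sub by (intro mult_mono s_sum_upper) auto
  finally show "ennreal (\<Sum>u\<in>F. ?w u) \<le> s_sum B n \<rho> * s_sum B m \<rho>" .
qed

lemma s_sum_power_le:
  assumes "0 < B" "0 \<le> \<rho>"
  shows "s_sum B (m * k) \<rho> \<le> s_sum B k \<rho> ^ m"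
proof (induction m)
  case (Suc m)
  have "s_sum B (Suc m * k) \<rho> \<le> s_sum B k \<rho> * s_sum B (m * k) \<rho>"
    using s_sum_add_le[OF assms, of k "m * k"] by simp
  also have "\<dots> \<le> s_sum B k \<rho> * s_sum B k \<rho> ^ m"
    using Suc by (intro mult_left_mono) auto
  finally show ?case by simp
qed (use s_sum_0 in simp)

text \<open>Appending a fixed word of ones costs only a bounded factor, so bounds pass from the
  longer length \<open>n + j\<close> down to \<open>n\<close>.\<close>

lemma s_sum_pad:
  assumes "0 < B" "0 \<le> \<rho>"
  shows "s_sum B n \<rho> \<le>
    ennreal ((4 * B ^ (2 * j) * (q_even (replicate j 1))\<^sup>2) powr \<rho>) * s_sum B (n + j) \<rho>"
proof (rule s_sum_least)
  fix F :: "nat list set"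
  assume F: "finite F" "F \<subseteq> words n"
  let ?w = "s_weight B \<rho>" and ?v = "replicate j (1::nat)"
  let ?c = "4 * B ^ (2 * j) * (q_even ?v)\<^sup>2"
  have c: "?c > 0" using assms(1) q_even_pos[of ?v] by simp
  have "?w u \<le> ?c powr \<rho> * ?w (u @ ?v)" if "u \<in> F" for u
  proof -
    have "?w u * ?c powr (- \<rho>) \<le> ?w (u @ ?v)"
      using s_weight_append_ge[OF assms, of u ?v] F(2) that by (auto simp: words_def)
    then have "?c powr \<rho> * (?w u * ?c powr (- \<rho>)) \<le> ?c powr \<rho> * ?w (u @ ?v)"
      by (intro mult_left_mono) auto
    moreover have "x powr \<rho> * x powr (- \<rho>) = 1" if "0 < x" for x :: real
      using that by (simp add: powr_minus)
    note this[OF c]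
    ultimately show ?thesis by (simp add: mult.left_commute)
  qed
  then have "(\<Sum>u\<in>F. ?w u) \<le> (\<Sum>u\<in>F. ?c powr \<rho> * ?w (u @ ?v))" by (rule sum_mono)
  also have "\<dots> = ?c powr \<rho> * (\<Sum>u\<in>(\<lambda>u. u @ ?v) ` F. ?w u)"
    by (subst sum.reindex) (auto simp: inj_on_def sum_distrib_left)
  finally have "ennreal (\<Sum>u\<in>F. ?w u) \<le> ennreal (?c powr \<rho>) * ennreal (\<Sum>u\<in>(\<lambda>u. u @ ?v) ` F. ?w u)"
    by (subst ennreal_mult[symmetric]) (auto intro!: ennreal_leI sum_nonneg s_weight_nonneg)
  also have "\<dots> \<le> ennreal (?c powr \<rho>) * s_sum B (n + j) \<rho>"
    using F by (intro mult_left_mono s_sum_upper) (auto simp: words_def subset_iff)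
  finally show "ennreal (\<Sum>u\<in>F. ?w u) \<le> ennreal (?c powr \<rho>) * s_sum B (n + j) \<rho>" .
qed

text \<open>One length \<open>k\<close> with sum below 1 controls all lengths: submultiplicativity
  gives decay along the multiples of \<open>k\<close>, and any length is padded with ones up to a
  larger multiple.\<close>

lemma s_sum_geometric_decay:
  assumes B: "0 < B" "0 \<le> \<rho>" and k: "1 \<le> k" and lt: "s_sum B k \<rho> < 1"
  shows "\<exists>C \<delta>. 0 \<le> C \<and> 0 < \<delta> \<and> \<delta> < 1 \<and> (\<forall>n. s_sum B n \<rho> \<le> ennreal (C * \<delta> ^ n))"
proof -
  define \<theta> where "\<theta> = max (1 / 2) (enn2real (s_sum B k \<rho>))"
  have \<theta>: "0 < \<theta>" "\<theta> < 1" "s_sum B k \<rho> \<le> ennreal \<theta>"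
  proof -
    obtain r where r: "s_sum B k \<rho> = ennreal r" "0 \<le> r" "r < 1"
      using lt by (cases "s_sum B k \<rho>") (auto simp: ennreal_less_one_iff)
    then show "0 < \<theta>" "\<theta> < 1" "s_sum B k \<rho> \<le> ennreal \<theta>" by (auto simp: \<theta>_def intro: ennreal_leI)
  qed
  define \<delta> where "\<delta> = root k \<theta>"
  have \<delta>: "0 < \<delta>" "\<delta> < 1" "\<delta> ^ k = \<theta>"
    using \<theta> k by (auto simp: \<delta>_def real_root_gt_zero real_root_lt_1_iff)
  define c where "c j = (4 * B ^ (2 * j) * (q_even (replicate j 1))\<^sup>2) powr \<rho>" for j
  define C where "C = (\<Sum>j\<le>k. c j)"
  have c: "0 \<le> c j" for j by (simp add: c_def)
  have "s_sum B n \<rho> \<le> ennreal (C * \<delta> ^ n)" for n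
  proof -
    \<comment> \<open>\<open>j\<close> lies between 1 and \<open>k\<close>: a length divisible by
      \<open>k\<close> is padded by a whole block.\<close>
    define m j where "m = n div k" and "j = k - n mod k"
    have nj: "n + j = Suc m * k"
    proof -
      have "n mod k < k" "n = m * k + n mod k" using k by (simp_all add: m_def)
      then have "n + j = m * k + k" unfolding j_def by linarith
      then show ?thesis by simp
    qed
    have "s_sum B n \<rho> \<le> ennreal (c j) * s_sum B (Suc m * k) \<rho>"
      using s_sum_pad[OF B, of n j] unfolding nj c_def .
    also have "\<dots> \<le> ennreal (c j) * s_sum B k \<rho> ^ Suc m"
      by (intro mult_left_mono s_sum_power_le B) auto
    also have "\<dots> \<le> ennreal (c j) * ennreal \<theta> ^ Suc m"
      by (intro mult_left_mono power_mono \<theta>) auto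
    also have "ennreal \<theta> ^ Suc m = ennreal (\<delta> ^ (n + j))"
      unfolding nj mult.commute[of "Suc m"] power_mult \<delta>(3)
      using \<theta>(1) by (intro ennreal_power) simp
    also have "ennreal (c j) * \<dots> = ennreal (c j * \<delta> ^ (n + j))"
      using c \<delta>(1) by (simp add: ennreal_mult)
    also have "\<dots> \<le> ennreal (C * \<delta> ^ n)"
    proof (intro ennreal_leI mult_mono)
      show "c j \<le> C" unfolding C_def using c by (intro member_le_sum) (auto simp: j_def)
      show "\<delta> ^ (n + j) \<le> \<delta> ^ n" using \<delta> by (intro power_decreasing) auto
    qed (use c \<delta> in \<open>auto simp: C_def intro: sum_nonneg\<close>)
    finally show ?thesis .
  qed
  moreover have "0 \<le> C" using c by (auto simp: C_def intro: sum_nonneg)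
  ultimately show ?thesis using \<delta> by blast
qed

section \<open>Dependence on the exponent and on \<open>B\<close>; existence of the limits\<close>

lemma base_ge:
  assumes "1 \<le> B" "u \<in> words n"
  shows "4 ^ n \<le> B ^ (2 * length u) * (q_even u)\<^sup>2"
proof -
  have "(2 ^ n)\<^sup>2 \<le> (q_even u)\<^sup>2"
    using q_even_ge_power2[of u] assms(2) by (intro power_mono) (auto simp: words_def)
  moreover have "(4::real) ^ n = (2 ^ n)\<^sup>2"
    by (simp add: power2_eq_square flip: power_mult_distrib)
  ultimately have "1 * 4 ^ n \<le> B ^ (2 * length u) * (q_even u)\<^sup>2"
    using assms(1) by (intro mult_mono) auto
  then show ?thesis by simp
qed

text \<open>Every base is at least 4^n, so raising the exponent gains a power of 4 uniformly over
  the words of length \<open>n\<close>.\<close>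

lemma s_weight_exponent:
  assumes "1 \<le> B" "u \<in> words n" "\<rho> \<le> \<rho>'"
  shows "s_weight B \<rho>' u * (4 ^ n) powr (\<rho>' - \<rho>) \<le> s_weight B \<rho> u"
proof -
  let ?b = "B ^ (2 * length u) * (q_even u)\<^sup>2"
  have "(4 ^ n) powr (\<rho>' - \<rho>) \<le> ?b powr (\<rho>' - \<rho>)"
    using base_ge[OF assms(1,2)] assms(3) by (intro powr_mono2) auto
  then have "?b powr (- \<rho>') * (4 ^ n) powr (\<rho>' - \<rho>) \<le> ?b powr (- \<rho>') * ?b powr (\<rho>' - \<rho>)"
    by (intro mult_left_mono) auto
  then show ?thesis by (simp add: s_weight_def flip: powr_add)
qed

lemma s_weight_antimono:
  assumes "0 < B" "B \<le> B'" "0 \<le> \<rho>"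
  shows "s_weight B' \<rho> u \<le> s_weight B \<rho> u"
  unfolding s_weight_def using assms base_pos[of B u]
  by (intro powr_mono2' mult_right_mono power_mono) auto

lemma s_sum_antimono:
  assumes "0 < B" "B \<le> B'" "0 \<le> \<rho>"
  shows "s_sum B' n \<rho> \<le> s_sum B n \<rho>"
proof (rule s_sum_least)
  fix F assume F: "finite F" "F \<subseteq> words n"
  have "ennreal (\<Sum>u\<in>F. s_weight B' \<rho> u) \<le> ennreal (\<Sum>u\<in>F. s_weight B \<rho> u)"
    by (intro ennreal_leI sum_mono s_weight_antimono assms)
  also note s_sum_upper[OF F]
  finally show "ennreal (\<Sum>u\<in>F. s_weight B' \<rho> u) \<le> s_sum B n \<rho>" .
qed

lemma finite_words_1:
  assumes "finite F" "F \<subseteq> words 1"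
  obtains N where "F \<subseteq> (\<lambda>a. [a]) ` {1..N}"
proof
  show "F \<subseteq> (\<lambda>a. [a]) ` {1..Max (hd ` F)}"
  proof
    fix u assume u: "u \<in> F"
    then obtain a where "u = [a]" "1 \<le> a" using assms(2) by (cases u) (auto simp: words_def)
    moreover from this have "a \<le> Max (hd ` F)" using u assms(1) by (intro Max_ge) (force simp: image_iff)+
    ultimately show "u \<in> (\<lambda>a. [a]) ` {1..Max (hd ` F)}" by auto
  qed
qed

lemma s_sum_1_le:
  assumes C: "\<And>N. (\<Sum>a=1..N. (real a + 1) powr (- 2 * \<rho>)) \<le> C"
  shows "s_sum 1 1 \<rho> \<le> ennreal C"
proof (rule s_sum_least)
  fix F assume F: "finite F" "F \<subseteq> words 1"
  then obtain N where N: "F \<subseteq> (\<lambda>a. [a]) ` {1..N}" by (rule finite_words_1)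
  have "(\<Sum>u\<in>F. s_weight 1 \<rho> u) \<le> (\<Sum>u\<in>(\<lambda>a. [a]) ` {1..N}. s_weight 1 \<rho> u)"
    using N by (intro sum_mono2) (auto simp: s_weight_nonneg)
  also have "\<dots> = (\<Sum>a=1..N. (real a + 1) powr (- 2 * \<rho>))"
    by (subst sum.reindex)
      (auto simp: inj_on_def s_weight_def q_even_singleton powr_powr add.commute simp flip: powr_numeral intro!: sum.cong)
  finally show "ennreal (\<Sum>u\<in>F. s_weight 1 \<rho> u) \<le> ennreal C"
    using C[of N] by (intro ennreal_leI) linarith
qed

text \<open>The sum of 1 / (a + 1)^2 telescopes. The bound makes the exponent 1 admissible for every
  length and every \<open>B \<ge> 1\<close>, so the infima are over nonempty sets and all
  dimensional numbers are at most 1.\<close>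

lemma s_sum_1_1_one: "s_sum 1 1 1 \<le> 1"
proof -
  have "(\<Sum>a=1..N. (real a + 1) powr (- 2 * 1)) \<le> 1 - 1 / (real N + 1)" for N
  proof (induction N)
    case (Suc N)
    have "1 / (real N + 2)\<^sup>2 \<le> 1 / ((real N + 1) * (real N + 2))"
      unfolding power2_eq_square by (intro divide_left_mono mult_mono) auto
    also have "\<dots> = 1 / (real N + 1) - 1 / (real N + 2)"
      by (simp add: field_simps)
    finally have "1 / (real N + 2)\<^sup>2 \<le> 1 / (real N + 1) - 1 / (real N + 2)" .
    moreover have "(real (Suc N) + 1) powr (- 2 * 1) = 1 / (real N + 2)\<^sup>2"
      by (simp add: powr_minus_divide add.commute)
    ultimately show ?case using Suc by (simp add: add.commute)
  qed simp
  then have "(\<Sum>a=1..N. (real a + 1) powr (- 2 * 1)) \<le> 1" for N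
    by (smt (verit) divide_nonneg_nonneg of_nat_0_le_iff)
  then show ?thesis using s_sum_1_le[of 1 1] by simp
qed

lemma s_sum_1_1_finite:
  assumes "1 / 2 < \<rho>"
  obtains Z where "0 \<le> Z" "s_sum 1 1 \<rho> \<le> ennreal Z"
proof
  let ?f = "\<lambda>n. real n powr (- 2 * \<rho>)"
  have sm: "summable ?f" using assms by (simp add: summable_real_powr_iff)
  show "0 \<le> suminf ?f" by (intro suminf_nonneg sm) simp
  have "(\<Sum>a=1..N. (real a + 1) powr (- 2 * \<rho>)) \<le> suminf ?f" for N
  proof -
    have "(\<Sum>a=1..N. (real a + 1) powr (- 2 * \<rho>)) = (\<Sum>a\<in>Suc ` {1..N}. ?f a)"
      by (subst sum.reindex) (auto simp: add.commute)
    also have "\<dots> \<le> suminf ?f" by (intro sum_le_suminf sm) auto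
    finally show ?thesis .
  qed
  then show "s_sum 1 1 \<rho> \<le> ennreal (suminf ?f)" by (rule s_sum_1_le)
qed

lemma s_sum_one: "1 \<le> B \<Longrightarrow> s_sum B n 1 \<le> 1"
  using s_sum_antimono[of 1 B 1 n] s_sum_power_le[of 1 1 n 1] power_mono[OF s_sum_1_1_one, of n] by simp

lemma s_approx_nonneg: "1 \<le> B \<Longrightarrow> 0 \<le> s_approx B n"
  unfolding s_approx_def by (rule cInf_greatest) (use s_sum_one[of B n] in \<open>auto intro!: exI[of _ 1]\<close>)

lemma s_approx_le: "0 \<le> \<rho> \<Longrightarrow> s_sum B n \<rho> \<le> 1 \<Longrightarrow> s_approx B n \<le> \<rho>"
  unfolding s_approx_def by (rule cInf_lower) (auto intro: bdd_belowI[of _ 0])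

lemma s_sum_gt_1: "0 \<le> \<rho> \<Longrightarrow> \<rho> < s_approx B n \<Longrightarrow> 1 < s_sum B n \<rho>"
  using s_approx_le[of \<rho> B n] by (meson not_le)

text \<open>Strictness comes from passing from an admissible exponent \<open>\<rho>0\<close> to the
  larger \<open>\<rho>\<close>, which gains the factor \<open>c > 1\<close>.\<close>

lemma s_sum_less_1:
  assumes B: "1 \<le> B" and n: "1 \<le> n" and \<rho>: "s_approx B n < \<rho>"
  shows "s_sum B n \<rho> < 1"
proof -
  obtain \<rho>0 where \<rho>0: "0 \<le> \<rho>0" "s_sum B n \<rho>0 \<le> 1" "\<rho>0 < \<rho>"
    using \<rho> s_sum_one[OF B, of n] unfolding s_approx_def by (subst (asm) cInf_less_iff) (auto intro: bdd_belowI[of _ 0] exI[of _ 1])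
  define c where "c = (4 ^ n) powr (\<rho> - \<rho>0)"
  have c: "1 < c" unfolding c_def using n \<rho>0 by (intro gr_one_powr) auto
  have "s_sum B n \<rho> \<le> ennreal (1 / c)"
  proof (rule s_sum_least)
    fix F assume F: "finite F" "F \<subseteq> words n"
    have "c * (\<Sum>u\<in>F. s_weight B \<rho> u) \<le> (\<Sum>u\<in>F. s_weight B \<rho>0 u)"
      unfolding sum_distrib_left using F \<rho>0(3) s_weight_exponent[OF B, of _ n \<rho>0 \<rho>]
      by (intro sum_mono) (auto simp: c_def mult.commute)
    also have "\<dots> \<le> 1" using s_sum_finite_le[of B n \<rho>0 1 F] \<rho>0(2) F by simp
    finally show "ennreal (\<Sum>u\<in>F. s_weight B \<rho> u) \<le> ennreal (1 / c)"
      using c by (intro ennreal_leI) (simp add: field_simps)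
  qed
  also have "\<dots> < 1" using c by (simp add: ennreal_less_one_iff)
  finally show ?thesis .
qed

text \<open>As in Fekete's lemma the limit is the infimum: once \<open>s_approx B k < y\<close> for
  one \<open>k\<close>, geometric decay makes every large length admit the exponent
  \<open>y\<close>.\<close>

lemma s_num_tendsto:
  assumes B: "1 \<le> B"
  shows "s_approx B \<longlonglongrightarrow> s_num B" and "s_num B = (INF n\<in>{1..}. s_approx B n)"
proof -
  define L where "L = (INF n\<in>{1..}. s_approx B n)"
  have bdd: "bdd_below (s_approx B ` {1..})" using s_approx_nonneg[OF B] by (intro bdd_belowI2[of _ 0])
  have "s_approx B \<longlonglongrightarrow> L"
  proof (rule order_tendstoI)
    fix x assume "x < L"
    then have "x < s_approx B n" if "1 \<le> n" for n
      using cINF_lower[OF bdd, of n] that by (simp add: L_def)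
    then show "\<forall>\<^sub>F n in sequentially. x < s_approx B n"
      by (auto simp: eventually_sequentially)
  next
    fix x assume "L < x"
    then obtain y where y: "L < y" "y < x" using dense by blast
    then obtain k where k: "1 \<le> k" "s_approx B k < y"
      unfolding L_def using bdd by (auto simp: cINF_less_iff)
    have y0: "0 \<le> y" using s_approx_nonneg[OF B, of k] k by simp
    obtain C \<delta> where C: "0 < \<delta>" "\<delta> < 1" "\<And>n. s_sum B n y \<le> ennreal (C * \<delta> ^ n)"
      using s_sum_geometric_decay[OF _ y0 k(1) s_sum_less_1[OF B k]] B by auto
    have "(\<lambda>n. C * \<delta> ^ n) \<longlonglongrightarrow> C * 0" using C by (intro tendsto_intros LIMSEQ_power_zero) auto
    then have "\<forall>\<^sub>F n in sequentially. C * \<delta> ^ n < 1" by (rule order_tendstoD) simp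
    then show "\<forall>\<^sub>F n in sequentially. s_approx B n < x"
    proof eventually_elim
      case (elim n)
      then have "s_sum B n y \<le> 1"
        using C(3)[of n] order_trans ennreal_leI[of "C * \<delta> ^ n" 1] by fastforce
      then show ?case using s_approx_le[OF y0, of B n] y by simp
    qed
  qed
  moreover from this have "s_num B = L" unfolding s_num_def by (rule limI)
  ultimately show "s_approx B \<longlonglongrightarrow> s_num B" and "s_num B = (INF n\<in>{1..}. s_approx B n)"
    by (simp_all add: L_def)
qed

lemma s_num_le_s_approx:
  assumes "1 \<le> B" "1 \<le> n"
  shows "s_num B \<le> s_approx B n"
  unfolding s_num_tendsto(2)[OF assms(1)]
  using s_approx_nonneg[OF assms(1)] assms(2) by (intro cINF_lower bdd_belowI2[of _ 0]) auto

lemma s_num_nonneg: "1 \<le> B \<Longrightarrow> 0 \<le> s_num B"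
  using s_approx_nonneg[of B] by (intro LIMSEQ_le_const[OF s_num_tendsto(1)]) auto

lemma s_num_le_1: "1 \<le> B \<Longrightarrow> s_num B \<le> 1"
  using s_approx_le[OF _ s_sum_one, of B] by (intro LIMSEQ_le_const2[OF s_num_tendsto(1)]) auto

lemma s_approx_antimono:
  assumes "1 \<le> B" "B \<le> B'"
  shows "s_approx B' n \<le> s_approx B n"
  unfolding s_approx_def
proof (rule cInf_superset_mono)
  show "{\<rho>. 0 \<le> \<rho> \<and> s_sum B n \<rho> \<le> 1} \<noteq> {}" using s_sum_one[OF assms(1), of n] by (auto intro: exI[of _ 1])
  show "{\<rho>. 0 \<le> \<rho> \<and> s_sum B n \<rho> \<le> 1} \<subseteq> {\<rho>. 0 \<le> \<rho> \<and> s_sum B' n \<rho> \<le> 1}"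
    using s_sum_antimono[of B B' _ n] assms by (auto intro: order_trans)
qed (auto intro: bdd_belowI[of _ 0])

lemma s_num_antimono: "1 \<le> B \<Longrightarrow> B \<le> B' \<Longrightarrow> s_num B' \<le> s_num B"
  using s_approx_antimono[of B B']
  by (intro LIMSEQ_le[OF s_num_tendsto(1) s_num_tendsto(1)]) auto

text \<open>Monotonicity in \<open>B\<close> turns the right limit into a supremum over
  \<open>B > 1\<close>.\<close>

lemma s_num_at_right_1: "(s_num \<longlongrightarrow> s_one) (at_right 1)"
proof -
  define L where "L = (SUP B\<in>{1<..}. s_num B)"
  have bdd: "bdd_above (s_num ` {1<..})" using s_num_le_1 by (intro bdd_aboveI2[where M = 1]) auto
  have "(s_num \<longlongrightarrow> L) (at_right 1)"
  proof (rule order_tendstoI)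
    fix x assume "x < L"
    then obtain B0 where B0: "1 < B0" "x < s_num B0"
      unfolding L_def using bdd by (subst (asm) less_cSUP_iff) auto
    then have "x < s_num B" if "1 < B" "B < B0" for B
      using s_num_antimono[of B B0] that by auto
    then show "\<forall>\<^sub>F B in at_right 1. x < s_num B"
      using B0(1) by (auto simp: eventually_at_right)
  next
    fix x assume "L < x"
    then have "s_num B < x" if "1 < B" for B
      using cSUP_upper[OF _ bdd, of B] that by (simp add: L_def)
    then show "\<forall>\<^sub>F B in at_right 1. s_num B < x"
      by (intro eventually_mono[OF eventually_at_right_less[of "1 :: real"]])
  qed
  moreover from this have "s_one = L" unfolding s_one_def by (intro tendsto_Lim) auto
  ultimately show ?thesis by simp
qed

section \<open>Strict inequalities for the exponent traded for room in the base\<close>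

text \<open>The liminf only bounds \<phi> n from below by B'^(2n) with B' < B, so the decay has to
  survive a slight decrease of the base. At one length \<open>k\<close> the base enters through a
  single power factor that tends to 1, and this length then controls all others.\<close>

lemma s_sum_decay_above_s_num:
  assumes B: "1 < B" and s: "s_num B < s"
  obtains B' C \<delta> where "1 < B'" "B' < B" "0 \<le> C" "0 < \<delta>" "\<delta> < 1" "\<And>n. s_sum B' n s \<le> ennreal (C * \<delta> ^ n)"
proof -
  have s0: "0 < s" using s s_num_nonneg[of B] B by simp
  have "\<forall>\<^sub>F n in sequentially. s_approx B n < s"
    using s_num_tendsto(1)[of B] B s by (intro order_tendstoD(2)) auto
  then obtain k where k: "1 \<le> k" "s_approx B k < s"
    by (auto simp: eventually_sequentially) (metis le_add1 le_add2)
  have lt: "s_sum B k s < 1" using s_sum_less_1[of B k s] B k by simp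
  then obtain r where r: "s_sum B k s = ennreal r" "0 \<le> r" "r < 1"
    by (cases "s_sum B k s") (auto simp: ennreal_less_one_iff)
  have "((\<lambda>B'. (B / B') powr (2 * k * s) * r) \<longlongrightarrow> (B / B) powr (2 * k * s) * r) (at_left B)"
    using B by (intro tendsto_intros) auto
  then have "\<forall>\<^sub>F B' in at_left B. (B / B') powr (2 * k * s) * r < 1"
    using B r by (intro order_tendstoD(2)) auto
  moreover have "\<forall>\<^sub>F B' in at_left B. B' \<in> {1<..<B}" using B by (rule eventually_at_left_real)
  ultimately have "\<forall>\<^sub>F B' in at_left B. (B / B') powr (2 * k * s) * r < 1 \<and> B' \<in> {1<..<B}"
    by (rule eventually_conj)
  from eventually_happens'[OF trivial_limit_at_left_real this]
  obtain B' where B': "(B / B') powr (2 * k * s) * r < 1" "1 < B'" "B' < B" by auto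
  have "s_sum B' k s \<le> ennreal ((B / B') powr (2 * k * s) * r)"
  proof (rule s_sum_least)
    fix F assume F: "finite F" "F \<subseteq> words k"
    have "s_weight B' s u = (B / B') powr (2 * k * s) * s_weight B s u" if "u \<in> F" for u
    proof -
      have len: "length u = k" using that F(2) by (auto simp: words_def)
      have pos: "0 < B' ^ (2 * k) * (q_even u)\<^sup>2" using base_pos[of B' u] B' len by simp
      have "s_weight B s u = ((B / B') ^ (2 * k) * (B' ^ (2 * k) * (q_even u)\<^sup>2)) powr (- s)"
        using B' by (simp add: s_weight_def len power_divide)
      also have "\<dots> = ((B / B') ^ (2 * k)) powr (- s) * s_weight B' s u"
        using pos B B' by (subst powr_mult) (auto simp: s_weight_def len)
      also have "((B / B') ^ (2 * k)) powr (- s) = (B / B') powr (- (2 * k * s))"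
        using B B' by (simp add: powr_powr flip: powr_realpow)
      finally have "(B / B') powr (2 * k * s) * s_weight B s u =
          ((B / B') powr (2 * k * s) * (B / B') powr (- (2 * k * s))) * s_weight B' s u" by simp
      also have "(B / B') powr (2 * k * s) * (B / B') powr (- (2 * k * s)) = 1"
        using B B' by (simp flip: powr_add)
      finally show ?thesis by simp
    qed
    then have "(\<Sum>u\<in>F. s_weight B' s u) = (B / B') powr (2 * k * s) * (\<Sum>u\<in>F. s_weight B s u)"
      by (simp add: sum_distrib_left)
    also have "\<dots> \<le> (B / B') powr (2 * k * s) * r"
      using s_sum_finite_le[of B k s r F] F r by (intro mult_left_mono) auto
    finally show "ennreal (\<Sum>u\<in>F. s_weight B' s u) \<le> ennreal ((B / B') powr (2 * k * s) * r)"
      by (rule ennreal_leI)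
  qed
  also have "\<dots> < 1" using B' r by (simp add: ennreal_less_one_iff)
  finally have "s_sum B' k s < 1" .
  from s_sum_geometric_decay[OF _ _ k(1) this] s0 B' that show thesis by auto
qed

text \<open>The gap between \<open>s\<close> and \<open>s_num B\<close> pays for a base larger than
  \<open>B\<close> and for an arbitrary constant \<open>K\<close>: B'^(2ks) equals B^(2ks'), and
  lowering the exponent of q from \<open>s'\<close> to \<open>s\<close> gains 4^(k (s' - s)), which
  exceeds \<open>K\<close> for long words.\<close>

lemma s_sum_growth_below_s_num:
  assumes B: "1 < B" and s: "0 < s" "s < s_num B"
  obtains B' k W where "B < B'" "1 \<le> k" "finite W" "W \<subseteq> words k"
    "K * B' powr (2 * k * s) \<le> (\<Sum>u\<in>W. q_even u powr (- 2 * s))"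
proof -
  define s' where "s' = (s + s_num B) / 2"
  have s': "s < s'" "s' < s_num B" using s by (auto simp: s'_def)
  define B' where "B' = B powr (s' / s)"
  have "B powr 1 < B'" unfolding B'_def using B s s' by (intro powr_less_mono) auto
  then have B': "B < B'" using B by simp
  obtain m :: nat where m: "max 1 K \<le> (4 powr (s' - s)) ^ m"
    using real_arch_pow[of "4 powr (s' - s)" "max 1 K"] s' by (auto simp: gr_one_powr intro: less_imp_le)
  define k where "k = max 1 m"
  have "(4 powr (s' - s)) ^ m \<le> (4 powr (s' - s)) ^ k"
    using s' by (intro power_increasing) (auto simp: k_def ge_one_powr_ge_zero)
  then have K: "K \<le> (4 powr (s' - s)) ^ k" using m by simp
  \<comment> \<open>As \<open>s_num B\<close> is the infimum over all lengths, this holds at the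
    length already chosen; a finite part of the sum then exceeds 1 too.\<close>
  have "1 < s_sum B k s'"
    using s_sum_gt_1[of s' B k] s s' s_num_le_s_approx[of B k] B by (simp add: k_def)
  then obtain W where W: "finite W" "W \<subseteq> words k" "1 < ennreal (\<Sum>u\<in>W. s_weight B s' u)"
    unfolding s_sum_eq_SUP less_SUP_iff by auto
  have W1: "1 < (\<Sum>u\<in>W. s_weight B s' u)" using W(3) by simp
  have pos: "0 < (4 powr (s' - s)) ^ k" by simp
  have le: "s_weight B s' u * ((4 powr (s' - s)) ^ k * B' powr (2 * k * s)) \<le> q_even u powr (- 2 * s)" if "u \<in> W" for u
  proof -
    have len: "length u = k" "u \<in> words k" using that W(2) by (auto simp: words_def)
    have "s_weight B s' u = B powr (- 2 * k * s') * q_even u powr (- 2 * s')"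
    proof -
      have "B ^ (2 * k) = B powr (2 * k)" "(q_even u)\<^sup>2 = q_even u powr 2"
        using B q_even_pos[of u] powr_realpow[of B "2 * k"] by simp_all
      then show ?thesis unfolding s_weight_def len by (simp only: powr_mult powr_powr) simp
    qed
    moreover have "B' powr (2 * k * s) = B powr (2 * k * s')"
      using s by (simp add: B'_def powr_powr mult_ac)
    moreover have "(4 powr (s' - s)) ^ k \<le> q_even u powr (2 * (s' - s))"
    proof -
      have "(4 powr (s' - s)) ^ k = (2 ^ k) powr (2 * (s' - s))"
      proof -
        have "(4::real) powr x = 2 powr (2 * x)" for x
          using powr_powr[of "2 :: real" 2 x] by simp
        then show ?thesis by (simp only:) (simp add: powr_powr algebra_simps flip: powr_realpow)
      qed
      also have "\<dots> \<le> q_even u powr (2 * (s' - s))"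
        using q_even_ge_power2[of u] len s' by (intro powr_mono2) (auto simp: words_def)
      finally show ?thesis .
    qed
    ultimately have "s_weight B s' u * ((4 powr (s' - s)) ^ k * B' powr (2 * k * s)) \<le>
        (B powr (- 2 * k * s') * q_even u powr (- 2 * s')) * (q_even u powr (2 * (s' - s)) * B powr (2 * k * s'))"
      by (auto intro!: mult_left_mono mult_right_mono)
    also have "\<dots> = (B powr (- 2 * k * s') * B powr (2 * k * s')) * (q_even u powr (- 2 * s') * q_even u powr (2 * (s' - s)))"
      by (simp only: mult_ac)
    also have "\<dots> = q_even u powr (- 2 * s)"
      using B q_even_pos[of u] by (simp flip: powr_add add: algebra_simps)
    finally show ?thesis .
  qed
  have "K * B' powr (2 * k * s) \<le> (4 powr (s' - s)) ^ k * B' powr (2 * k * s)"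
    using K by (intro mult_right_mono) auto
  also have "\<dots> \<le> (\<Sum>u\<in>W. s_weight B s' u) * ((4 powr (s' - s)) ^ k * B' powr (2 * k * s))"
    using mult_right_mono[OF less_imp_le[OF W1], of "(4 powr (s' - s)) ^ k * B' powr (2 * k * s)"] by simp
  also have "\<dots> \<le> (\<Sum>u\<in>W. q_even u powr (- 2 * s))"
    unfolding sum_distrib_right by (intro sum_mono le)
  finally have le: "K * B' powr (2 * k * s) \<le> (\<Sum>u\<in>W. q_even u powr (- 2 * s))" .
  have "1 \<le> k" by (simp add: k_def)
  then show thesis using B' W(1,2) le that[of B' k W] by simp
qed

section \<open>Upper bounds\<close>

lemma cf_map_dist_le:
  assumes "0 \<le> y" "0 \<le> z"
  shows "\<bar>cf_map u y - cf_map u z\<bar> \<le> \<bar>y - z\<bar> / (q_even u)\<^sup>2"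
proof -
  have "(q_even u)\<^sup>2 \<le> cf_den u y * cf_den u z"
    unfolding power2_eq_square using assms q_even_pos[of u]
    by (intro mult_mono cf_den_ge_q_even) (auto intro: order_trans[OF less_imp_le cf_den_ge_q_even])
  moreover from this have "0 < cf_den u y * cf_den u z"
    using q_even_pos[of u] by (meson less_le_trans zero_less_power)
  ultimately have "\<bar>y - z\<bar> / (cf_den u y * cf_den u z) \<le> \<bar>y - z\<bar> / (q_even u)\<^sup>2"
    using q_even_pos[of u] by (intro divide_left_mono) auto
  then show ?thesis
    using \<open>0 < cf_den u y * cf_den u z\<close> by (simp add: cf_map_diff[OF assms] abs_divide abs_of_pos)
qed

text \<open>A next digit \<open>a\<close> puts the remainder 1 - 1 / (a + 1 + z) into [1 - 1/a, 1],
  so these images are the covering sets for a prefix followed by a digit at least 1 / r.\<close>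

lemma cf_map_interval_image:
  assumes "0 \<le> r" "r \<le> 1"
  shows "bounded (cf_map u ` {1 - r..1})" "diameter (cf_map u ` {1 - r..1}) \<le> r / (q_even u)\<^sup>2"
proof -
  have "norm (x - y) \<le> r / (q_even u)\<^sup>2" if *: "x \<in> cf_map u ` {1 - r..1}" "y \<in> cf_map u ` {1 - r..1}" for x y
  proof -
    obtain x' y' where xy: "x = cf_map u x'" "y = cf_map u y'" "x' \<in> {1 - r..1}" "y' \<in> {1 - r..1}"
      using * by auto
    then have "\<bar>x - y\<bar> \<le> \<bar>x' - y'\<bar> / (q_even u)\<^sup>2"
      using assms cf_map_dist_le[of x' y' u] by auto
    also have "\<dots> \<le> r / (q_even u)\<^sup>2"
      using xy by (intro divide_right_mono) auto
    finally show ?thesis by simp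
  qed
  then show "diameter (cf_map u ` {1 - r..1}) \<le> r / (q_even u)\<^sup>2"
    using assms(1) by (intro diameter_le) auto
  have "cf_map u x \<in> {0..1}" if "x \<in> {1 - r..1}" for x
    using that assms cf_map_nonneg[of x u] cf_map_le1[of x u] by auto
  then show "bounded (cf_map u ` {1 - r..1})"
    by (intro bounded_subset[OF bounded_closed_interval[of 0 1]]) auto
qed

lemma I_even_mem_cylinder:
  assumes x: "x \<in> I_even" and r: "1 / real (cf_digit x (2 * Suc n)) \<le> r"
  shows "x \<in> cf_map (even_digits x n) ` {1 - r..1}"
proof -
  define y where "y = (gauss_map ^^ (2 * n)) x"
  have y: "y \<in> I_even" "x = cf_map (even_digits x n) y"
    using I_even_expansion[OF x, of n] by (simp_all add: y_def)
  define a where "a = cf_digit y 2"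
  have a: "a = cf_digit x (2 * Suc n)"
    using cf_digit_shift[of 2 x "2 * n"] by (simp add: y_def a_def)
  define z where "z = (gauss_map ^^ 2) y"
  have *: "1 \<le> a" "0 \<le> z" "y = 1 - 1 / (a + 1 + z)"
    using I_even_step[OF y(1)] by (auto simp: a_def z_def cf_map_Cons I_even_def add_ac)
  have "1 / (a + 1 + z) \<le> 1 / a" using * by (intro divide_left_mono) auto
  also have "\<dots> \<le> r" using r by (simp add: a)
  finally have "1 - r \<le> y" unfolding *(3) by linarith
  moreover have "y \<le> 1" using I_even_bounds[OF y(1)] by simp
  ultimately show ?thesis using y(2) by auto
qed

text \<open>The threshold \<open>r u\<close> may depend on the whole prefix and not just on its
  length, as the cover at record times requires.\<close>

lemma hausdorff_dim_le_cylinders: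
  assumes s: "0 < s" and r: "\<And>u. 0 \<le> r u" "\<And>u. r u \<le> 1"
    and summable: "(\<lambda>u. (r u / (q_even u)\<^sup>2) powr s) summable_on {u. pos_digits u}"
    and A: "A \<subseteq> I_even"
    and inf: "\<And>x N. x \<in> A \<Longrightarrow> \<exists>n\<ge>N. 1 / real (cf_digit x (2 * Suc n)) \<le> r (even_digits x n)"
  shows "hausdorff_dim A \<le> ereal s"
proof (rule hausdorff_dim_le)
  show "hausdorff_measure s A = 0"
  proof (rule hausdorff_measure_limsup_null[OF s summable])
    fix x assume x: "x \<in> A"
    define S where "S = {n. 1 / real (cf_digit x (2 * Suc n)) \<le> r (even_digits x n)}"
    have "infinite S" unfolding infinite_nat_iff_unbounded_le S_def using inf[OF x] by auto
    moreover have "inj_on (even_digits x) S"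
      by (rule inj_on_inverseI[of _ length]) simp
    ultimately have "infinite (even_digits x ` S)" by (simp add: finite_image_iff)
    moreover have "even_digits x ` S \<subseteq> {u \<in> {u. pos_digits u}. x \<in> cf_map u ` {1 - r u..1}}"
      using x A I_even_mem_cylinder[of x] I_even_expansion(1)[of x] by (auto simp: S_def)
    ultimately show "infinite {u \<in> {u. pos_digits u}. x \<in> cf_map u ` {1 - r u..1}}"
      using infinite_super by blast
  qed (use cf_map_interval_image r in auto)
qed (use s in simp)

lemma summable_on_words:
  fixes f :: "nat list \<Rightarrow> real"
  assumes f: "\<And>u. 0 \<le> f u" and g: "\<And>n F. finite F \<Longrightarrow> F \<subseteq> words n \<Longrightarrow> sum f F \<le> g n"
    and sm: "summable g"
  shows "f summable_on {u. pos_digits u}"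
proof (rule nonneg_bdd_above_summable_on)
  show "bdd_above (sum f ` {F. F \<subseteq> {u. pos_digits u} \<and> finite F})"
  proof (rule bdd_aboveI2)
    fix F assume "F \<in> {F. F \<subseteq> {u. pos_digits u} \<and> finite F}"
    then have F: "finite F" "F \<subseteq> {u. pos_digits u}" by auto
    have g0: "0 \<le> g n" for n using g[of "{}" n] by simp
    have "sum f F = (\<Sum>n\<in>length ` F. sum f {u \<in> F. length u = n})"
      using F(1) by (rule sum.image_gen)
    also have "\<dots> \<le> (\<Sum>n\<in>length ` F. g n)"
      using F by (intro sum_mono g) (auto simp: words_def)
    also have "\<dots> \<le> suminf g"
      using F g0 by (intro sum_le_suminf sm) auto
    finally show "sum f F \<le> suminf g" .
  qed
qed (use f in auto)

lemma F_set_subset: "F_set \<phi> \<subseteq> I_even"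
  by (auto simp: F_set_def)

lemma F_set_infinitely_often:
  assumes "x \<in> F_set \<phi>"
  shows "\<exists>n\<ge>N. \<phi> (Suc n) \<le> real (cf_digit x (2 * Suc n))"
proof -
  have "infinite {n. 1 \<le> n \<and> real (cf_digit x (2 * n)) \<ge> \<phi> n}"
    using assms by (simp add: F_set_def)
  then obtain n where n: "Suc N \<le> n" "\<phi> n \<le> real (cf_digit x (2 * n))"
    unfolding infinite_nat_iff_unbounded_le by blast
  then show ?thesis by (intro exI[of _ "n - 1"]) auto
qed

lemma F_set_dim_le_exponential:
  assumes s: "0 < s" and B: "1 < B" and C: "0 \<le> C" "0 < \<delta>" "\<delta> < 1"
    and decay: "\<And>n. s_sum B n s \<le> ennreal (C * \<delta> ^ n)"
    and \<phi>: "\<forall>\<^sub>F n in sequentially. B ^ (2 * n) \<le> \<phi> n"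
  shows "hausdorff_dim (F_set \<phi>) \<le> ereal s"
proof (rule hausdorff_dim_le_cylinders[OF s])
  define r where "r u = 1 / B ^ (2 * Suc (length u))" for u :: "nat list"
  show "0 \<le> r u" "r u \<le> 1" for u
    using B one_le_power[of B "2 * Suc (length u)"] by (auto simp: r_def)
  show "(\<lambda>u. (r u / (q_even u)\<^sup>2) powr s) summable_on {u. pos_digits u}"
  proof (rule summable_on_words)
    fix n F assume F: "finite F" "F \<subseteq> words n"
    have "(\<Sum>u\<in>F. (r u / (q_even u)\<^sup>2) powr s) \<le> (\<Sum>u\<in>F. s_weight B s u)"
    proof (rule sum_mono)
      fix u :: "nat list"
      have "B ^ (2 * length u) \<le> B ^ (2 * Suc (length u))" using B by (intro power_increasing) auto
      then have "r u / (q_even u)\<^sup>2 \<le> 1 / (B ^ (2 * length u) * (q_even u)\<^sup>2)"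
        using B q_even_pos[of u] unfolding r_def divide_divide_eq_left
        by (intro divide_left_mono mult_right_mono) auto
      then have "(r u / (q_even u)\<^sup>2) powr s \<le> (1 / (B ^ (2 * length u) * (q_even u)\<^sup>2)) powr s"
        using s B by (intro powr_mono2) (auto simp: r_def)
      also have "\<dots> = s_weight B s u"
        using base_pos[of B u] B by (simp add: s_weight_def powr_divide powr_minus_divide)
      finally show "(r u / (q_even u)\<^sup>2) powr s \<le> s_weight B s u" .
    qed
    also have "\<dots> \<le> C * \<delta> ^ n"
      using s_sum_finite_le[OF decay _ F] C by simp
    finally show "(\<Sum>u\<in>F. (r u / (q_even u)\<^sup>2) powr s) \<le> C * \<delta> ^ n" .
  next
    show "summable (\<lambda>n. C * \<delta> ^ n)" using C by (intro summable_mult summable_geometric) auto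
  qed simp
  show "\<exists>n\<ge>N. 1 / real (cf_digit x (2 * Suc n)) \<le> r (even_digits x n)" if x: "x \<in> F_set \<phi>" for x N
  proof -
    obtain N0 where N0: "\<And>n. N0 \<le> n \<Longrightarrow> B ^ (2 * n) \<le> \<phi> n"
      using \<phi> by (auto simp: eventually_sequentially)
    obtain n where n: "max N N0 \<le> n" "\<phi> (Suc n) \<le> real (cf_digit x (2 * Suc n))"
      using F_set_infinitely_often[OF x] by blast
    have "B ^ (2 * Suc n) \<le> real (cf_digit x (2 * Suc n))" using N0[of "Suc n"] n by simp
    then have "1 / real (cf_digit x (2 * Suc n)) \<le> 1 / B ^ (2 * Suc n)"
      using B by (intro divide_left_mono) (auto intro!: mult_pos_pos elim: less_le_trans[rotated])
    then show ?thesis using n by (intro exI[of _ n]) (auto simp: r_def)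
  qed
qed (rule F_set_subset)

section \<open>Upper bound for doubly exponential growth: covers at record times\<close>

lemma exists_record:
  fixes f :: "nat \<Rightarrow> real"
  assumes "\<And>M. \<exists>n. M < f n"
  shows "\<exists>n\<ge>N. c \<le> f n \<and> (\<forall>k<n. f k \<le> f n)"
proof -
  define M where "M = max c (Max (f ` {..N}))"
  define n where "n = (LEAST n. M < f n)"
  have n: "M < f n" unfolding n_def using assms by (rule LeastI_ex)
  have "f k \<le> M" if "k \<le> N" for k
    unfolding M_def using that by (intro max.coboundedI2 Max_ge) auto
  then have "N \<le> n" using n by (meson linear not_le)
  moreover have "f k \<le> f n" if "k < n" for k
    using not_less_Least[of k "\<lambda>n. M < f n"] that n by (auto simp: n_def)
  moreover have "c \<le> f n" using n by (simp add: M_def)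
  ultimately show ?thesis by blast
qed

text \<open>Each digit costs a factor 2 for the concatenation and a factor 2 for a + 1 \<le>
  2a.\<close>

lemma ln_q_even_le: "pos_digits u \<Longrightarrow> ln (q_even u) \<le> length u * ln 4 + (\<Sum>k<length u. ln (real (u ! k)))"
proof (induction u rule: rev_induct)
  case (snoc a u)
  have a: "1 \<le> a" "pos_digits u" using snoc.prems by auto
  have "q_even (u @ [a]) \<le> 2 * q_even u * (a + 1)"
    using q_even_append_le[OF a(2), of "[a]"] by (simp add: q_even_singleton)
  also have "\<dots> \<le> 2 * q_even u * (2 * a)"
    using a(1) q_even_pos[of u] by (intro mult_left_mono) auto
  finally have "ln (q_even (u @ [a])) \<le> ln (4 * q_even u * a)"
    using q_even_pos[of "u @ [a]"] by (simp add: ac_simps)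
  also have "\<dots> = ln 4 + ln (q_even u) + ln a"
    using a(1) q_even_pos[of u] by (simp add: ln_mult)
  finally show ?case using snoc.IH[OF a(2)] by (simp add: nth_append algebra_simps)
qed simp

text \<open>At a record with logarithm \<alpha>, both \<alpha> \<ge> d^(n+1) and \<alpha> \<ge> (d -
  1) (ln q(u) - n ln 4) hold. The radius uses a convex combination: the first bound, with weight
  \<open>\<eta>\<close>, beats every exponential in n, and the second raises the power of q(u) until
  the sum over words of length n converges.\<close>

lemma F_set_dim_le_double_exponential:
  assumes d: "1 < d" "d < c" and s: "1 / (1 + d) < s"
    and \<phi>: "\<forall>\<^sub>F n in sequentially. exp (c ^ n) \<le> \<phi> n"
  shows "hausdorff_dim (F_set \<phi>) \<le> ereal s"
proof (rule hausdorff_dim_le_cylinders)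
  have "0 < 1 / (1 + d)" using d by simp
  then show s0: "0 < s" using s by linarith
  \<comment> \<open>With this choice 2 \<rho> = s (d + 1) - \<eta> s (d - 1) is at least the
    midpoint of 1 and s (d + 1), hence above 1, the convergence condition for one digit.\<close>
  define \<eta> where "\<eta> = min (1 / 2) ((s * (d + 1) - 1) / (2 * s * (d - 1)))"
  have sd: "1 < s * (d + 1)" using s d by (simp add: field_simps)
  have \<eta>: "0 < \<eta>" "\<eta> < 1" using sd d s0 by (auto simp: \<eta>_def)
  define \<rho> where "\<rho> = s * (2 + (1 - \<eta>) * (d - 1)) / 2"
  have \<rho>2: "2 * \<rho> = s * (2 + (1 - \<eta>) * (d - 1))" by (simp add: \<rho>_def)
  have "1 / 2 < \<rho>"
  proof -
    have "\<eta> \<le> (s * (d + 1) - 1) / (2 * s * (d - 1))" by (simp add: \<eta>_def)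
    then have "\<eta> * (2 * s * (d - 1)) \<le> s * (d + 1) - 1"
      using s0 d by (simp add: pos_le_divide_eq)
    then show ?thesis using sd by (simp add: \<rho>_def algebra_simps)
  qed
  then obtain Z where Z: "0 \<le> Z" "s_sum 1 1 \<rho> \<le> ennreal Z" by (rule s_sum_1_1_finite)
  define L where "L u = ln (q_even u) - length u * ln 4" for u
  \<comment> \<open>\<open>L u\<close> can be negative; the cut at 1 keeps the radius in the unit
    interval.\<close>
  define r where "r u = min 1 (exp (- (\<eta> * d ^ Suc (length u) + (1 - \<eta>) * (d - 1) * L u)))" for u
  show "0 \<le> r u" "r u \<le> 1" for u by (auto simp: r_def)
  define K where "K = exp (s * (1 - \<eta>) * (d - 1) * ln 4) * Z"
  show "(\<lambda>u. (r u / (q_even u)\<^sup>2) powr s) summable_on {u. pos_digits u}"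
  proof (rule summable_on_words)
    fix n F assume F: "finite F" "F \<subseteq> words n"
    define E where "E = exp (- s * \<eta> * d ^ Suc n) * exp (s * (1 - \<eta>) * (d - 1) * ln 4) ^ n"
    have "(\<Sum>u\<in>F. (r u / (q_even u)\<^sup>2) powr s) \<le> (\<Sum>u\<in>F. E * s_weight 1 \<rho> u)"
    proof (rule sum_mono)
      fix u assume "u \<in> F"
      then have len: "length u = n" using F(2) by (auto simp: words_def)
      let ?l = "ln (q_even u)"
      have q: "(q_even u)\<^sup>2 = exp (2 * ?l)"
        using q_even_pos[of u] by (simp add: exp_double)
      have "r u / (q_even u)\<^sup>2 \<le> exp (- (\<eta> * d ^ Suc n + (1 - \<eta>) * (d - 1) * L u)) / exp (2 * ?l)"
        unfolding q by (intro divide_right_mono) (auto simp: r_def len)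
      also have "\<dots> = exp (- (\<eta> * d ^ Suc n + (1 - \<eta>) * (d - 1) * L u) - 2 * ?l)"
        by (simp only: exp_diff)
      finally have "(r u / (q_even u)\<^sup>2) powr s \<le> exp (- (\<eta> * d ^ Suc n + (1 - \<eta>) * (d - 1) * L u) - 2 * ?l) powr s"
        using s0 by (intro powr_mono2) (auto simp: r_def)
      also have "\<dots> = exp (s * (- (\<eta> * d ^ Suc n + (1 - \<eta>) * (d - 1) * L u) - 2 * ?l))"
        by (simp add: powr_def)
      also have "\<dots> = exp (- s * \<eta> * d ^ Suc n + n * (s * (1 - \<eta>) * (d - 1) * ln 4) + - (2 * \<rho>) * ?l)"
        unfolding \<rho>2 L_def len by (simp add: algebra_simps)
      also have "\<dots> = E * exp (- (2 * \<rho>) * ?l)"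
        unfolding E_def exp_add exp_of_nat_mult ..
      also have "exp (- (2 * \<rho>) * ?l) = s_weight 1 \<rho> u"
        unfolding s_weight_def q by (simp add: powr_def)
      finally show "(r u / (q_even u)\<^sup>2) powr s \<le> E * s_weight 1 \<rho> u" .
    qed
    also have "\<dots> = E * (\<Sum>u\<in>F. s_weight 1 \<rho> u)" by (simp add: sum_distrib_left)
    also have "\<dots> \<le> E * Z ^ n"
    proof (intro mult_left_mono)
      have "s_sum 1 n \<rho> \<le> ennreal (Z ^ n)"
        using s_sum_power_le[of 1 \<rho> n 1] power_mono[OF Z(2), of n] \<open>1 / 2 < \<rho>\<close> Z(1)
        by (simp add: ennreal_power)
      then show "(\<Sum>u\<in>F. s_weight 1 \<rho> u) \<le> Z ^ n"
        using s_sum_finite_le[OF _ _ F] Z(1) by simp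
    qed (simp add: E_def)
    also have "\<dots> = exp (- s * \<eta> * d ^ Suc n) * K ^ n"
      by (simp add: E_def K_def power_mult_distrib)
    finally show "(\<Sum>u\<in>F. (r u / (q_even u)\<^sup>2) powr s) \<le> exp (- s * \<eta> * d ^ Suc n) * K ^ n" .
  next
    have K0: "0 \<le> K" using Z by (simp add: K_def)
    \<comment> \<open>Chosen so that K^n \<le> (exp M / 2)^n, which leaves 2^(-n) for the comparison
      with a geometric series.\<close>
    define M where "M = ln (2 * max 1 K)"
    have M0: "0 < M" by (simp add: M_def)
    have "(\<lambda>n. of_nat n * (1 / d) ^ n) \<longlonglongrightarrow> 0"
      using d by (intro powser_times_n_limit_0) auto
    then have "\<forall>\<^sub>F n in sequentially. of_nat n * (1 / d) ^ n < s * \<eta> * d / M"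
      using s0 \<eta> d M0 by (intro order_tendstoD) auto
    then have "\<forall>\<^sub>F n in sequentially. norm (exp (- s * \<eta> * d ^ Suc n) * K ^ n) \<le> (1 / 2) ^ n"
    proof eventually_elim
      case (elim n)
      have "of_nat n * (1 / d) ^ n * (M * d ^ n) \<le> s * \<eta> * d / M * (M * d ^ n)"
        using elim M0 d by (intro mult_right_mono) auto
      then have nM: "n * M \<le> s * \<eta> * d ^ Suc n"
        using M0 d by (simp add: power_divide mult_ac)
      have "K ^ n \<le> (max 1 K) ^ n" using K0 by (intro power_mono) auto
      also have "max 1 K = exp M / 2" by (simp add: M_def)
      also have "(exp M / 2) ^ n = exp (n * M) * (1 / 2) ^ n"
        by (simp add: power_divide exp_of_nat_mult)
      finally have "exp (- s * \<eta> * d ^ Suc n) * K ^ n \<le> exp (- s * \<eta> * d ^ Suc n) * (exp (n * M) * (1 / 2) ^ n)"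
        by (intro mult_left_mono) auto
      also have "\<dots> = exp (n * M - s * \<eta> * d ^ Suc n) * (1 / 2) ^ n"
        by (simp add: exp_diff exp_minus field_simps)
      also have "\<dots> \<le> 1 * (1 / 2) ^ n"
        using nM by (intro mult_right_mono) auto
      finally show ?case using K0 by simp
    qed
    then show "summable (\<lambda>n. exp (- s * \<eta> * d ^ Suc n) * K ^ n)"
      by (rule summable_comparison_test_ev) (simp add: summable_geometric)
  qed simp
  show "\<exists>n\<ge>N. 1 / real (cf_digit x (2 * Suc n)) \<le> r (even_digits x n)" if x: "x \<in> F_set \<phi>" for x N
  proof -
    define a where "a n = cf_digit x (2 * Suc n)" for n
    define f where "f n = ln (real (a n)) / d ^ Suc n" for n
    have xI: "x \<in> I_even" using x F_set_subset by blast
    have dig: "even_digits x n ! k = a k" if "k < n" for n k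
      using that unfolding even_digits_def a_def by (subst nth_map) (auto simp del: upt_Suc)
    have a1: "1 \<le> a n" for n
      using I_even_expansion(1)[OF xI, of "Suc n"] dig[of n "Suc n"] nth_mem[of n "even_digits x (Suc n)"] by simp
    \<comment> \<open>Digits of size exp(c^(n+1)) occur infinitely often, and d < c makes the
      normalised logarithm unbounded. The record found next need not be at one of those
      times.\<close>
    have "\<exists>n. M < f n" for M
    proof -
      obtain N0 where N0: "\<And>n. N0 \<le> n \<Longrightarrow> exp (c ^ n) \<le> \<phi> n"
        using \<phi> by (auto simp: eventually_sequentially)
      obtain N1 where N1: "M < (c / d) ^ N1" using real_arch_pow[of "c / d" M] d by auto
      obtain n where n: "max N0 N1 \<le> n" "\<phi> (Suc n) \<le> real (a n)"
        using F_set_infinitely_often[OF x] unfolding a_def by blast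
      have "exp (c ^ Suc n) \<le> a n" using N0[of "Suc n"] n by simp
      then have "c ^ Suc n \<le> ln (a n)" using a1[of n] by (simp add: ln_ge_iff)
      then have "(c / d) ^ Suc n \<le> f n"
        using d by (simp add: f_def power_divide divide_right_mono)
      moreover have "(c / d) ^ N1 \<le> (c / d) ^ Suc n"
        using d n by (intro power_increasing) auto
      ultimately show ?thesis using N1 by (intro exI[of _ n]) linarith
    qed
    from exists_record[OF this, of N 1]
    obtain n where n: "N \<le> n" "1 \<le> f n" "\<And>k. k < n \<Longrightarrow> f k \<le> f n" by blast
    define u where "u = even_digits x n"
    have len: "length u = n" by (simp add: u_def)
    define \<alpha> where "\<alpha> = ln (real (a n))"
    have \<alpha>: "d ^ Suc n \<le> \<alpha>" using n(2) d by (simp add: f_def \<alpha>_def pos_le_divide_eq)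
    have \<alpha>0: "0 \<le> \<alpha>" unfolding \<alpha>_def using a1[of n] by simp
    \<comment> \<open>At a record the earlier logarithms lie below a geometric progression of ratio
      \<open>d\<close> that reaches \<alpha> at k = n; its sum over k < n is at most \<alpha> / (d -
      1).\<close>
    have "ln (real (a k)) \<le> \<alpha> / d ^ n * d ^ k" if "k < n" for k
      using n(3)[OF that] d by (simp add: f_def \<alpha>_def field_simps)
    then have "(\<Sum>k<n. ln (real (a k))) \<le> (\<Sum>k<n. \<alpha> / d ^ n * d ^ k)"
      by (intro sum_mono) auto
    also have "\<dots> = \<alpha> / d ^ n * ((d ^ n - 1) / (d - 1))"
      unfolding sum_distrib_left[symmetric] using d by (simp add: geometric_sum)
    also have "\<dots> \<le> \<alpha> / d ^ n * (d ^ n / (d - 1))"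
      using d \<alpha>0 by (intro mult_left_mono divide_right_mono) auto
    also have "\<dots> = \<alpha> / (d - 1)" using d by simp
    finally have "L u \<le> \<alpha> / (d - 1)"
      using ln_q_even_le[of u] I_even_expansion(1)[OF xI, of n] dig[of _ n] unfolding L_def len
      by (simp add: u_def)
    then have "(d - 1) * L u \<le> \<alpha>" using d by (simp add: field_simps)
    then have "(1 - \<eta>) * ((d - 1) * L u) \<le> (1 - \<eta>) * \<alpha>" using \<eta> by (intro mult_left_mono) auto
    moreover have "\<eta> * d ^ Suc n \<le> \<eta> * \<alpha>" using \<alpha> \<eta> by (intro mult_left_mono) auto
    ultimately have "\<eta> * d ^ Suc n + (1 - \<eta>) * (d - 1) * L u \<le> \<alpha>" by (simp add: algebra_simps)
    then have "exp (- \<alpha>) \<le> r u" using \<alpha>0 by (simp add: r_def len)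
    moreover have "exp (- \<alpha>) = 1 / a n"
      using a1[of n] by (simp add: \<alpha>_def exp_minus inverse_eq_divide)
    ultimately show ?thesis using n(1) by (intro exI[of _ n]) (simp add: u_def a_def)
  qed
qed (rule F_set_subset)

section \<open>Separation of cylinders\<close>

lemma cf_map_dist_ge:
  assumes "pos_digits u" "y \<in> {0..1}" "z \<in> {0..1}"
  shows "\<bar>y - z\<bar> / (4 * (q_even u)\<^sup>2) \<le> \<bar>cf_map u y - cf_map u z\<bar>"
proof -
  have pos: "0 < cf_den u y" "0 < cf_den u z"
    using cf_den_ge1[of y u] cf_den_ge1[of z u] assms by auto
  have "cf_den u y * cf_den u z \<le> (2 * q_even u) * (2 * q_even u)"
    using assms pos q_even_pos[of u] by (intro mult_mono cf_den_le_q_even) auto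
  also have "\<dots> = 4 * (q_even u)\<^sup>2" by (simp add: power2_eq_square)
  finally have "\<bar>y - z\<bar> / (4 * (q_even u)\<^sup>2) \<le> \<bar>y - z\<bar> / (cf_den u y * cf_den u z)"
    using pos q_even_pos[of u] by (intro divide_left_mono) auto
  also have "\<dots> = \<bar>cf_map u y - cf_map u z\<bar>"
    using assms pos by (simp add: cf_map_diff abs_divide abs_mult)
  finally show ?thesis .
qed

lemma cf_map_upper_half:
  assumes "pos_digits u" "y \<in> {1 / 2..1}"
  shows "cf_map u y \<in> {1 / 2..1}"
proof (cases u)
  case (Cons a v)
  have "0 \<le> cf_map v y" "cf_map (a # v) y \<le> 1" using assms by (auto intro: cf_map_nonneg cf_map_le1)
  moreover from this have "1 / (a + 1 + cf_map v y) \<le> 1 / 2"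
    using assms Cons by (intro divide_left_mono) auto
  ultimately show ?thesis using assms by (simp add: Cons cf_map_Cons)
qed (use assms in simp)

text \<open>Restricting the arguments to the upper half of the unit interval, where \<open>I_even\<close> lives,
  separates the images for adjacent digits.\<close>
lemma cf_map_digit_separation:
  assumes "1 \<le> a" "1 \<le> a'" "y \<in> {1 / 2..1}" "y' \<in> {1 / 2..1}"
  shows "\<bar>real a - real a'\<bar> / (2 * (real a + 2) * (real a' + 2)) \<le> \<bar>cf_map [a] y - cf_map [a'] y'\<bar>"
proof -
  have *: "(real a' - real a) / (2 * (real a + 2) * (real a' + 2)) \<le> \<bar>cf_map [a'] y' - cf_map [a] y\<bar>"
    if a: "a < a'" and y: "y \<in> {1 / 2..1}" "y' \<in> {1 / 2..1}" for a a' :: nat and y y' :: real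
  proof -
    \<comment> \<open>The remainders differ by at most 1/2 and a' - a \<ge> 1, so half of the digit
      difference survives.\<close>
    have "(real a' - real a) / 2 \<le> (real a' + y') - (real a + y)" using a y by auto
    then have "(real a' - real a) / 2 / ((real a + 2) * (real a' + 2)) \<le> ((real a' + y') - (real a + y)) / ((real a + 1 + y) * (real a' + 1 + y'))"
      using a y by (intro frac_le mult_mono mult_pos_pos) auto
    also have "\<dots> = 1 / (real a + 1 + y) - 1 / (real a' + 1 + y')"
      using y by (simp add: diff_frac_eq)
    also have "\<dots> \<le> \<bar>cf_map [a'] y' - cf_map [a] y\<bar>"
      using y by (simp add: cf_map_Cons add_ac)
    finally show ?thesis by (simp only: mult.assoc divide_divide_eq_left)
  qed
  consider "a = a'" | "a < a'" | "a' < a" by linarith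
  then show ?thesis
  proof cases
    case 2
    then show ?thesis using *[OF 2 assms(3,4)] by (simp add: abs_minus_commute)
  next
    case 3
    have comm: "2 * (real a + 2) * (real a' + 2) = 2 * (real a' + 2) * (real a + 2)" by (simp add: algebra_simps)
    show ?thesis unfolding comm using 3 *[OF 3 assms(4,3)] by simp
  qed simp
qed

text \<open>Leading digits common to both words shrink distances by a bounded factor only, and the
  first differing digit already separates the images.\<close>

lemma cf_map_word_separation:
  assumes "pos_digits u" "pos_digits v" "length u = length v" "u \<noteq> v"
  shows "\<exists>c>0. \<forall>y\<in>{1 / 2..1}. \<forall>z\<in>{1 / 2..1}. c \<le> \<bar>cf_map u y - cf_map v z\<bar>"
  using assms(3,1,2,4)
proof (induction u v rule: list_induct2)
  case (Cons a u b v)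
  have app: "cf_map (a # u) y = cf_map [a] (cf_map u y)" if "y \<in> {1 / 2..1}" for a u and y :: real
    using cf_map_append[of y "[a]" u] that by auto
  show ?case
  proof (cases "a = b")
    case True
    then obtain c where c: "c > 0" "\<And>y z. y \<in> {1 / 2..1} \<Longrightarrow> z \<in> {1 / 2..1} \<Longrightarrow> c \<le> \<bar>cf_map u y - cf_map v z\<bar>"
      using Cons by auto
    have "c / (4 * (q_even [a])\<^sup>2) \<le> \<bar>cf_map (a # u) y - cf_map (b # v) z\<bar>"
      if yz: "y \<in> {1 / 2..1}" "z \<in> {1 / 2..1}" for y z
    proof -
      have "cf_map u y \<in> {1 / 2..1}" "cf_map v z \<in> {1 / 2..1}"
        using Cons.prems by (auto intro!: cf_map_upper_half[OF _ yz(1)] cf_map_upper_half[OF _ yz(2)] simp del: atLeastAtMost_iff)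
      then have "\<bar>cf_map u y - cf_map v z\<bar> / (4 * (q_even [a])\<^sup>2) \<le> \<bar>cf_map [a] (cf_map u y) - cf_map [a] (cf_map v z)\<bar>"
        using Cons.prems by (intro cf_map_dist_ge) auto
      moreover have "c / (4 * (q_even [a])\<^sup>2) \<le> \<bar>cf_map u y - cf_map v z\<bar> / (4 * (q_even [a])\<^sup>2)"
        using c(2)[OF yz] by (intro divide_right_mono) auto
      ultimately show ?thesis using yz True by (simp add: app)
    qed
    then show ?thesis using c(1) q_even_pos[of "[a]"] by (intro exI[of _ "c / (4 * (q_even [a])\<^sup>2)"]) auto
  next
    case False
    have "\<bar>real a - real b\<bar> / (2 * (real a + 2) * (real b + 2)) \<le> \<bar>cf_map (a # u) y - cf_map (b # v) z\<bar>"
      if yz: "y \<in> {1 / 2..1}" "z \<in> {1 / 2..1}" for y z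
      unfolding app[OF yz(1)] app[OF yz(2)]
      using Cons.prems cf_map_upper_half[OF _ yz(1), of u] cf_map_upper_half[OF _ yz(2), of v]
      by (intro cf_map_digit_separation) auto
    moreover have "0 < \<bar>real a - real b\<bar> / (2 * (real a + 2) * (real b + 2))" using False by (intro divide_pos_pos mult_pos_pos) auto
    ultimately show ?thesis by blast
  qed
qed simp

lemma cf_map_finite_separation:
  assumes "finite W" "W \<subseteq> words k"
  obtains c where "0 < c" "\<And>u v y z. u \<in> W \<Longrightarrow> v \<in> W \<Longrightarrow> u \<noteq> v \<Longrightarrow> y \<in> {1 / 2..1} \<Longrightarrow> z \<in> {1 / 2..1} \<Longrightarrow>
    c \<le> \<bar>cf_map u y - cf_map v z\<bar>"
proof -
  define P where "P = {(u, v) \<in> W \<times> W. u \<noteq> v}"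
  have "\<forall>w\<in>P. \<exists>c>0. \<forall>y\<in>{1 / 2..1}. \<forall>z\<in>{1 / 2..1}. c \<le> \<bar>cf_map (fst w) y - cf_map (snd w) z\<bar>"
    using assms(2) by (intro ballI cf_map_word_separation) (auto simp: P_def words_def subset_iff)
  from bchoice[OF this] obtain f where
    f': "\<forall>w\<in>P. 0 < f w \<and> (\<forall>y\<in>{1 / 2..1}. \<forall>z\<in>{1 / 2..1}. f w \<le> \<bar>cf_map (fst w) y - cf_map (snd w) z\<bar>)" ..
  then have f: "0 < f w" "y \<in> {1 / 2..1} \<Longrightarrow> z \<in> {1 / 2..1} \<Longrightarrow> f w \<le> \<bar>cf_map (fst w) y - cf_map (snd w) z\<bar>"
    if "w \<in> P" for w y z
    using that by (simp_all del: atLeastAtMost_iff)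
  have "finite P" by (rule finite_subset[of _ "W \<times> W"]) (use assms(1) in \<open>auto simp: P_def\<close>)
  \<comment> \<open>The inserted 1 gives the minimum a value when \<open>P\<close> is empty.\<close>
  define c where "c = Min (insert 1 (f ` P))"
  have "0 < c" unfolding c_def using \<open>finite P\<close> f(1) by (subst Min_gr_iff) auto
  moreover have "c \<le> \<bar>cf_map u y - cf_map v z\<bar>"
    if "u \<in> W" "v \<in> W" "u \<noteq> v" "y \<in> {1 / 2..1}" "z \<in> {1 / 2..1}" for u v y z
  proof -
    have P: "(u, v) \<in> P" using that by (simp add: P_def)
    have "c \<le> f (u, v)" unfolding c_def using \<open>finite P\<close> P by (intro Min_le) auto
    also have "\<dots> \<le> \<bar>cf_map u y - cf_map v z\<bar>" using f(2)[OF P that(4,5)] by simp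
    finally show ?thesis .
  qed
  ultimately show thesis using that by blast
qed

section \<open>Points coded by infinite sequences of words\<close>

definition word_prefix :: "(nat \<Rightarrow> nat list) \<Rightarrow> nat \<Rightarrow> nat list" where
  "word_prefix \<omega> n = concat (map \<omega> [0..<n])"

definition cf_limit :: "(nat \<Rightarrow> nat list) \<Rightarrow> real" where
  "cf_limit \<omega> = lim (\<lambda>n. cf_map (word_prefix \<omega> n) 0)"

lemma word_prefix_0 [simp]: "word_prefix \<omega> 0 = []"
  by (simp add: word_prefix_def)

lemma word_prefix_Suc: "word_prefix \<omega> (Suc n) = word_prefix \<omega> n @ \<omega> n"
  by (simp add: word_prefix_def)

lemma word_prefix_add: "word_prefix \<omega> (n + m) = word_prefix \<omega> n @ word_prefix (\<lambda>i. \<omega> (n + i)) m"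
  by (induction m) (simp_all add: word_prefix_Suc)

lemma word_prefix_cong: "(\<And>j. j < n \<Longrightarrow> \<omega> j = \<omega>' j) \<Longrightarrow> word_prefix \<omega> n = word_prefix \<omega>' n"
  by (induction n) (simp_all add: word_prefix_Suc)

lemma pos_digits_word_prefix: "(\<And>i. \<omega> i \<in> words k) \<Longrightarrow> pos_digits (word_prefix \<omega> n)"
  by (induction n) (auto simp: word_prefix_Suc words_def)

lemma length_word_prefix: "(\<And>i. \<omega> i \<in> words k) \<Longrightarrow> length (word_prefix \<omega> n) = n * k"
  by (induction n) (auto simp: word_prefix_Suc words_def)

text \<open>Ending each prefix with the least remainder 0 makes the approximants increase, since the
  maps are increasing.\<close>

lemma cf_limit_LIMSEQ: "(\<lambda>n. cf_map (word_prefix \<omega> n) 0) \<longlonglongrightarrow> cf_limit \<omega>"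
proof -
  have "incseq (\<lambda>n. cf_map (word_prefix \<omega> n) 0)"
    by (rule incseq_SucI) (simp add: word_prefix_Suc cf_map_append cf_map_mono cf_map_nonneg)
  moreover have "cf_map (word_prefix \<omega> n) 0 \<in> {0..1}" for n
    using cf_map_nonneg[of 0] cf_map_le1[of 0] by simp
  ultimately have "convergent (\<lambda>n. cf_map (word_prefix \<omega> n) 0)"
    by (intro Bseq_monoseq_convergent) (auto simp: monoseq_iff intro!: BseqI'[of _ 1])
  then show ?thesis unfolding cf_limit_def by (simp add: convergent_LIMSEQ_iff)
qed

lemma cf_limit_in_unit: "cf_limit \<omega> \<in> {0..1}"
  using LIMSEQ_le_const[OF cf_limit_LIMSEQ, of 0] LIMSEQ_le_const2[OF cf_limit_LIMSEQ, of _ 1]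
    cf_map_nonneg[of 0] cf_map_le1[of 0] by simp

lemma cf_limit_shift: "cf_limit \<omega> = cf_map (word_prefix \<omega> n) (cf_limit (\<lambda>i. \<omega> (n + i)))"
proof -
  let ?\<omega>' = "\<lambda>i. \<omega> (n + i)" and ?u = "word_prefix \<omega> n"
  let ?f = "\<lambda>m. cf_map (word_prefix ?\<omega>' m) 0"
  have "(\<lambda>m. \<bar>?f m - cf_limit ?\<omega>'\<bar> / (q_even ?u)\<^sup>2) \<longlonglongrightarrow> \<bar>cf_limit ?\<omega>' - cf_limit ?\<omega>'\<bar> / (q_even ?u)\<^sup>2"
    using q_even_pos[of ?u] by (intro tendsto_intros cf_limit_LIMSEQ) auto
  then have lim: "(\<lambda>m. \<bar>?f m - cf_limit ?\<omega>'\<bar> / (q_even ?u)\<^sup>2) \<longlonglongrightarrow> 0" by simp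
  have le: "norm (cf_map ?u (?f m) - cf_map ?u (cf_limit ?\<omega>')) \<le> \<bar>?f m - cf_limit ?\<omega>'\<bar> / (q_even ?u)\<^sup>2" for m
    using cf_map_dist_le[of "?f m" "cf_limit ?\<omega>'" ?u] cf_limit_in_unit[of ?\<omega>'] cf_map_nonneg[of 0] by simp
  have "(\<lambda>m. cf_map ?u (?f m) - cf_map ?u (cf_limit ?\<omega>')) \<longlonglongrightarrow> 0"
    by (rule Lim_null_comparison[OF always_eventually[OF allI[OF le]] lim])
  then have "(\<lambda>m. cf_map ?u (?f m)) \<longlonglongrightarrow> cf_map ?u (cf_limit ?\<omega>')"
    by (simp add: LIM_zero_iff)
  moreover have "cf_map ?u (?f m) = cf_map (word_prefix \<omega> (m + n)) 0" for m
    by (simp add: word_prefix_add cf_map_append add.commute[of m])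
  moreover have "(\<lambda>m. cf_map (word_prefix \<omega> (m + n)) 0) \<longlonglongrightarrow> cf_limit \<omega>"
    by (rule LIMSEQ_ignore_initial_segment[OF cf_limit_LIMSEQ])
  ultimately show ?thesis by (simp add: LIMSEQ_unique)
qed

lemma cf_limit_bounds:
  assumes "1 \<le> k" "\<And>i. \<omega> i \<in> words k"
  shows "cf_limit \<omega> \<in> {1 / 2..1}" "cf_limit \<omega> < 1"
proof -
  obtain a v where av: "\<omega> 0 = a # v" "1 \<le> a" "pos_digits v"
    using assms(2)[of 0] assms(1) by (cases "\<omega> 0") (auto simp: words_def)
  define y where "y = cf_map v (cf_limit (\<lambda>i. \<omega> (1 + i)))"
  have y: "0 \<le> y" unfolding y_def using cf_limit_in_unit by (intro cf_map_nonneg) simp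
  have eq: "cf_limit \<omega> = 1 - 1 / (a + 1 + y)"
    using cf_limit_shift[of \<omega> 1] cf_limit_in_unit[of "\<lambda>i. \<omega> (1 + i)"]
    by (simp add: word_prefix_def av cf_map_Cons y_def)
  have "1 / (a + 1 + y) \<le> 1 / 2" using av y by (intro divide_left_mono) auto
  then show "cf_limit \<omega> \<in> {1 / 2..1}" using av y by (simp add: eq)
  show "cf_limit \<omega> < 1" using av y by (simp add: eq)
qed

lemma cf_limit_in_I_even:
  assumes k: "1 \<le> k" and \<omega>: "\<And>i. \<omega> i \<in> words k"
  shows "cf_limit \<omega> \<in> I_even"
proof (rule in_I_evenI)
  fix n
  have "n * 1 \<le> n * k" using k by (intro mult_le_mono) auto
  then show "\<exists>u y. n \<le> length u \<and> pos_digits u \<and> 0 < y \<and> y < 1 \<and> cf_limit \<omega> = cf_map u y"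
    using cf_limit_shift[of \<omega> n] pos_digits_word_prefix[of \<omega> k n, OF \<omega>] length_word_prefix[of \<omega> k n, OF \<omega>]
      cf_limit_bounds[OF k, of "\<lambda>i. \<omega> (n + i)", OF \<omega>]
    by (intro exI[of _ "word_prefix \<omega> n"] exI[of _ "cf_limit (\<lambda>i. \<omega> (n + i))"]) auto
qed

lemma cf_digit_cf_limit:
  assumes k: "1 \<le> k" and \<omega>: "\<And>i. \<omega> i \<in> words k" and t: "\<omega> t = v @ [a] @ w"
  shows "cf_digit (cf_limit \<omega>) (2 * (k * t + length v + 1)) = a"
proof -
  define y where "y = cf_limit (\<lambda>i. \<omega> (Suc t + i))"
  define z where "z = cf_map w y"
  have y: "0 < y" "y < 1" using cf_limit_bounds[OF k, of "\<lambda>i. \<omega> (Suc t + i)", OF \<omega>] by (auto simp: y_def)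
  have pos: "pos_digits v" "1 \<le> a" "pos_digits w" using \<omega>[of t] t by (auto simp: words_def)
  have z: "0 < z" "z < 1" using cf_map_in_unit[OF pos(3) y] by (simp_all add: z_def)
  have 1: "cf_limit \<omega> = cf_map (word_prefix \<omega> t @ v) (cf_map [a] z)"
    using cf_limit_shift[of \<omega> "Suc t"] y z unfolding y_def[symmetric] z_def
    by (simp add: word_prefix_Suc t cf_map_append cf_map_nonneg flip: append_assoc)
      (simp add: cf_map_append[of y "[a]" w, simplified] )
  have "pos_digits (word_prefix \<omega> t @ v)" using pos_digits_word_prefix[of \<omega> k t, OF \<omega>] pos by auto
  moreover have "0 < cf_map [a] z" "cf_map [a] z < 1" using cf_map_in_unit[of "[a]" z] pos z by auto
  moreover have "2 * (k * t + length v + 1) = 2 * length (word_prefix \<omega> t @ v) + 2"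
    by (simp add: length_word_prefix[of \<omega> k t, OF \<omega>] mult.commute)
  ultimately have "cf_digit (cf_limit \<omega>) (2 * (k * t + length v + 1)) = cf_digit (cf_map [a] z) 2"
    unfolding 1 by (simp only: cf_digit_cf_map)
  then show ?thesis using gauss_map_cf_map(2)[OF pos(2) z] by simp
qed

section \<open>Words with one large digit\<close>

lemma card_le_spread:
  fixes L :: "nat set"
  assumes "finite L" "\<And>a b. a \<in> L \<Longrightarrow> b \<in> L \<Longrightarrow> \<bar>real a - real b\<bar> \<le> \<Delta>" "0 \<le> \<Delta>"
  shows "real (card L) \<le> \<Delta> + 1"
proof (cases "L = {}")
  case False
  have sub: "L \<subseteq> {Min L..Max L}" using assms(1) by auto
  have "card L \<le> card {Min L..Max L}" using sub by (intro card_mono) auto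
  also have "\<dots> = Suc (Max L) - Min L" by simp
  finally have "real (card L) \<le> real (Suc (Max L) - Min L)" by linarith
  moreover have "Min L \<le> Max L" using assms(1) False by simp
  moreover have "\<bar>real (Max L) - real (Min L)\<bar> \<le> \<Delta>" using assms(1) False by (intro assms(2)) auto
  ultimately show ?thesis by (simp add: of_nat_diff)
qed (use assms in simp)

text \<open>The block length \<open>k\<close> is dictated by the ordinary words, while an index
  where \<phi> is small may have any residue modulo \<open>k\<close>; hence the movable position
  \<open>r\<close>.\<close>

definition marked_word :: "nat \<Rightarrow> nat \<Rightarrow> nat \<Rightarrow> nat list" where
  "marked_word k r a = replicate r 1 @ [a] @ replicate (k - 1 - r) 1"

lemma marked_word_in_words: "r < k \<Longrightarrow> 1 \<le> a \<Longrightarrow> marked_word k r a \<in> words k"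
  by (auto simp: marked_word_def words_def)

lemma q_even_replicate_le: "r \<le> k \<Longrightarrow> q_even (replicate r 1) \<le> q_even (replicate k 1)"
proof -
  assume "r \<le> k"
  then have "replicate k (1::nat) = replicate r 1 @ replicate (k - r) 1" by (simp flip: replicate_add)
  moreover have "q_even (replicate r 1) * 1 \<le> q_even (replicate r 1) * q_even (replicate (k - r) 1)"
    using q_even_ge1 q_even_pos by (intro mult_left_mono) (auto intro: less_imp_le)
  ultimately show ?thesis using q_even_append_ge[of "replicate r 1" "replicate (k - r) 1"] by simp
qed

text \<open>Each run of ones contributes at most \<open>q_even (replicate k 1)\<close>, which makes
  the bound uniform in the position \<open>r\<close>.\<close>

lemma q_even_marked_word_le:
  assumes "r < k"
  shows "q_even (marked_word k r a) \<le> 4 * (q_even (replicate k 1))\<^sup>2 * (a + 1)"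
proof -
  let ?q = "q_even (replicate k 1)"
  have "q_even (marked_word k r a) \<le> 2 * q_even (replicate r 1) * q_even ([a] @ replicate (k - 1 - r) 1)"
    unfolding marked_word_def by (rule q_even_append_le) auto
  also have "\<dots> \<le> 2 * q_even (replicate r 1) * (2 * (a + 1) * q_even (replicate (k - 1 - r) 1))"
  proof (intro mult_left_mono)
    have "cf_den [a] (cf_map (replicate (k - 1 - r) 1) 0) \<le> 2 * (a + 1)"
      using cf_map_le1[of 0 "replicate (k - 1 - r) 1"] by (simp add: cf_den_eq q_pair_def q_step_def)
    then show "q_even ([a] @ replicate (k - 1 - r) 1) \<le> 2 * (a + 1) * q_even (replicate (k - 1 - r) 1)"
      unfolding q_even_def using cf_den_append[of 0 "[a]" "replicate (k - 1 - r) 1"] q_even_pos[of "replicate (k - 1 - r) 1"]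
      by (auto intro: mult_right_mono simp: q_even_def simp del: cf_den.simps)
  qed (use q_even_pos in \<open>auto intro: less_imp_le\<close>)
  also have "\<dots> = 4 * (a + 1) * (q_even (replicate r 1) * q_even (replicate (k - 1 - r) 1))" by simp
  also have "\<dots> \<le> 4 * (a + 1) * (?q * ?q)"
    using assms q_even_pos by (intro mult_left_mono mult_mono q_even_replicate_le) (auto intro: less_imp_le)
  finally show ?thesis by (simp add: power2_eq_square algebra_simps)
qed

lemma marked_word_separation:
  assumes r: "r < k" and a: "N \<le> a" "a < 2 * N" "N \<le> a'" "a' < 2 * N" and y: "y \<in> {1 / 2..1}" "y' \<in> {1 / 2..1}"
  shows "\<bar>real a - real a'\<bar> / (72 * (q_even (replicate k 1))\<^sup>2 * (real N)\<^sup>2)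
    \<le> \<bar>cf_map (marked_word k r a) y - cf_map (marked_word k r a') y'\<bar>"
proof -
  let ?u = "replicate r (1::nat)" and ?v = "replicate (k - 1 - r) (1::nat)" and ?q = "q_even (replicate k 1)"
  define z z' where "z = cf_map ?v y" and "z' = cf_map ?v y'"
  have z: "z \<in> {1 / 2..1}" "z' \<in> {1 / 2..1}"
    unfolding z_def z'_def by (intro cf_map_upper_half y; simp)+
  have N: "1 \<le> N" using a by linarith
  have w: "cf_map [a] z \<in> {1 / 2..1}" "cf_map [a'] z' \<in> {1 / 2..1}"
    using a N by (intro cf_map_upper_half z; simp)+
  have eq: "cf_map (marked_word k r a) y = cf_map ?u (cf_map [a] z)" "cf_map (marked_word k r a') y' = cf_map ?u (cf_map [a'] z')"
    using y by (auto simp: marked_word_def z_def z'_def cf_map_append cf_map_nonneg simp del: append_Cons)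
  \<comment> \<open>A digit below 2N satisfies a + 2 \<le> 3N because 1 \<le> N. The final 72 is 4
    times 18.\<close>
  have "(2 * (real a + 2) * (real a' + 2)) \<le> 2 * (3 * real N) * (3 * real N)"
    using a N by (intro mult_mono) auto
  then have "\<bar>real a - real a'\<bar> / (18 * (real N)\<^sup>2) \<le> \<bar>real a - real a'\<bar> / (2 * (real a + 2) * (real a' + 2))"
    using N by (intro divide_left_mono) (auto simp: power2_eq_square)
  also have "\<dots> \<le> \<bar>cf_map [a] z - cf_map [a'] z'\<bar>"
    using a N by (intro cf_map_digit_separation z) auto
  finally have 1: "\<bar>real a - real a'\<bar> / (18 * (real N)\<^sup>2) \<le> \<bar>cf_map [a] z - cf_map [a'] z'\<bar>" .
  have qq: "(q_even ?u)\<^sup>2 \<le> ?q\<^sup>2" using r q_even_pos by (intro power_mono q_even_replicate_le) (auto intro: less_imp_le)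
  have "\<bar>real a - real a'\<bar> / (18 * (real N)\<^sup>2) / (4 * ?q\<^sup>2) \<le> \<bar>cf_map [a] z - cf_map [a'] z'\<bar> / (4 * (q_even ?u)\<^sup>2)"
    using qq q_even_pos[of ?u] by (intro frac_le 1) auto
  also have "\<dots> \<le> \<bar>cf_map ?u (cf_map [a] z) - cf_map ?u (cf_map [a'] z')\<bar>"
    using w by (intro cf_map_dist_ge) auto
  finally show ?thesis unfolding eq by (simp add: mult_ac)
qed

section \<open>Lower bounds\<close>

lemma finite_pmf_of_weights:
  fixes f :: "'a \<Rightarrow> real"
  assumes "finite W" "W \<noteq> {}" "\<And>w. w \<in> W \<Longrightarrow> 0 < f w"
  obtains p where "set_pmf p = W" "\<And>w. w \<in> W \<Longrightarrow> pmf p w = f w / sum f W"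
proof -
  have S: "0 < sum f W" using assms by (intro sum_pos) auto
  define g where "g w = (if w \<in> W then f w / sum f W else 0)" for w
  have g0: "0 \<le> g w" for w using S assms(3) by (auto simp: g_def intro!: divide_nonneg_pos less_imp_le)
  have "(\<integral>\<^sup>+ w. ennreal (g w) \<partial>count_space UNIV) = (\<Sum>w\<in>W. ennreal (g w))"
    using assms(1) by (intro nn_integral_count_space') (auto simp: g_def)
  also have "\<dots> = ennreal (\<Sum>w\<in>W. f w / sum f W)"
    using S assms(3) by (subst sum_ennreal) (auto simp: g_def intro!: divide_nonneg_pos less_imp_le)
  also have "(\<Sum>w\<in>W. f w / sum f W) = 1" using S by (simp flip: sum_divide_distrib)
  finally have int: "(\<integral>\<^sup>+ w. ennreal (g w) \<partial>count_space UNIV) = 1" by simp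
  have pmf: "pmf (embed_pmf g) w = g w" for w by (rule pmf_embed_pmf[OF g0 int])
  show thesis
  proof
    show "set_pmf (embed_pmf g) = W"
      using assms(3) S by (auto simp: set_pmf_eq pmf g_def less_imp_neq[symmetric])
    show "pmf (embed_pmf g) w = f w / sum f W" if "w \<in> W" for w using that by (simp add: pmf g_def)
  qed
qed

text \<open>Words of length \<open>k\<close> are drawn independently: from a fixed finite alphabet \<open>W\<close>, with weights
  \<open>q_even u powr (- 2 * s)\<close>, at the times outside \<open>T\<close>; with one digit uniformly distributed in
  \<open>[N t, 2 N t)\<close> and all others equal to 1 at the times \<open>t \<in> T\<close>. The sequence \<open>R\<close> bounds the mass of a cylinder
  relative to \<open>q_even u powr (- 2 * s)\<close>.\<close>
lemma hausdorff_dim_ge_marked: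
  fixes N r :: "nat \<Rightarrow> nat"
  assumes s: "0 < s" "s \<le> 1" and k: "1 \<le> k"
    and W: "finite W" "W \<subseteq> words k" "W \<noteq> {}"
    and r: "\<And>t. r t < k" and N: "\<And>t. 1 \<le> N t"
    and D: "D = (16 * (q_even (replicate k 1))\<^sup>2) powr (2 * s)"
    and R0: "1 \<le> R 0"
    and R_big: "\<And>t. t \<in> T \<Longrightarrow> R t * (D * N t powr (2 * s - 1)) \<le> R (Suc t)"
    and R_small: "\<And>t. t \<notin> T \<Longrightarrow> R t * (4 powr s / (\<Sum>u\<in>W. q_even u powr (- 2 * s))) \<le> R (Suc t)"
    and R_nonneg: "\<And>t. 0 \<le> R t" and R_le: "\<And>t. R t \<le> C" and R_le_big: "\<And>t. t \<in> T \<Longrightarrow> R t \<le> C * N t powr (- s)"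
  shows "ereal s \<le> hausdorff_dim {x \<in> I_even. \<forall>t\<in>T. N t \<le> cf_digit x (2 * (k * t + r t + 1))}"
proof -
  define Q where "Q = q_even (replicate k 1)"
  have Q1: "1 \<le> Q" by (simp add: Q_def q_even_ge1)
  have C1: "1 \<le> C" using R0 R_le[of 0] by linarith
  obtain p0 where p0: "set_pmf p0 = W"
      "\<And>w. w \<in> W \<Longrightarrow> pmf p0 w = q_even w powr (- 2 * s) / (\<Sum>u\<in>W. q_even u powr (- 2 * s))"
    using finite_pmf_of_weights[OF W(1,3), of "\<lambda>w. q_even w powr (- 2 * s)"] q_even_pos
    by (metis powr_gt_zero less_irrefl)
  define M where "M t = marked_word k (r t) ` {N t..<2 * N t}" for t
  have inj: "inj_on (marked_word k (r t)) A" for t A by (auto simp: inj_on_def marked_word_def)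
  have M: "finite (M t)" "M t \<noteq> {}" "card (M t) = N t" for t
    using N[of t] card_image[OF inj[of t "{N t..<2 * N t}"]] by (auto simp: M_def)
  define p where "p t = (if t \<in> T then pmf_of_set (M t) else p0)" for t
  have set_p: "set_pmf (p t) = (if t \<in> T then M t else W)" for t
    using M p0 by (simp add: p_def set_pmf_of_set)
  define \<Omega> where "\<Omega> = {\<omega>. \<forall>i. \<omega> i \<in> set_pmf (p i)}"
  have wordM: "M t \<subseteq> words k" for t
    using N[of t] marked_word_in_words[OF r[of t]] by (auto simp: M_def)
  have word: "\<omega> i \<in> words k" if "\<omega> \<in> \<Omega>" for \<omega> i
    using that W(2) wordM[of i] by (auto simp: \<Omega>_def set_p split: if_splits)
  define q where "q \<omega> i = q_even (word_prefix \<omega> i)" for \<omega> i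
  have q_pos: "0 < q \<omega> i" for \<omega> i by (simp add: q_def q_even_pos)
  \<comment> \<open>Appending a word w multiplies q by at most 2 q(w), so \<open>R\<close> has to
    absorb pmf(w) (2 q(w))^(2s). The assumptions \<open>R_big\<close> and \<open>R_small\<close> are
    bounds for this product in the two cases.\<close>
  have mass: "(\<Prod>j<i. pmf (p j) (\<omega> j)) \<le> R i * q \<omega> i powr (- 2 * s)" if \<omega>: "\<omega> \<in> \<Omega>" for \<omega> i
  proof (induction i)
    case 0
    then show ?case using R0 by (simp add: q_def)
  next
    case (Suc i)
    have pos: "pos_digits (word_prefix \<omega> i)" using pos_digits_word_prefix[of \<omega> k i] word[OF \<omega>] by simp
    let ?w = "q_even (\<omega> i)"
    have w: "0 < ?w" by (rule q_even_pos)
    have step: "R i * (pmf (p i) (\<omega> i) * (2 * ?w) powr (2 * s)) \<le> R (Suc i)"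
    proof (cases "i \<in> T")
      case True
      then obtain a where a: "N i \<le> a" "a < 2 * N i" "\<omega> i = marked_word k (r i) a"
        using \<omega> by (auto simp: \<Omega>_def set_p M_def dest!: spec[of _ i])
      \<comment> \<open>The 16 in \<open>D\<close> is made of 4 from the marked word, 2 from a + 1
        \<le> 2N and 2 from the concatenation.\<close>
      have "?w \<le> 4 * Q\<^sup>2 * (a + 1)" unfolding a(3) Q_def by (rule q_even_marked_word_le[OF r])
      also have "\<dots> \<le> 4 * Q\<^sup>2 * (2 * N i)" using a by (intro mult_left_mono) auto
      finally have "(2 * ?w) powr (2 * s) \<le> (16 * Q\<^sup>2 * N i) powr (2 * s)"
        using s w by (intro powr_mono2) (auto simp: mult_ac)
      also have "\<dots> = D * N i powr (2 * s)" unfolding D Q_def[symmetric] by (rule powr_mult)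
      finally have "pmf (p i) (\<omega> i) * (2 * ?w) powr (2 * s) \<le> 1 / N i * (D * N i powr (2 * s))"
        using True a M[of i] \<omega> by (auto simp: p_def pmf_of_set M_def indicator_def intro!: mult_mono divide_right_mono)
      also have "\<dots> = D * N i powr (2 * s - 1)"
        using N[of i] by (simp add: powr_diff)
      finally show ?thesis using R_big[OF True] R_nonneg[of i] by (meson mult_left_mono order_trans)
    next
      case False
      then have wi: "\<omega> i \<in> W" using \<omega> by (auto simp: \<Omega>_def set_p dest: spec[of _ i])
      have "?w powr (- 2 * s) * (2 * ?w) powr (2 * s) = 2 powr (2 * s) * (?w powr (- 2 * s) * ?w powr (2 * s))"
        by (simp add: powr_mult)
      also have "?w powr (- 2 * s) * ?w powr (2 * s) = 1" using w by (simp flip: powr_add)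
      also have "2 powr (2 * s) = (4 :: real) powr s" using powr_powr[of "2 :: real" 2 s] by simp
      finally have "pmf (p i) (\<omega> i) * (2 * ?w) powr (2 * s) = 4 powr s / (\<Sum>u\<in>W. q_even u powr (- 2 * s))"
        using False p0(2)[OF wi] by (simp add: p_def)
      then show ?thesis using R_small[OF False] by simp
    qed
    have q_le: "q \<omega> (Suc i) \<le> q \<omega> i * (2 * ?w)"
      using q_even_append_le[OF pos, of "\<omega> i"] by (simp add: q_def word_prefix_Suc mult_ac)
    have "(\<Prod>j<Suc i. pmf (p j) (\<omega> j)) \<le> R i * q \<omega> i powr (- 2 * s) * pmf (p i) (\<omega> i)"
      using Suc by (simp add: mult_right_mono)
    also have "\<dots> = R i * (pmf (p i) (\<omega> i) * (2 * ?w) powr (2 * s)) * (q \<omega> i * (2 * ?w)) powr (- 2 * s)"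
    proof -
      have "(2 * ?w) powr (2 * s) * (2 * ?w) powr (- 2 * s) = 1" using w by (simp flip: powr_add)
      then show ?thesis unfolding powr_mult[of "q \<omega> i" "2 * ?w"] by (simp add: mult_ac)
    qed
    also have "\<dots> \<le> R (Suc i) * (q \<omega> i * (2 * ?w)) powr (- 2 * s)"
      using step by (rule mult_right_mono) simp
    also have "\<dots> \<le> R (Suc i) * q \<omega> (Suc i) powr (- 2 * s)"
      using q_le q_pos[of \<omega> "Suc i"] s R_nonneg by (intro mult_left_mono powr_mono2') auto
    finally show ?case .
  qed
  obtain c where c: "0 < c" "\<And>u v y z. u \<in> W \<Longrightarrow> v \<in> W \<Longrightarrow> u \<noteq> v \<Longrightarrow> y \<in> {1 / 2..1} \<Longrightarrow> z \<in> {1 / 2..1} \<Longrightarrow>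
      c \<le> \<bar>cf_map u y - cf_map v z\<bar>"
    using cf_map_finite_separation[OF W(1,2)] by blast
  \<comment> \<open>One summand per case below: 4 / c from the separation of \<open>W\<close>, and
    576 from the spread of marked digits.\<close>
  define C' where "C' = C * (4 / c) powr s + C * (576 * Q\<^sup>2) powr s"
  have dim: "ereal s \<le> hausdorff_dim (cf_limit ` \<Omega>)"
  proof (rule mass_distribution_principle[OF s(1) _ _ \<Omega>_def])
    show "0 < C'" unfolding C'_def using C1 c(1) by (intro add_pos_nonneg mult_pos_pos) auto
  next
    fix \<omega> assume \<omega>: "\<omega> \<in> \<Omega>"
    have le: "(\<Prod>j<i. pmf (p j) (\<omega> j)) \<le> C * (2 powr (- 2 * s)) ^ i" for i
    proof -
      have "i * 1 \<le> i * k" using k by (intro mult_le_mono) auto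
      then have "(2::real) ^ i \<le> 2 ^ length (word_prefix \<omega> i)"
        using length_word_prefix[of \<omega> k i] word[OF \<omega>] by (intro power_increasing) auto
      also have "\<dots> \<le> q \<omega> i"
        unfolding q_def using pos_digits_word_prefix[of \<omega> k i] word[OF \<omega>] by (intro q_even_ge_power2) auto
      finally have "q \<omega> i powr (- 2 * s) \<le> (2 ^ i) powr (- 2 * s)"
        using s by (intro powr_mono2') auto
      also have "\<dots> = (2 powr (- 2 * s)) ^ i" by (simp add: powr_def ln_realpow mult_ac flip: exp_of_nat_mult)
      finally have "R i * q \<omega> i powr (- 2 * s) \<le> C * (2 powr (- 2 * s)) ^ i"
        using R_le[of i] C1 by (intro mult_mono) auto
      then show ?thesis using mass[OF \<omega>, of i] by linarith
    qed
    have "(\<lambda>i. C * (2 powr (- 2 * s)) ^ i) \<longlonglongrightarrow> C * 0"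
      using s by (intro tendsto_intros LIMSEQ_power_zero) (simp add: powr_less_one)
    then have lim: "(\<lambda>i. C * (2 powr (- 2 * s)) ^ i) \<longlonglongrightarrow> 0" by simp
    show "(\<lambda>i. \<Prod>j<i. pmf (p j) (\<omega> j)) \<longlonglongrightarrow> 0"
    proof (rule tendsto_sandwich[OF always_eventually always_eventually tendsto_const lim])
      show "\<forall>i. 0 \<le> (\<Prod>j<i. pmf (p j) (\<omega> j))" by (simp add: prod_nonneg)
    qed (use le in blast)
  next
    fix U i \<omega> \<omega>'
    assume U: "bounded U" and \<omega>: "\<omega> \<in> \<Omega>" "\<omega>' \<in> \<Omega>" and inU: "cf_limit \<omega> \<in> U" "cf_limit \<omega>' \<in> U"
      and agree: "\<And>j. j < i \<Longrightarrow> \<omega>' j = \<omega> j" and differ: "\<omega>' i \<noteq> \<omega> i"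
    define S where "S = {\<omega>'' i |\<omega>''. \<omega>'' \<in> \<Omega> \<and> cf_limit \<omega>'' \<in> U \<and> (\<forall>j<i. \<omega>'' j = \<omega> j)}"
    define m where "m = (\<Prod>j<i. pmf (p j) (\<omega> j))"
    have m0: "0 \<le> m" unfolding m_def by (intro prod_nonneg) auto
    define d where "d = diameter U"
    define q0 where "q0 = q \<omega> i"
    have q0: "0 < q0" by (simp add: q0_def q_pos)
    have d0: "0 \<le> d" unfolding d_def by (rule diameter_ge_0[OF U])
    define tail where "tail \<omega> = cf_limit (\<lambda>j. \<omega> (Suc i + j))" for \<omega> :: "nat \<Rightarrow> nat list"
    have tail: "tail \<omega>1 \<in> {1 / 2..1}" if "\<omega>1 \<in> \<Omega>" for \<omega>1
      unfolding tail_def using cf_limit_bounds(1)[OF k, of "\<lambda>j. \<omega>1 (Suc i + j)"] word[OF that] by simp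
    \<comment> \<open>Two coded points of \<open>U\<close> with the common prefix are pulled back
      through it, which expands their distance by at most 4 q0^2.\<close>
    have gap: "\<bar>cf_map (\<omega>1 i) (tail \<omega>1) - cf_map (\<omega>2 i) (tail \<omega>2)\<bar> \<le> 4 * q0\<^sup>2 * d"
      if 1: "\<omega>1 \<in> \<Omega>" "cf_limit \<omega>1 \<in> U" "\<And>j. j < i \<Longrightarrow> \<omega>1 j = \<omega> j"
        and 2: "\<omega>2 \<in> \<Omega>" "cf_limit \<omega>2 \<in> U" "\<And>j. j < i \<Longrightarrow> \<omega>2 j = \<omega> j" for \<omega>1 \<omega>2
    proof -
      have eq: "cf_limit \<omega>1 = cf_map (word_prefix \<omega> i) (cf_map (\<omega>1 i) (tail \<omega>1))"
        if "\<omega>1 \<in> \<Omega>" "\<And>j. j < i \<Longrightarrow> \<omega>1 j = \<omega> j" for \<omega>1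
      proof -
        have "cf_limit \<omega>1 = cf_map (word_prefix \<omega> i @ \<omega>1 i) (tail \<omega>1)"
          using cf_limit_shift[of \<omega>1 "Suc i"] word_prefix_cong[of i \<omega>1 \<omega>] that(2)
          by (simp add: word_prefix_Suc tail_def)
        then show ?thesis using tail[OF that(1)] by (simp add: cf_map_append)
      qed
      have mem: "cf_map (\<omega>1 i) (tail \<omega>1) \<in> {0..1}" if "\<omega>1 \<in> \<Omega>" for \<omega>1
        using tail[OF that] by (auto intro: cf_map_nonneg cf_map_le1)
      have "\<bar>cf_map (\<omega>1 i) (tail \<omega>1) - cf_map (\<omega>2 i) (tail \<omega>2)\<bar> / (4 * q0\<^sup>2) \<le> \<bar>cf_limit \<omega>1 - cf_limit \<omega>2\<bar>"
        using cf_map_dist_ge[OF _ mem[OF 1(1)] mem[OF 2(1)], of "word_prefix \<omega> i"] eq[OF 1(1)] eq[OF 2(1)] 1(3) 2(3)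
          pos_digits_word_prefix[of \<omega> k i] word[OF \<omega>(1)] by (simp add: q0_def q_def)
      also have "\<dots> \<le> d"
        unfolding d_def using diameter_bounded_bound[OF U 1(2) 2(2)] by (simp add: dist_real_def)
      finally show ?thesis using q0 by (simp add: pos_divide_le_eq mult_ac)
    qed
    have m_le: "m \<le> R i * q0 powr (- 2 * s)" unfolding m_def q0_def by (rule mass[OF \<omega>(1)])
    have q0sq: "q0 powr (- 2 * s) * (q0\<^sup>2) powr s = 1"
    proof -
      have "(q0\<^sup>2) powr s = q0 powr (2 * s)" using powr_powr[of q0 2 s] q0 by simp
      then show ?thesis using q0 by (simp flip: powr_add)
    qed
    have "m * measure_pmf.prob (p i) S \<le> C' * d powr s"
    proof (cases "i \<in> T")
      case False
      then have "\<omega> i \<in> W" "\<omega>' i \<in> W" using \<omega> by (auto simp: \<Omega>_def set_p dest: spec[of _ i])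
      \<comment> \<open>Two different ordinary words at coordinate \<open>i\<close> force
        \<open>U\<close> to be at least comparable in size to the whole cylinder, so the probability
        of \<open>S\<close> can be bounded by 1.\<close>
      then have "c \<le> 4 * q0\<^sup>2 * d"
        using c(2)[of "\<omega>' i" "\<omega> i" "tail \<omega>'" "tail \<omega>"] gap[of \<omega>' \<omega>] \<omega> inU agree differ tail by (meson order_trans)
      then have "1 \<le> (4 / c) * (q0\<^sup>2 * d)" using c(1) by (simp add: field_simps)
      then have "1 \<le> ((4 / c) * (q0\<^sup>2 * d)) powr s" using s by (intro ge_one_powr_ge_zero) auto
      also have "\<dots> = (4 / c) powr s * ((q0\<^sup>2) powr s * d powr s)" by (simp only: powr_mult)
      finally have "C * q0 powr (- 2 * s) * 1 \<le> C * q0 powr (- 2 * s) * ((4 / c) powr s * ((q0\<^sup>2) powr s * d powr s))"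
        using C1 by (intro mult_left_mono) auto
      also have "\<dots> = C * (4 / c) powr s * (q0 powr (- 2 * s) * (q0\<^sup>2) powr s) * d powr s" by (simp only: mult_ac)
      finally have "C * q0 powr (- 2 * s) \<le> C * (4 / c) powr s * d powr s" unfolding q0sq by simp
      moreover have "m * measure_pmf.prob (p i) S \<le> m * 1" using m0 by (intro mult_left_mono) auto
      moreover have "R i * q0 powr (- 2 * s) \<le> C * q0 powr (- 2 * s)" using R_le by (intro mult_right_mono) auto
      ultimately have "m * measure_pmf.prob (p i) S \<le> C * (4 / c) powr s * d powr s" using m_le by linarith
      also have "\<dots> \<le> C' * d powr s" unfolding C'_def using C1 by (intro mult_right_mono) auto
      finally show ?thesis .
    next
      case True
      have inM: "\<omega>1 i \<in> M i" if "\<omega>1 \<in> \<Omega>" for \<omega>1 using that True by (auto simp: \<Omega>_def set_p dest: spec[of _ i])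
      define L where "L = {a \<in> {N i..<2 * N i}. marked_word k (r i) a \<in> S}"
      have "S \<subseteq> M i" unfolding S_def using inM by auto
      then have S_eq: "M i \<inter> S = marked_word k (r i) ` L" unfolding M_def L_def by auto
      define \<Delta> where "\<Delta> = 288 * Q\<^sup>2 * (real (N i))\<^sup>2 * (q0\<^sup>2 * d)"
      have N0: "0 < real (N i)" using N[of i] by simp
      have spread: "\<bar>real a - real b\<bar> \<le> \<Delta>" if ab: "a \<in> L" "b \<in> L" for a b
      proof -
        obtain \<omega>1 where 1: "\<omega>1 \<in> \<Omega>" "cf_limit \<omega>1 \<in> U" "\<And>j. j < i \<Longrightarrow> \<omega>1 j = \<omega> j" "\<omega>1 i = marked_word k (r i) a"
          using ab(1) unfolding L_def S_def by fastforce
        obtain \<omega>2 where 2: "\<omega>2 \<in> \<Omega>" "cf_limit \<omega>2 \<in> U" "\<And>j. j < i \<Longrightarrow> \<omega>2 j = \<omega> j" "\<omega>2 i = marked_word k (r i) b"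
          using ab(2) unfolding L_def S_def by fastforce
        have "\<bar>real a - real b\<bar> / (72 * Q\<^sup>2 * (real (N i))\<^sup>2) \<le>
            \<bar>cf_map (marked_word k (r i) a) (tail \<omega>1) - cf_map (marked_word k (r i) b) (tail \<omega>2)\<bar>"
          unfolding Q_def using ab 1 2 by (intro marked_word_separation r tail) (auto simp: L_def)
        also have "\<dots> \<le> 4 * q0\<^sup>2 * d" using gap[OF 1(1-3) 2(1-3)] 1(4) 2(4) by simp
        finally show ?thesis using N0 Q1 by (simp add: \<Delta>_def pos_divide_le_eq mult_ac)
      qed
      obtain a where a: "a \<in> {N i..<2 * N i}" "\<omega> i = marked_word k (r i) a" using inM[OF \<omega>(1)] by (auto simp: M_def)
      obtain a' where a': "a' \<in> {N i..<2 * N i}" "\<omega>' i = marked_word k (r i) a'" using inM[OF \<omega>(2)] by (auto simp: M_def)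
      have "\<omega> i \<in> S" "\<omega>' i \<in> S" unfolding S_def using \<omega> inU agree by blast+
      then have "a \<in> L" "a' \<in> L" using a a' by (auto simp: L_def)
      moreover have "a \<noteq> a'" using a a' differ by auto
      \<comment> \<open>The disagreement at \<open>i\<close> gives two digits in \<open>L\<close>;
        the spread is thus at least 1, and the additive 1 in the count is absorbed into 2
        \<Delta>.\<close>
      ultimately have "1 \<le> \<Delta>" using spread[of a a'] by linarith
      moreover have "finite L" by (simp add: L_def)
      ultimately have "real (card L) \<le> 2 * \<Delta>" using card_le_spread[of L \<Delta>] spread by auto
      then have "card L / N i \<le> 2 * \<Delta> / N i" by (intro divide_right_mono) auto
      also have "\<dots> = 576 * Q\<^sup>2 * (N i * (q0\<^sup>2 * d))"
        using N0 by (simp add: \<Delta>_def power2_eq_square)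
      finally have frac_le: "card L / N i \<le> 576 * Q\<^sup>2 * (N i * (q0\<^sup>2 * d))" .
      have prob: "measure_pmf.prob (p i) S = card L / N i"
        using True M[of i] by (simp add: p_def measure_pmf_of_set S_eq card_image[OF inj])
      define P where "P = measure_pmf.prob (p i) S"
      have P: "0 \<le> P" "P \<le> 1" "P \<le> 576 * Q\<^sup>2 * (N i * (q0\<^sup>2 * d))"
        using frac_le prob measure_pmf.prob_le_1[of "p i" S] by (auto simp: P_def)
      \<comment> \<open>Since P \<le> 1 and s \<le> 1, this interpolates between the bound 1 and the
        bound of order N q0^2 d. The resulting N^s cancels against the factor N^(-s) in
        \<open>R_le_big\<close>.\<close>
      have "P \<le> P powr s" using powr_mono'[of s 1 P] P s by simp
      also have "\<dots> \<le> (576 * Q\<^sup>2 * (N i * (q0\<^sup>2 * d))) powr s" using P s by (intro powr_mono2) auto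
      also have "\<dots> = (576 * Q\<^sup>2) powr s * (N i powr s * ((q0\<^sup>2) powr s * d powr s))" by (simp only: powr_mult)
      finally have P_le: "P \<le> (576 * Q\<^sup>2) powr s * (N i powr s * ((q0\<^sup>2) powr s * d powr s))" .
      have "m \<le> C * N i powr (- s) * q0 powr (- 2 * s)"
        using m_le mult_right_mono[OF R_le_big[OF True], of "q0 powr (- 2 * s)"] by simp
      then have "m * P \<le> C * N i powr (- s) * q0 powr (- 2 * s) * ((576 * Q\<^sup>2) powr s * (N i powr s * ((q0\<^sup>2) powr s * d powr s)))"
        using P_le P(1) C1 by (intro mult_mono) auto
      also have "\<dots> = C * (576 * Q\<^sup>2) powr s * (N i powr (- s) * N i powr s) * (q0 powr (- 2 * s) * (q0\<^sup>2) powr s) * d powr s"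
        by (simp only: mult_ac)
      also have "N i powr (- s) * N i powr s = 1" using N0 by (simp flip: powr_add)
      finally have "m * P \<le> C * (576 * Q\<^sup>2) powr s * d powr s" unfolding q0sq by simp
      also have "\<dots> \<le> C' * d powr s" unfolding C'_def using C1 by (intro mult_right_mono) auto
      finally show ?thesis unfolding P_def .
    qed
    then show "(\<Prod>j<i. pmf (p j) (\<omega> j)) *
         measure_pmf.prob (p i) {\<omega>'' i |\<omega>''. \<omega>'' \<in> \<Omega> \<and> cf_limit \<omega>'' \<in> U \<and> (\<forall>j<i. \<omega>'' j = \<omega> j)}
       \<le> C' * diameter U powr s"
      unfolding m_def S_def d_def .
  qed
  have "cf_limit ` \<Omega> \<subseteq> {x \<in> I_even. \<forall>t\<in>T. N t \<le> cf_digit x (2 * (k * t + r t + 1))}"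
  proof clarify
    fix \<omega> assume \<omega>: "\<omega> \<in> \<Omega>"
    have "N t \<le> cf_digit (cf_limit \<omega>) (2 * (k * t + r t + 1))" if t: "t \<in> T" for t
    proof -
      have "\<omega> t \<in> M t" using \<omega> t by (auto simp: \<Omega>_def set_p dest: spec[of _ t])
      then obtain a where a: "N t \<le> a" "\<omega> t = marked_word k (r t) a" by (auto simp: M_def)
      then show ?thesis
        using cf_digit_cf_limit[OF k, of \<omega> t "replicate (r t) 1" a] word[OF \<omega>] by (simp add: marked_word_def)
    qed
    then show "cf_limit \<omega> \<in> I_even \<and> (\<forall>t\<in>T. N t \<le> cf_digit (cf_limit \<omega>) (2 * (k * t + r t + 1)))"
      using cf_limit_in_I_even[OF k, of \<omega>] word[OF \<omega>] by blast
  qed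
  then show ?thesis using dim hausdorff_dim_mono order_trans by blast
qed

lemma F_set_supersetI:
  assumes inf: "\<And>n0. \<exists>t\<in>T. n0 \<le> t" and k: "1 \<le> k"
    and \<phi>: "\<And>t. t \<in> T \<Longrightarrow> \<phi> (k * t + r t + 1) \<le> real (N t)"
  shows "{x \<in> I_even. \<forall>t\<in>T. N t \<le> cf_digit x (2 * (k * t + r t + 1))} \<subseteq> F_set \<phi>"
proof clarify
  fix x assume x: "x \<in> I_even" "\<forall>t\<in>T. N t \<le> cf_digit x (2 * (k * t + r t + 1))"
  have "\<exists>n\<ge>n0. 1 \<le> n \<and> \<phi> n \<le> real (cf_digit x (2 * n))" for n0
  proof -
    obtain t where t: "t \<in> T" "n0 \<le> t" using inf by blast
    have "t \<le> k * t" using k by (cases k) auto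
    then have "n0 \<le> k * t + r t + 1" using t by linarith
    moreover have "\<phi> (k * t + r t + 1) \<le> real (cf_digit x (2 * (k * t + r t + 1)))"
      using \<phi>[OF t(1)] x(2) t(1) by (meson of_nat_mono order_trans)
    ultimately show ?thesis by (intro exI[of _ "k * t + r t + 1"]) auto
  qed
  then show "x \<in> F_set \<phi>"
    using x(1) by (simp add: F_set_def infinite_nat_iff_unbounded_le)
qed

section \<open>Lower bound for doubly exponential growth\<close>

lemma linear_minus_exponential_bounded:
  fixes d \<kappa> L :: real
  assumes "1 < d" "0 < \<kappa>"
  obtains G where "\<And>n :: nat. n * L - \<kappa> * d ^ n \<le> G"
proof -
  have "(\<lambda>n. of_nat n * (1 / d) ^ n) \<longlonglongrightarrow> 0"
    using assms by (intro powser_times_n_limit_0) auto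
  then have "\<forall>\<^sub>F n in sequentially. of_nat n * (1 / d) ^ n < \<kappa> / (\<bar>L\<bar> + 1)"
    using assms by (intro order_tendstoD) auto
  then obtain n0 where n0: "\<And>n. n0 \<le> n \<Longrightarrow> of_nat n * (1 / d) ^ n < \<kappa> / (\<bar>L\<bar> + 1)"
    by (auto simp: eventually_sequentially)
  define G where "G = max 0 (Max ((\<lambda>n. real n * L - \<kappa> * d ^ n) ` {..n0}))"
  have "n * L - \<kappa> * d ^ n \<le> G" for n :: nat
  proof (cases "n \<le> n0")
    case True
    then show ?thesis unfolding G_def by (intro max.coboundedI2 Max_ge) auto
  next
    case False
    then have "n * (1 / d) ^ n * ((\<bar>L\<bar> + 1) * d ^ n) \<le> \<kappa> / (\<bar>L\<bar> + 1) * ((\<bar>L\<bar> + 1) * d ^ n)"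
      using n0[of n] assms by (intro mult_right_mono) auto
    then have "n * (\<bar>L\<bar> + 1) \<le> \<kappa> * d ^ n"
      using assms by (simp add: power_divide mult_ac)
    moreover have "n * L \<le> n * (\<bar>L\<bar> + 1)" by (intro mult_left_mono) auto
    ultimately show ?thesis by (simp add: G_def)
  qed
  then show thesis by (rule that)
qed

text \<open>Every time is marked, not only those where \<phi> is small: the earlier huge digits are
  what makes \<open>R\<close> decay, and extra huge digits do not spoil membership in
  \<open>F_set \<phi>\<close>.\<close>

lemma F_set_dim_ge_double_exponential:
  assumes \<beta>: "1 < \<beta>" and s: "0 < s" "s < 1 / (1 + \<beta>)"
    and \<phi>: "\<And>n0. \<exists>n\<ge>n0. \<phi> n \<le> exp (\<beta> ^ n)"
  shows "ereal s \<le> hausdorff_dim (F_set \<phi>)"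
proof -
  have s\<beta>: "s * (1 + \<beta>) < 1" using s \<beta> by (simp add: field_simps)
  have s2: "2 * s < 1"
  proof -
    have "s * 2 \<le> s * (1 + \<beta>)" using s \<beta> by (intro mult_left_mono) auto
    then show ?thesis using s\<beta> by simp
  qed
  \<comment> \<open>The word at time \<open>t\<close> is the single digit with index 2 (t + 1),
    hence \<open>Suc t\<close>.\<close>
  define N where "N t = nat \<lceil>exp (\<beta> ^ Suc t)\<rceil>" for t
  have N_ge: "exp (\<beta> ^ Suc t) \<le> real (N t)" for t unfolding N_def by linarith
  have N1: "1 \<le> N t" for t using N_ge[of t] exp_gt_zero[of "\<beta> ^ Suc t"] by (cases "N t") auto
  have ln_ge: "\<beta> ^ Suc t \<le> ln (N t)" for t
    using N_ge[of t] N1[of t] by (simp add: ln_ge_iff)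
  have ln_le: "ln (N t) \<le> \<beta> ^ Suc t + ln 2" for t
  proof -
    have "1 \<le> exp (\<beta> ^ Suc t)" using \<beta> by simp
    then have "real (N t) \<le> exp (\<beta> ^ Suc t) * 2" unfolding N_def by linarith
    then have "ln (N t) \<le> ln (exp (\<beta> ^ Suc t) * 2)" using N1[of t] by (subst ln_le_cancel_iff) auto
    also have "\<dots> = \<beta> ^ Suc t + ln 2" by (subst ln_mult) auto
    finally show ?thesis .
  qed
  define D where "D = (16 * (q_even (replicate 1 1))\<^sup>2) powr (2 * s)"
  have D0: "0 < D" unfolding D_def using q_even_pos[of "replicate 1 1"] by simp
  define R where "R t = (\<Prod>j<t. D * N j powr (2 * s - 1))" for t
  have Rpos: "0 < R t" for t unfolding R_def using D0 N1 by (intro prod_pos) (auto simp: Suc_le_eq)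
  \<comment> \<open>Minus the coefficient of \<beta>^t in the bound for ln R_t + s ln N_t. It is
    positive because s (1 + \<beta>) < 1, and then beats the linear term t ln D.\<close>
  define \<kappa> where "\<kappa> = \<beta> * ((1 - 2 * s) / (\<beta> - 1) - s)"
  have "s * (\<beta> - 1) < 1 - 2 * s" using s\<beta> by (simp add: algebra_simps)
  then have "s < (1 - 2 * s) / (\<beta> - 1)" using \<beta> by (simp add: pos_less_divide_eq)
  then have \<kappa>: "0 < \<kappa>" using \<beta> by (simp add: \<kappa>_def)
  obtain G where G: "\<And>n :: nat. n * ln D - \<kappa> * \<beta> ^ n \<le> G"
    using linear_minus_exponential_bounded[OF \<beta> \<kappa>] by blast
  define H where "H = G + s * ln 2 + (1 - 2 * s) * \<beta> / (\<beta> - 1)"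
  have lnR: "ln (R t) + s * ln (N t) \<le> H" for t
  proof -
    have "ln (R t) = (\<Sum>j<t. ln (D * N j powr (2 * s - 1)))"
      unfolding R_def using D0 N1 by (intro ln_prod) (auto simp: Suc_le_eq)
    also have "\<dots> = (\<Sum>j<t. ln D + (2 * s - 1) * ln (N j))"
      using D0 N1 by (intro sum.cong) (auto simp: ln_mult ln_powr Suc_le_eq)
    also have "\<dots> \<le> (\<Sum>j<t. ln D + (2 * s - 1) * (\<beta> * \<beta> ^ j))"
      using ln_ge s2 by (intro sum_mono add_left_mono mult_left_mono_neg) auto
    also have "\<dots> = t * ln D + (2 * s - 1) * \<beta> * ((\<beta> ^ t - 1) / (\<beta> - 1))"
      using \<beta> by (simp add: sum.distrib geometric_sum flip: sum_distrib_left mult.assoc)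
    finally have "ln (R t) + s * ln (N t) \<le> t * ln D + (2 * s - 1) * \<beta> * ((\<beta> ^ t - 1) / (\<beta> - 1)) + s * (\<beta> ^ Suc t + ln 2)"
      using ln_le[of t] s by (intro add_mono mult_left_mono) auto
    also have "\<dots> = (t * ln D - \<kappa> * \<beta> ^ t) + s * ln 2 + (1 - 2 * s) * \<beta> / (\<beta> - 1)"
      by (simp add: \<kappa>_def divide_inverse algebra_simps)
    finally show ?thesis using G[of t] by (simp add: H_def)
  qed
  define C where "C = exp H"
  have R_big: "R t \<le> C * N t powr (- s)" for t
  proof -
    have "R t = exp (ln (R t))" using Rpos by simp
    also have "\<dots> \<le> exp (H + - s * ln (N t))" using lnR[of t] by simp
    also have "\<dots> = C * N t powr (- s)" using N1[of t] by (simp add: C_def powr_def exp_diff exp_minus divide_inverse)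
    finally show ?thesis .
  qed
  have R_le: "R t \<le> C" for t
  proof -
    have "C * N t powr (- s) \<le> C * 1 powr (- s)"
      unfolding C_def using N1[of t] s by (intro mult_left_mono powr_mono2') auto
    then show ?thesis using R_big[of t] by simp
  qed
  define T where "T = {t. \<phi> (Suc t) \<le> real (N t)}"
  have T: "\<exists>t\<in>T. n0 \<le> t" for n0
  proof -
    obtain n where n: "Suc n0 \<le> n" "\<phi> n \<le> exp (\<beta> ^ n)" using \<phi> by blast
    then show ?thesis using N_ge[of "n - 1"] by (intro bexI[of _ "n - 1"]) (auto simp: T_def)
  qed
  have "ereal s \<le> hausdorff_dim {x \<in> I_even. \<forall>t\<in>UNIV. N t \<le> cf_digit x (2 * (1 * t + 0 + 1))}"
  proof (rule hausdorff_dim_ge_marked[where W = "{[1]}" and R = R and C = C and D = D])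
    show "R t * (D * N t powr (2 * s - 1)) \<le> R (Suc t)" for t by (simp add: R_def)
  qed (use s s2 N1 R_le R_big D_def less_imp_le[OF Rpos] in \<open>auto simp: words_def R_def\<close>)
  also have "\<dots> \<le> hausdorff_dim {x \<in> I_even. \<forall>t\<in>T. N t \<le> cf_digit x (2 * (1 * t + 0 + 1))}"
    by (intro hausdorff_dim_mono) auto
  also have "\<dots> \<le> hausdorff_dim (F_set \<phi>)"
    by (intro hausdorff_dim_mono F_set_supersetI T) (auto simp: T_def)
  finally show ?thesis .
qed

section \<open>Lower bound for exponential growth\<close>

lemma powr_power_swap: "0 < (x::real) \<Longrightarrow> (x powr (- (real m * s))) ^ n = (x ^ (m * n)) powr (- s)"
  by (simp add: powr_def ln_realpow mult_ac flip: exp_of_nat_mult)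

text \<open>An ordinary word multiplies \<open>R\<close> by \<open>\<delta>\<close>, at most b / 2,
  whereas N_t^(-s) only falls like b^t. So \<open>R\<close> eventually drops below N_t^(-s) at a
  time where \<phi> is small, and only then is a marked word inserted.\<close>

lemma F_set_dim_ge_s_num:
  assumes B: "1 < B" and \<phi>: "\<And>B' n0. B < B' \<Longrightarrow> \<exists>n\<ge>n0. \<phi> n \<le> B' ^ (2 * n)"
  shows "ereal (s_num B) \<le> hausdorff_dim (F_set \<phi>)"
proof (rule dense_le)
  fix x assume x: "x < ereal (s_num B)"
  show "x \<le> hausdorff_dim (F_set \<phi>)"
  proof (cases "x \<le> 0")
    case True
    then show ?thesis using hausdorff_dim_nonneg order_trans by blast
  next
    case False
    then obtain s where s: "x = ereal s" "0 < s" "s < s_num B" using x by (cases x) auto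
    then have s1: "s \<le> 1" using s_num_le_1[of B] B by simp
    \<comment> \<open>4^s is the loss per concatenation; the extra 2 brings \<open>\<delta>\<close>
      down to b / 2.\<close>
    obtain B' k W where B': "B < B'" and k: "1 \<le> k" and W: "finite W" "W \<subseteq> words k"
      and Q: "2 * 4 powr s * B' powr (2 * k * s) \<le> (\<Sum>u\<in>W. q_even u powr (- 2 * s))"
      using s_sum_growth_below_s_num[OF B s(2,3)] by metis
    have B1: "1 < B'" using B B' by simp
    define Q where "Q = (\<Sum>u\<in>W. q_even u powr (- 2 * s))"
    define b where "b = B' powr (- (2 * k * s))"
    have b: "0 < b" using B1 by (simp add: b_def)
    define \<delta> where "\<delta> = 4 powr s / Q"
    have Q0: "0 < Q" using Q B1 unfolding Q_def by (smt (verit) mult_pos_pos powr_gt_zero)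
    have bB: "b * B' powr (2 * k * s) = 1" using B1 unfolding b_def by (simp flip: powr_add)
    have \<delta>: "0 < \<delta>" "\<delta> \<le> b / 2" "\<delta> \<le> 1"
    proof -
      show "0 < \<delta>" using Q0 by (simp add: \<delta>_def)
      have "2 * 4 powr s = b * (2 * 4 powr s * B' powr (2 * k * s))" using bB by simp
      also have "\<dots> \<le> b * Q" using Q b unfolding Q_def by (intro mult_left_mono) auto
      finally show "\<delta> \<le> b / 2" using Q0 by (simp add: \<delta>_def field_simps)
      moreover have "b \<le> B' powr 0" unfolding b_def using B1 s k by (intro powr_mono) auto
      ultimately show "\<delta> \<le> 1" using B1 by simp
    qed
    have Wne: "W \<noteq> {}" using Q0 by (auto simp: Q_def)
    \<comment> \<open>The blocks of \<open>k\<close> even-indexed digits that contain an index where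
      \<phi> is small.\<close>
    define S where "S = {t. \<exists>r<k. \<phi> (k * t + r + 1) \<le> B' ^ (2 * (k * t + r + 1))}"
    have S_inf: "\<exists>t\<in>S. n0 \<le> t" for n0
    proof -
      obtain n where n: "k * n0 + 1 \<le> n" "\<phi> n \<le> B' ^ (2 * n)" using \<phi>[OF B'] by blast
      define t r where "t = (n - 1) div k" and "r = (n - 1) mod k"
      have eq: "k * t + r + 1 = n" using n(1) by (simp add: t_def r_def)
      have "r < k" using k by (simp add: r_def)
      moreover have "\<phi> (k * t + r + 1) \<le> B' ^ (2 * (k * t + r + 1))" using n(2) unfolding eq .
      ultimately have "t \<in> S" unfolding S_def by blast
      moreover have "k * n0 div k \<le> (n - 1) div k" using n(1) by (intro div_le_mono) simp
      then have "n0 \<le> t" using k by (simp add: t_def)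
      ultimately show ?thesis by blast
    qed
    have "\<forall>t. \<exists>r<k. t \<in> S \<longrightarrow> \<phi> (k * t + r + 1) \<le> B' ^ (2 * (k * t + r + 1))"
      unfolding S_def using k by auto (metis less_eq_Suc_le)
    then obtain r where r: "\<And>t. r t < k" "\<And>t. t \<in> S \<Longrightarrow> \<phi> (k * t + r t + 1) \<le> B' ^ (2 * (k * t + r t + 1))"
      by metis
    \<comment> \<open>Taken at the end of the block, so that it dominates B'^(2n) for every index n
      in it.\<close>
    define N where "N t = nat \<lceil>B' ^ (2 * (k * Suc t))\<rceil>" for t
    have N_ge: "B' ^ (2 * (k * Suc t)) \<le> real (N t)" for t unfolding N_def by linarith
    have pow_ge: "1 \<le> B' ^ (2 * (k * Suc t))" for t using B1 by (intro one_le_power) simp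
    have N_le: "real (N t) \<le> 2 * B' ^ (2 * (k * Suc t))" for t
      using pow_ge[of t] unfolding N_def by linarith
    have N1: "1 \<le> N t" for t using N_ge[of t] pow_ge[of t] by linarith
    define D where "D = (16 * (q_even (replicate k 1))\<^sup>2) powr (2 * s)"
    have D0: "0 < D" unfolding D_def using q_even_pos[of "replicate k 1"] by simp
    \<comment> \<open>A greedy rule: a time in \<open>S\<close> is marked as soon as
      \<open>R\<close> has come down to N_t^(-s), and the set \<open>T\<close> of marked times is
      read off from the recursion.\<close>
    define R where "R = rec_nat 1 (\<lambda>t R. if t \<in> S \<and> R \<le> N t powr (- s) then R * (D * N t powr (2 * s - 1)) else R * \<delta>)"
    have R0: "R 0 = 1" by (simp add: R_def)
    have R_Suc: "R (Suc t) = (if t \<in> S \<and> R t \<le> N t powr (- s) then R t * (D * N t powr (2 * s - 1)) else R t * \<delta>)" for t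
      by (simp add: R_def)
    have R_pos: "0 < R t" for t
    proof (induction t)
      case (Suc t)
      then show ?case using D0 \<delta>(1) N1[of t] by (simp add: R_Suc)
    qed (simp add: R0)
    define T where "T = {t \<in> S. R t \<le> N t powr (- s)}"
    have R_small: "R (Suc t) = R t * \<delta>" if "t \<notin> T" for t
    proof -
      have "\<not> (t \<in> S \<and> R t \<le> N t powr (- s))" using that by (simp add: T_def)
      then show ?thesis by (simp only: R_Suc if_False)
    qed
    define C where "C = max 1 D"
    have R_le: "R t \<le> C" for t
    proof (induction t)
      case (Suc t)
      show ?case
      proof (cases "t \<in> T")
        case True
        \<comment> \<open>N^(-s) N^(2s - 1) = N^(s - 1) \<le> 1, so a marked word lifts
          \<open>R\<close> to \<open>D\<close> at most.\<close>
        then have "R (Suc t) \<le> N t powr (- s) * (D * N t powr (2 * s - 1))"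
          using D0 unfolding R_Suc T_def by (auto intro!: mult_right_mono)
        also have "\<dots> = D * (N t powr (- s) * N t powr (2 * s - 1))" by simp
        also have "N t powr (- s) * N t powr (2 * s - 1) = N t powr (s - 1)" by (simp flip: powr_add)
        also have "D * N t powr (s - 1) \<le> D * 1"
        proof (intro mult_left_mono)
          have "N t powr (s - 1) \<le> N t powr 0" using N1[of t] s1 by (intro powr_mono) auto
          then show "N t powr (s - 1) \<le> 1" using N1[of t] by simp
        qed (use D0 in simp)
        finally show ?thesis by (simp add: C_def)
      next
        case False
        then have "R (Suc t) = R t * \<delta>" by (rule R_small)
        also have "\<dots> \<le> R t * 1" using \<delta> R_pos[of t] by (intro mult_left_mono) auto
        finally show ?thesis using Suc by simp
      qed
    qed (simp add: R0 C_def)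
    have T_inf: "\<exists>t\<in>T. n0 \<le> t" for n0
    proof (rule ccontr)
      assume "\<not> (\<exists>t\<in>T. n0 \<le> t)"
      then have notT: "n0 + j \<notin> T" for j by auto
      have R_dec: "R (n0 + j) \<le> R n0 * (b / 2) ^ j" for j
      proof (induction j)
        case (Suc j)
        have "R (n0 + Suc j) = R (n0 + j) * \<delta>" using R_small[OF notT[of j]] by simp
        also have "\<dots> \<le> (R n0 * (b / 2) ^ j) * (b / 2)"
          using Suc \<delta> R_pos[of n0] b by (intro mult_mono) auto
        finally show ?case by (simp add: mult_ac)
      qed simp
      have "(\<lambda>j. (1 / 2 :: real) ^ j) \<longlonglongrightarrow> 0" by (intro LIMSEQ_power_zero) simp
      moreover have "0 < 2 powr (- s) * b ^ Suc n0 / R n0" using b R_pos[of n0] by simp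
      ultimately have "\<forall>\<^sub>F j in sequentially. (1 / 2) ^ j < 2 powr (- s) * b ^ Suc n0 / R n0"
        by (rule order_tendstoD)
      then obtain j0 where j0: "\<And>j. j0 \<le> j \<Longrightarrow> (1 / 2) ^ j < 2 powr (- s) * b ^ Suc n0 / R n0"
        by (auto simp: eventually_sequentially)
      obtain t where t: "t \<in> S" "n0 + j0 \<le> t" using S_inf by blast
      define j where "j = t - n0"
      have j: "t = n0 + j" "j0 \<le> j" using t(2) by (auto simp: j_def)
      have "R n0 * (1 / 2) ^ j \<le> 2 powr (- s) * b ^ Suc n0"
        using j0[OF j(2)] R_pos[of n0] by (simp add: field_simps)
      then have "R n0 * (1 / 2) ^ j * b ^ j \<le> 2 powr (- s) * b ^ Suc n0 * b ^ j"
        using b by (intro mult_right_mono) auto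
      also have "\<dots> = 2 powr (- s) * b ^ Suc t" by (simp add: j(1) power_add mult_ac)
      also have "b ^ Suc t = (B' ^ (2 * (k * Suc t))) powr (- s)"
        using powr_power_swap[of B' "2 * k" s "Suc t"] B1 by (simp add: b_def mult.assoc del: power_Suc mult_Suc_right)
      also have "2 powr (- s) * \<dots> = (2 * B' ^ (2 * (k * Suc t))) powr (- s)" by (simp only: powr_mult)
      also have "\<dots> \<le> N t powr (- s)" using N_le[of t] N1[of t] s by (intro powr_mono2') auto
      finally have "R n0 * (1 / 2) ^ j * b ^ j \<le> N t powr (- s)" .
      moreover have "R t \<le> R n0 * (1 / 2) ^ j * b ^ j"
        using R_dec[of j] by (simp add: j(1) power_divide)
      ultimately have "t \<in> T" using t(1) by (simp add: T_def)
      then show False using notT[of j] j by simp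
    qed
    have "ereal s \<le> hausdorff_dim {x \<in> I_even. \<forall>t\<in>T. N t \<le> cf_digit x (2 * (k * t + r t + 1))}"
    proof (rule hausdorff_dim_ge_marked[where W = W and R = R and C = C and D = D])
      show "R t * (D * N t powr (2 * s - 1)) \<le> R (Suc t)" if "t \<in> T" for t
        using that by (simp add: R_Suc T_def)
      show "R t * (4 powr s / (\<Sum>u\<in>W. q_even u powr (- 2 * s))) \<le> R (Suc t)" if "t \<notin> T" for t
        using R_small[OF that] by (simp add: \<delta>_def Q_def)
      show "R t \<le> C * N t powr (- s)" if "t \<in> T" for t
      proof -
        have "1 * N t powr (- s) \<le> C * N t powr (- s)" by (intro mult_right_mono) (auto simp: C_def)
        then show ?thesis using that by (simp add: T_def)
      qed
    qed (use s s1 k W Wne r N1 D_def R0 R_le less_imp_le[OF R_pos] in auto)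
    also have "\<dots> \<le> hausdorff_dim (F_set \<phi>)"
    proof (intro hausdorff_dim_mono F_set_supersetI T_inf k)
      fix t assume "t \<in> T"
      then have "\<phi> (k * t + r t + 1) \<le> B' ^ (2 * (k * t + r t + 1))" using r(2) by (simp add: T_def)
      also have "\<dots> \<le> B' ^ (2 * (k * Suc t))" using B1 r(1)[of t] by (intro power_increasing) auto
      also have "\<dots> \<le> N t" by (rule N_ge)
      finally show "\<phi> (k * t + r t + 1) \<le> real (N t)" .
    qed
    finally show ?thesis by (simp add: s(1))
  qed
qed

section \<open>From the lower limits to bounds on \<open>\<phi>\<close>, and the five cases\<close>

lemma ereal_le_of_all_greater:
  fixes x :: ereal
  assumes "\<And>z. y < z \<Longrightarrow> x \<le> ereal z"
  shows "x \<le> ereal y"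
  by (rule dense_ge) (use assms in \<open>auto elim!: less_ereal.elims\<close>)

lemma eventually_power_le_of_liminf:
  assumes pos: "\<And>n. 1 \<le> n \<Longrightarrow> 0 < \<phi> n" and B: "1 < (B::real)"
    and lim: "ereal (ln B) < liminf (\<lambda>n. ereal (ln (\<phi> n) / (2 * real n)))"
  shows "\<forall>\<^sub>F n in sequentially. B ^ (2 * n) \<le> \<phi> n"
  using less_LiminfD[OF lim] eventually_ge_at_top[of 1]
proof eventually_elim
  case (elim n)
  then have "(2 * n) * ln B < ln (\<phi> n)" by (simp add: field_simps)
  then have "exp ((2 * n) * ln B) \<le> exp (ln (\<phi> n))" by simp
  then show ?case using pos[of n] elim B by (simp add: exp_of_nat_mult flip: of_nat_mult)
qed

lemma frequently_le_power_of_liminf: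
  assumes pos: "\<And>n. 1 \<le> n \<Longrightarrow> 0 < \<phi> n" and B: "1 < (B::real)"
    and lim: "liminf (\<lambda>n. ereal (ln (\<phi> n) / (2 * real n))) < ereal (ln B)"
  shows "\<exists>n\<ge>n0. \<phi> n \<le> B ^ (2 * n)"
proof (rule ccontr)
  assume none: "\<not> (\<exists>n\<ge>n0. \<phi> n \<le> B ^ (2 * n))"
  have "\<forall>\<^sub>F n in sequentially. ereal (ln B) \<le> ereal (ln (\<phi> n) / (2 * real n))"
    using eventually_ge_at_top[of "max 1 n0"]
  proof eventually_elim
    case (elim n)
    then have "B ^ (2 * n) < \<phi> n" using none by (meson max.boundedE not_le)
    then have "ln (B ^ (2 * n)) \<le> ln (\<phi> n)" using B pos[of n] elim by (subst ln_le_cancel_iff) auto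
    then show ?case using B elim by (simp add: ln_realpow field_simps)
  qed
  then have "ereal (ln B) \<le> liminf (\<lambda>n. ereal (ln (\<phi> n) / (2 * real n)))" by (rule Liminf_bounded)
  then show False using lim by simp
qed

lemma eventually_exp_le_of_liminf:
  assumes gt1: "\<forall>\<^sub>F n in sequentially. 1 < \<phi> n" and c: "1 < (c::real)"
    and lim: "ereal (ln c / 2) < liminf (\<lambda>n. ereal (ln (ln (\<phi> n)) / (2 * real n)))"
  shows "\<forall>\<^sub>F n in sequentially. exp (c ^ n) \<le> \<phi> n"
  using less_LiminfD[OF lim] gt1 eventually_ge_at_top[of 1]
proof eventually_elim
  case (elim n)
  then have "n * ln c < ln (ln (\<phi> n))" by (simp add: field_simps)
  then have "exp (n * ln c) \<le> exp (ln (ln (\<phi> n)))" by simp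
  then have "c ^ n \<le> ln (\<phi> n)" using elim c by (simp add: exp_of_nat_mult)
  then show ?case using elim by (simp add: ln_ge_iff)
qed

lemma frequently_le_exp_of_liminf:
  assumes gt1: "\<forall>\<^sub>F n in sequentially. 1 < \<phi> n" and c: "1 < (c::real)"
    and lim: "liminf (\<lambda>n. ereal (ln (ln (\<phi> n)) / (2 * real n))) < ereal (ln c / 2)"
  shows "\<exists>n\<ge>n0. \<phi> n \<le> exp (c ^ n)"
proof (rule ccontr)
  assume none: "\<not> (\<exists>n\<ge>n0. \<phi> n \<le> exp (c ^ n))"
  have "\<forall>\<^sub>F n in sequentially. ereal (ln c / 2) \<le> ereal (ln (ln (\<phi> n)) / (2 * real n))"
    using eventually_ge_at_top[of "max 1 n0"] gt1
  proof eventually_elim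
    case (elim n)
    then have "exp (c ^ n) < \<phi> n" using none by (meson max.boundedE not_le)
    then have "c ^ n \<le> ln (\<phi> n)" using elim by (simp add: ln_ge_iff)
    moreover have "0 < c ^ n" using c by simp
    ultimately have "ln (c ^ n) \<le> ln (ln (\<phi> n))" by (subst ln_le_cancel_iff) auto
    then show ?case using c elim by (simp add: ln_realpow field_simps)
  qed
  then have "ereal (ln c / 2) \<le> liminf (\<lambda>n. ereal (ln (ln (\<phi> n)) / (2 * real n)))" by (rule Liminf_bounded)
  then show False using lim by simp
qed

lemma F_set_dim_eq_s_num:
  assumes pos: "\<And>n. 1 \<le> n \<Longrightarrow> 0 < \<phi> n" and B: "1 < B"
    and lim: "liminf (\<lambda>n. ereal (ln (\<phi> n) / (2 * real n))) = ereal (ln B)"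
  shows "hausdorff_dim (F_set \<phi>) = ereal (s_num B)"
proof (rule antisym)
  show "ereal (s_num B) \<le> hausdorff_dim (F_set \<phi>)"
  proof (rule F_set_dim_ge_s_num[OF B])
    fix B' n0 assume "B < B'"
    then show "\<exists>n\<ge>n0. \<phi> n \<le> B' ^ (2 * n)"
      using B by (intro frequently_le_power_of_liminf pos) (auto simp: lim)
  qed
  show "hausdorff_dim (F_set \<phi>) \<le> ereal (s_num B)"
  proof (rule ereal_le_of_all_greater)
    fix s assume s: "s_num B < s"
    then have s0: "0 < s" using s_num_nonneg[of B] B by simp
    obtain B' C \<delta> where *: "1 < B'" "B' < B" "0 \<le> C" "0 < \<delta>" "\<delta> < 1" "\<And>n. s_sum B' n s \<le> ennreal (C * \<delta> ^ n)"
      using s_sum_decay_above_s_num[OF B s] by blast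
    have "\<forall>\<^sub>F n in sequentially. B' ^ (2 * n) \<le> \<phi> n"
      using * by (intro eventually_power_le_of_liminf pos) (auto simp: lim)
    then show "hausdorff_dim (F_set \<phi>) \<le> ereal s"
      using F_set_dim_le_exponential[OF s0 *(1,3,4,5,6)] by blast
  qed
qed

text \<open>For s > 1/2 the sum over one digit is finite at base 1, and the base B divides it by
  B^(2s). Taking B^(2s) = Z + 2 makes it less than 1 and keeps B > 1 even if Z = 0.\<close>

lemma F_set_dim_le_half:
  assumes "\<And>B. 1 < B \<Longrightarrow> \<forall>\<^sub>F n in sequentially. B ^ (2 * n) \<le> \<phi> n"
  shows "hausdorff_dim (F_set \<phi>) \<le> ereal (1 / 2)"
proof (rule ereal_le_of_all_greater)
  fix s :: real assume s: "1 / 2 < s"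
  obtain Z where Z: "0 \<le> Z" "s_sum 1 1 s \<le> ennreal Z" using s_sum_1_1_finite[OF s] by blast
  define B where "B = (Z + 2) powr (1 / (2 * s))"
  have B: "1 < B" unfolding B_def using Z s by (intro gr_one_powr) auto
  have B2: "B powr (2 * s) = Z + 2" using Z s by (simp add: B_def powr_powr)
  have "s_sum B 1 s \<le> ennreal (Z / (Z + 2))"
  proof (rule s_sum_least)
    fix F assume F: "finite F" "F \<subseteq> words 1"
    have "s_weight B s u = s_weight 1 s u / (Z + 2)" if "u \<in> F" for u
    proof -
      have "length u = 1" using that F(2) by (auto simp: words_def)
      moreover have "(B\<^sup>2) powr (- s) = 1 / (Z + 2)"
        using powr_powr[of B 2 "- s"] B B2 by (simp add: powr_minus_divide)
      ultimately show ?thesis by (simp add: s_weight_def powr_mult)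
    qed
    then have "(\<Sum>u\<in>F. s_weight B s u) = (\<Sum>u\<in>F. s_weight 1 s u) / (Z + 2)"
      by (simp add: sum_divide_distrib)
    also have "\<dots> \<le> Z / (Z + 2)"
      using s_sum_finite_le[OF Z(2,1) F] Z by (intro divide_right_mono) auto
    finally show "ennreal (\<Sum>u\<in>F. s_weight B s u) \<le> ennreal (Z / (Z + 2))" by (rule ennreal_leI)
  qed
  also have "\<dots> < 1" using Z by (simp add: ennreal_less_one_iff)
  finally obtain C \<delta> where "0 \<le> C" "0 < \<delta>" "\<delta> < 1" "\<And>n. s_sum B n s \<le> ennreal (C * \<delta> ^ n)"
    using s_sum_geometric_decay[of B s 1] B s by auto
  then show "hausdorff_dim (F_set \<phi>) \<le> ereal s"
    using s B assms[OF B] by (intro F_set_dim_le_exponential) auto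
qed

text \<open>Below the claimed value there is room for a base \<gamma> > \<beta>, taken halfway
  between \<beta> and 1 / s - 1. The value \<beta> = 1 is included to obtain 1/2.\<close>

lemma F_set_dim_ge_of_frequently:
  assumes \<beta>: "1 \<le> \<beta>" and freq: "\<And>\<gamma> n0. \<beta> < \<gamma> \<Longrightarrow> \<exists>n\<ge>n0. \<phi> n \<le> exp (\<gamma> ^ n)"
  shows "ereal (1 / (1 + \<beta>)) \<le> hausdorff_dim (F_set \<phi>)"
proof (rule dense_le)
  fix x assume x: "x < ereal (1 / (1 + \<beta>))"
  show "x \<le> hausdorff_dim (F_set \<phi>)"
  proof (cases "x \<le> 0")
    case True
    then show ?thesis using hausdorff_dim_nonneg order_trans by blast
  next
    case False
    then obtain s where s: "x = ereal s" "0 < s" "s < 1 / (1 + \<beta>)" using x by (cases x) auto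
    then have "s * (1 + \<beta>) < 1" using \<beta> by (simp add: field_simps)
    define \<gamma> where "\<gamma> = (\<beta> + (1 / s - 1)) / 2"
    have "\<beta> < 1 / s - 1" using s \<beta> by (simp add: field_simps)
    then have \<gamma>: "\<beta> < \<gamma>" "\<gamma> < 1 / s - 1" by (simp_all add: \<gamma>_def)
    then have "s < 1 / (1 + \<gamma>)" using s \<beta> by (simp add: field_simps)
    then show ?thesis
      unfolding s(1) using \<gamma> \<beta> s freq by (intro F_set_dim_ge_double_exponential[of \<gamma>]) auto
  qed
qed

lemma F_set_dim_le_of_eventually:
  assumes \<beta>: "1 < \<beta>" and ev: "\<And>c. 1 < c \<Longrightarrow> c < \<beta> \<Longrightarrow> \<forall>\<^sub>F n in sequentially. exp (c ^ n) \<le> \<phi> n"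
  shows "hausdorff_dim (F_set \<phi>) \<le> ereal (1 / (1 + \<beta>))"
proof (rule ereal_le_of_all_greater)
  fix s :: real assume s: "1 / (1 + \<beta>) < s"
  moreover have "0 < 1 / (1 + \<beta>)" using \<beta> by simp
  ultimately have s0: "0 < s" by linarith
  have "1 / s - 1 < \<beta>" using s s0 \<beta> by (simp add: field_simps)
  then have "max 1 (1 / s - 1) < \<beta>" using \<beta> by simp
  \<comment> \<open>Two bases below \<beta> are used: \<open>d\<close> determines the exponent, and
    the strictly larger \<open>c\<close> makes the digits outgrow it, so that records occur.\<close>
  then obtain d where d: "max 1 (1 / s - 1) < d" "d < \<beta>" using dense by blast
  then obtain c where c: "d < c" "c < \<beta>" using dense by blast
  have "1 / s - 1 < d" "1 < d" using d by auto
  then have "1 / (1 + d) < s" using s0 by (simp add: field_simps)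
  then show "hausdorff_dim (F_set \<phi>) \<le> ereal s"
    using d c ev[of c] by (intro F_set_dim_le_double_exponential[of d c]) auto
qed

theorem theorem1p6:
  fixes \<phi> :: "nat \<Rightarrow> real" and B b :: ereal
  assumes "\<And>n. 1 \<le> n \<Longrightarrow> 0 < \<phi> n"
    and "1 \<le> B"
    and "liminf (\<lambda>n. ereal (ln (\<phi> n) / (2 * real n))) = elog B"
    and "B = \<infinity> \<Longrightarrow> 1 \<le> b"
    and "B = \<infinity> \<Longrightarrow> liminf (\<lambda>n. ereal (ln (ln (\<phi> n)) / (2 * real n))) = elog b"
  shows "(B = 1 \<longrightarrow>
            ereal s_one \<le> hausdorff_dim (F_set \<phi>) \<and> hausdorff_dim (F_set \<phi>) \<le> hausdorff_dim I_even)
       \<and> (1 < B \<and> B < \<infinity> \<longrightarrow> hausdorff_dim (F_set \<phi>) = ereal (s_num (real_of_ereal B)))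
       \<and> (B = \<infinity> \<and> b = 1 \<longrightarrow> hausdorff_dim (F_set \<phi>) = ereal (1 / 2))
       \<and> (B = \<infinity> \<and> 1 < b \<and> b < \<infinity> \<longrightarrow>
            hausdorff_dim (F_set \<phi>) = ereal (1 / (1 + (real_of_ereal b)\<^sup>2)))
       \<and> (B = \<infinity> \<and> b = \<infinity> \<longrightarrow> hausdorff_dim (F_set \<phi>) = 0)"
proof (intro conjI impI; (elim conjE)?)
  assume B: "B = 1"
  show "hausdorff_dim (F_set \<phi>) \<le> hausdorff_dim I_even"
    by (intro hausdorff_dim_mono F_set_subset)
  \<comment> \<open>The liminf is 0, below ln B' for every B' > x, and the lower bound only asks
    \<phi> to be small infinitely often; so it applies at every base x > 1.\<close>
  have "ereal (s_num x) \<le> hausdorff_dim (F_set \<phi>)" if x: "1 < x" for x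
  proof (rule F_set_dim_ge_s_num[OF x])
    fix B' n0 assume "x < B'"
    then show "\<exists>n\<ge>n0. \<phi> n \<le> B' ^ (2 * n)"
      using x by (intro frequently_le_power_of_liminf assms(1)) (auto simp: assms(3) B elog_def)
  qed
  then have "\<forall>\<^sub>F x in at_right 1. ereal (s_num x) \<le> hausdorff_dim (F_set \<phi>)"
    by (intro eventually_mono[OF eventually_at_right_less[of "1 :: real"]])
  moreover have "((\<lambda>x. ereal (s_num x)) \<longlongrightarrow> ereal s_one) (at_right 1)"
    using s_num_at_right_1 by (intro tendsto_intros)
  ultimately show "ereal s_one \<le> hausdorff_dim (F_set \<phi>)"
    by (intro tendsto_upperbound) auto
next
  assume B: "1 < B" "B < \<infinity>"
  then obtain x where x: "B = ereal x" "1 < x" by (cases B) auto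
  show "hausdorff_dim (F_set \<phi>) = ereal (s_num (real_of_ereal B))"
    using F_set_dim_eq_s_num[OF assms(1) x(2)] assms(3) by (simp add: x elog_def)
next
  assume B: "B = \<infinity>"
  have ev: "\<forall>\<^sub>F n in sequentially. x ^ (2 * n) \<le> \<phi> n" if "1 < x" for x
    using that by (intro eventually_power_le_of_liminf assms(1)) (auto simp: assms(3) B elog_def)
  have ev2: "\<forall>\<^sub>F n in sequentially. 2 ^ (2 * n) \<le> \<phi> n" by (rule ev) simp
  \<comment> \<open>Infinite \<open>B\<close> pushes \<phi> above 1 eventually, so that ln (ln
    \<phi>) is the logarithm of a positive number.\<close>
  have gt1: "\<forall>\<^sub>F n in sequentially. 1 < \<phi> n"
    using ev2 eventually_gt_at_top[of 0]
  proof eventually_elim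
    case (elim n)
    have "1 < (2::real) ^ (2 * n)" using elim by (intro one_less_power) auto
    then show ?case using elim(1) by linarith
  qed
  {
    assume b: "b = 1"
    have "\<exists>n\<ge>n0. \<phi> n \<le> exp (\<gamma> ^ n)" if "1 < \<gamma>" for \<gamma> n0
      using that by (intro frequently_le_exp_of_liminf gt1) (auto simp: assms(5)[OF B] b elog_def)
    then have "ereal (1 / 2) \<le> hausdorff_dim (F_set \<phi>)"
      using F_set_dim_ge_of_frequently[of 1 \<phi>] by simp
    then show "hausdorff_dim (F_set \<phi>) = ereal (1 / 2)"
      using F_set_dim_le_half[OF ev] by (intro antisym)
  next
    assume b: "1 < b" "b < \<infinity>"
    then obtain x where x: "b = ereal x" "1 < x" by (cases b) auto
    \<comment> \<open>The hypothesis is normalised by 2n, the bounds exp(c^n) by n; this turns b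
      into b^2.\<close>
    have lim: "liminf (\<lambda>n. ereal (ln (ln (\<phi> n)) / (2 * real n))) = ereal (ln (x\<^sup>2) / 2)"
      using assms(5)[OF B] x by (simp add: elog_def ln_realpow)
    have x2: "1 < x\<^sup>2" using x by (simp add: one_less_power)
    have "ereal (1 / (1 + x\<^sup>2)) \<le> hausdorff_dim (F_set \<phi>)"
    proof (rule F_set_dim_ge_of_frequently)
      fix \<gamma> n0 assume \<gamma>: "x\<^sup>2 < \<gamma>"
      then have "ln (x\<^sup>2) < ln \<gamma>" using x2 by (subst ln_less_cancel_iff) linarith+
      then show "\<exists>n\<ge>n0. \<phi> n \<le> exp (\<gamma> ^ n)"
        using x2 \<gamma> by (intro frequently_le_exp_of_liminf gt1) (simp_all add: lim)
    qed (use x2 in simp)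
    moreover have "hausdorff_dim (F_set \<phi>) \<le> ereal (1 / (1 + x\<^sup>2))"
    proof (rule F_set_dim_le_of_eventually[OF x2])
      fix c assume c: "1 < c" "c < x\<^sup>2"
      then have "ln c < ln (x\<^sup>2)" using x2 by (subst ln_less_cancel_iff) linarith+
      then show "\<forall>\<^sub>F n in sequentially. exp (c ^ n) \<le> \<phi> n"
        using c by (intro eventually_exp_le_of_liminf gt1) (simp_all add: lim)
    qed
    ultimately show "hausdorff_dim (F_set \<phi>) = ereal (1 / (1 + (real_of_ereal b)\<^sup>2))"
      by (simp add: x antisym)
  next
    assume b: "b = \<infinity>"
    have "hausdorff_dim (F_set \<phi>) \<le> ereal 0"
    proof (rule ereal_le_of_all_greater)
      fix s :: real assume s: "0 < s"
      have "\<forall>\<^sub>F n in sequentially. exp (c ^ n) \<le> \<phi> n" if "1 < c" for c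
        using that by (intro eventually_exp_le_of_liminf gt1) (auto simp: assms(5)[OF B] b elog_def)
      \<comment> \<open>\<beta> = 1 + 1 / s is large enough for 1 / (1 + \<beta>) \<le> s.\<close>
      then have "hausdorff_dim (F_set \<phi>) \<le> ereal (1 / (1 + (1 + 1 / s)))"
        using s by (intro F_set_dim_le_of_eventually) auto
      also have "1 / (1 + (1 + 1 / s)) \<le> s" using s by (simp add: field_simps)
      finally show "hausdorff_dim (F_set \<phi>) \<le> ereal s" by simp
    qed
    then show "hausdorff_dim (F_set \<phi>) = 0"
      using hausdorff_dim_nonneg[of "F_set \<phi>"] by (simp add: antisym zero_ereal_def)
  }
qed

end
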